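(* Let $\mathcal{D}\subset\mathbb{R}^n$ be compact, $r\geq 2$, $T>0$, $\varepsilon_0>0$, and let $g\in\mathcal{C}^r(\mathcal{D}\times\mathbb{R}/T\mathbb{Z}\times[0,\varepsilon_0],\mathbb{R}^n)$. Consider the system $$\dot x=\varepsilon g(x,t,\varepsilon) \qquad (A)$$ and its averaged system $$\dot y^0=\varepsilon\langle g\rangle(y^0),\qquad \langle g\rangle(x)=\frac1T\int_0^T g(x,t,0)\,dt. \qquad (B)$$ There exists a $\mathcal{C}^r$ change of coordinates $x=y+\varepsilon w(y,t)$, with $w$ a $T$-periodic function of $t$, transforming (A) into $$\dot y=\varepsilon\langle g\rangle(y)+\varepsilon^2 g_1(y,t,\varepsilon),$$ with $g_1$ also $T$-periodic in $t$. Moreover: (1) If $x(t)$ and $y^0(t)$ are solutions of the original system (A) and of the averaged system (B), respectively, with initial conditions satisfying $x(0)=y^0(0)+\mathcal{O}(\varepsilon)$, then $x(t)=y^0(t)+\mathcal{O}(\varepsilon)$ for times $t$ of order $1/\varepsilon$. (2) If $y^\star$ is an equilibrium point of (B) such that the Jacobian matrix $\frac{\partial}{\partial y}\langle g\rangle(y^\star)$ has no eigenvalue equal to zero, then (A) admits a $T$-periodic solution $\gamma_\varepsilon(t)=y^\star+\mathcal{O}(\varepsilon)$ for sufficiently small $\varepsilon$. If, in addition, $\frac{\partial}{\partial y}\langle g\rangle(y^\star)$ has no imaginary eigenvalue, then $\gamma_\varepsilon(t)$ has the same type of stability as $y^\star$ for sufficiently small $\varepsilon$.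
   Context: The parameter $\varepsilon\in[0,\varepsilon_0]$ is small, and solutions are considered as long as they remain in $\mathcal{D}$. "Times of order $1/\varepsilon$" means times $0\leq t\leq c/\varepsilon$ with a constant $c>0$ independent of $\varepsilon$; $\mathcal{O}(\varepsilon)$ denotes a quantity bounded in norm by a constant (independent of $\varepsilon$ and of $t$ in the range considered) times $\varepsilon$. "Imaginary" means with zero real part. The type of stability of the periodic solution $\gamma_\varepsilon$ is that of the corresponding fixed point of the time-$T$ (Poincaré) map of (A); "same type of stability" means that the linearization of this map at its fixed point, and the linearization at $y^\star$ of the time-$T$ map of (B), are both hyperbolic with the same numbers of eigenvalues inside and outside the unit circle.
   Formalization: In (2), y* is assumed to lie in the interior of D (for D=[0,1], g=x+ε, y*=0 the only periodic solution x=−ε leaves D), and the same type of stability is asserted for small ε>0 only (at ε=0 both time-T maps are the identity). *)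

theory Defs
  imports "HOL-Analysis.Analysis" "HOL-Computational_Algebra.Polynomial"
begin

text \<open>\<open>C\<^sup>k\<close> regularity on an open set. Iterated directional derivatives stand in for the
  iterated total derivatives, whose type would depend on \<open>k\<close>; on a Euclidean space this is the
  usual notion, because the directional derivatives along all \<open>v\<close> determine the total one.\<close>

primrec Ck_open :: "nat \<Rightarrow> ('a::euclidean_space \<Rightarrow> 'b::real_normed_vector) \<Rightarrow> 'a set \<Rightarrow> bool" where
  "Ck_open 0 f W \<longleftrightarrow> continuous_on W f"
| "Ck_open (Suc k) f W \<longleftrightarrow>
     (\<forall>x\<in>W. f differentiable (at x)) \<and>
     (\<forall>v. Ck_open k (\<lambda>x. frechet_derivative f (at x) v) W)"

text \<open>On an arbitrary set, \<open>C\<^sup>k\<close> means being the restriction of a \<open>C\<^sup>k\<close> function on an open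
  neighbourhood. For open \<open>S\<close> this agrees with \<open>Ck_open\<close>.\<close>

definition Ck_on :: "nat \<Rightarrow> ('a::euclidean_space \<Rightarrow> 'b::real_normed_vector) \<Rightarrow> 'a set \<Rightarrow> bool" where
  "Ck_on k f S \<longleftrightarrow> (\<exists>W F. open W \<and> S \<subseteq> W \<and> Ck_open k F W \<and> (\<forall>x\<in>S. F x = f x))"

definition Ck_diffeo_on :: "nat \<Rightarrow> ('a::euclidean_space \<Rightarrow> 'b::euclidean_space) \<Rightarrow> 'a set \<Rightarrow> bool" where
  "Ck_diffeo_on k \<Phi> S \<longleftrightarrow>
     inj_on \<Phi> S \<and> Ck_on k \<Phi> S \<and> Ck_on k (inv_into S \<Phi>) (\<Phi> ` S)"

text \<open>\<open>x\<close> solves \<open>x' = f t x\<close> on the time set \<open>J\<close> and stays in \<open>D\<close> (derivatives at end points of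
  \<open>J\<close> are one-sided).\<close>

definition solution_in ::
  "(real \<Rightarrow> 'a \<Rightarrow> 'a::real_normed_vector) \<Rightarrow> 'a set \<Rightarrow> real set \<Rightarrow> (real \<Rightarrow> 'a) \<Rightarrow> bool" where
  "solution_in f D J x \<longleftrightarrow>
     (\<forall>t\<in>J. x t \<in> D \<and> (x has_vector_derivative f t (x t)) (at t within J))"

definition time_average ::
  "real \<Rightarrow> ('a \<Rightarrow> real \<Rightarrow> real \<Rightarrow> 'a::euclidean_space) \<Rightarrow> 'a \<Rightarrow> 'a" where
  "time_average T g x = (1 / T) *\<^sub>R integral {0..T} (\<lambda>t. g x t 0)"

definition time_map_dom ::
  "(real \<Rightarrow> 'a \<Rightarrow> 'a::real_normed_vector) \<Rightarrow> 'a set \<Rightarrow> real \<Rightarrow> 'a set" where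
  "time_map_dom f D T = {p. \<exists>x. solution_in f D {0..T} x \<and> x 0 = p}"

text \<open>Only meaningful on \<open>time_map_dom f D T\<close>, and when solutions in \<open>D\<close> are determined by their
  initial value.\<close>

definition time_map ::
  "(real \<Rightarrow> 'a \<Rightarrow> 'a::real_normed_vector) \<Rightarrow> 'a set \<Rightarrow> real \<Rightarrow> 'a \<Rightarrow> 'a" where
  "time_map f D T p = (THE q. \<exists>x. solution_in f D {0..T} x \<and> x 0 = p \<and> x T = q)"

text \<open>Complex eigenvalues of a real matrix.\<close>

definition eigenvalue :: "real^'n^'n \<Rightarrow> complex \<Rightarrow> bool" where
  "eigenvalue A \<mu> \<longleftrightarrow> (\<exists>v::complex^'n. v \<noteq> 0 \<and> map_matrix of_real A *v v = \<mu> *s v)"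

definition charpoly :: "real^'n^'n \<Rightarrow> complex poly" where
  "charpoly A = det (mat [:0, 1:] - map_matrix (\<lambda>a. [:of_real a:]) A)"

text \<open>Number of eigenvalues in \<open>S\<close>, counted with algebraic multiplicity.\<close>

definition eigenvalue_count :: "real^'n^'n \<Rightarrow> complex set \<Rightarrow> nat" where
  "eigenvalue_count A S = (\<Sum>\<mu> | eigenvalue A \<mu> \<and> \<mu> \<in> S. order \<mu> (charpoly A))"

definition hyperbolic_fixed_point :: "(real^'n \<Rightarrow> real^'n) \<Rightarrow> (real^'n) set \<Rightarrow> real^'n \<Rightarrow> bool" where
  "hyperbolic_fixed_point P S p \<longleftrightarrow>
     p \<in> interior S \<and> P p = p \<and> P differentiable (at p) \<and>
     (\<forall>\<mu>. eigenvalue (jacobian P (at p)) \<mu> \<longrightarrow> cmod \<mu> \<noteq> 1)"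

definition same_stability_type ::
  "(real^'n) set \<Rightarrow> real \<Rightarrow> (real \<Rightarrow> real^'n \<Rightarrow> real^'n) \<Rightarrow> real^'n
    \<Rightarrow> (real \<Rightarrow> real^'n \<Rightarrow> real^'n) \<Rightarrow> real^'n \<Rightarrow> bool" where
  "same_stability_type D T f p h q \<longleftrightarrow>
     hyperbolic_fixed_point (time_map f D T) (time_map_dom f D T) p \<and>
     hyperbolic_fixed_point (time_map h D T) (time_map_dom h D T) q \<and>
     eigenvalue_count (jacobian (time_map f D T) (at p)) {\<mu>. cmod \<mu> < 1} =
       eigenvalue_count (jacobian (time_map h D T) (at q)) {\<mu>. cmod \<mu> < 1} \<and>
     eigenvalue_count (jacobian (time_map f D T) (at p)) {\<mu>. cmod \<mu> > 1} =
       eigenvalue_count (jacobian (time_map h D T) (at q)) {\<mu>. cmod \<mu> > 1}"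

end

theory Submission
  imports Defs "HOL-Computational_Algebra.Fundamental_Theorem_Algebra"
begin

text \<open>The vector field is first replaced by a better one. Since \<open>D\<close> is compact, \<open>g\<close> has an extension
  \<open>G\<close> to all of \<open>\<real>\<^sup>n \<times> \<real> \<times> \<real>\<close> that is \<open>C\<^sup>r\<close>, still \<open>T\<close>-periodic in time, and zero for large \<open>x\<close>
  (\<open>periodic_Ck_extension_exists\<close>). Periodicity and the compact support make \<open>G\<close> and its first two
  derivatives bounded for \<open>0 \<le> \<epsilon> \<le> \<epsilon>0\<close> (\<open>periodic_field_bounds\<close>), so the
  constants in all estimates below are global.

  Let \<open>m\<close> be the time average of \<open>G(\<cdot>, \<cdot>, 0)\<close> and \<open>w(y, t) = \<integral>\<^sub>0\<^sup>t (G(y, s, 0) - m(y)) ds\<close>, the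
  \<open>corrector\<close>. As the integrand has mean zero, \<open>w\<close> is \<open>T\<close>-periodic. In \<open>x = y + \<epsilon> w(y, t)\<close> the
  derivative \<open>\<epsilon> \<partial>\<^sub>t w = \<epsilon> (G - m)\<close> removes the oscillating part of the field at first order, which
  leaves \<open>y' = \<epsilon> m(y) + O(\<epsilon>\<^sup>2)\<close>. For small \<open>\<epsilon>\<close> the map is a Lipschitz perturbation of the identity,
  hence a global diffeomorphism, and its inverse is as smooth as \<open>w\<close> because Cramer's rule makes the
  derivative of the inverse a rational expression (\<open>near_identity_transform\<close>).

  For the comparison over times \<open>c/\<epsilon>\<close>, the difference of \<open>x - \<epsilon> w(x, t)\<close> and the averaged solution
  grows at rate \<open>O(\<epsilon>)\<close> and is forced by \<open>O(\<epsilon>\<^sup>2)\<close>, so it stays \<open>O(\<epsilon>)\<close> by a Gronwall argument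
  (\<open>averaging_estimate\<close>).

  For the periodic orbit only one period matters, which is a short time for the slow system. The
  time-\<open>T\<close> map is \<open>P(p) = p + \<epsilon> T m(p) + O(\<epsilon>\<^sup>2)\<close>, so its fixed points are the zeros of
  \<open>(P(p) - p)/(\<epsilon> T)\<close>, which is \<open>O(\<epsilon>)\<close>-close to \<open>m\<close>. Near a zero of \<open>m\<close> with invertible derivative
  \<open>A\<close>, Brouwer's theorem on a ball of radius \<open>C \<epsilon>\<close> gives one (\<open>periodic_point_exists\<close>). The
  variational equation shows that \<open>P\<close> is differentiable there with \<open>DP = I + \<epsilon> T A + O(\<epsilon>\<^sup>2)\<close>
  (\<open>flow_end_derivative\<close>), and the same lemma applies to the averaged system. An eigenvalue
  \<open>1 + \<epsilon> T \<lambda> + o(\<epsilon>)\<close> lies inside or outside the unit circle according to the sign of \<open>Re \<lambda>\<close>.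
  A compactness argument for the \<open>n\<close>-tuple of eigenvalues makes this precise with multiplicities
  (\<open>near_identity_hyperbolic\<close>), so both time-\<open>T\<close> maps have the eigenvalue counts
  prescribed by \<open>A\<close>.\<close>

section \<open>Differential calculus of iterated directional derivatives\<close>

lemma Ck_open_cong:
  fixes f g :: "'a::euclidean_space \<Rightarrow> 'b::real_normed_vector"
  assumes "open W" and "\<And>x. x \<in> W \<Longrightarrow> f x = g x" and "Ck_open k f W"
  shows "Ck_open k g W"
  using assms(2,3)
proof (induction k arbitrary: f g)
  case 0
  then show ?case by (simp cong: continuous_on_cong)
next
  case (Suc k)
  have eq: "frechet_derivative f (at x) = frechet_derivative g (at x)" if "x \<in> W" for x
    using Suc.prems that assms(1) by (intro frechet_derivative_transform_within_open) auto
  have "g differentiable (at x)" if "x \<in> W" for x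
    using Suc.prems that assms(1)
    by (metis Ck_open.simps(2) differentiable_def has_derivative_transform_within_open)
  moreover have "Ck_open k (\<lambda>x. frechet_derivative g (at x) v) W" for v
    by (rule Suc.IH[of "\<lambda>x. frechet_derivative f (at x) v"]) (use Suc.prems eq in auto)
  ultimately show ?case by simp
qed

lemma Ck_open_SucI:
  fixes f :: "'a::euclidean_space \<Rightarrow> 'b::real_normed_vector"
  assumes "open W" and f': "\<And>x. x \<in> W \<Longrightarrow> (f has_derivative f' x) (at x)"
    and "\<And>v. Ck_open k (\<lambda>x. f' x v) W"
  shows "Ck_open (Suc k) f W"
proof -
  have "f' x = frechet_derivative f (at x)" if "x \<in> W" for x
    using f'[OF that] by (rule frechet_derivative_at)
  then show ?thesis
    using f' Ck_open_cong[OF assms(1) _ assms(3)]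
    by (auto simp: differentiable_def)
qed

lemma Ck_open_Suc_has_derivative:
  assumes "Ck_open (Suc k) f W" "x \<in> W"
  shows "(f has_derivative frechet_derivative f (at x)) (at x)"
  using assms by (auto simp: frechet_derivative_works)

lemma Ck_open_SucD: "Ck_open (Suc k) f W \<Longrightarrow> Ck_open k (\<lambda>x. frechet_derivative f (at x) v) W"
  unfolding Ck_open.simps by blast

lemma Ck_open_subset:
  assumes "V \<subseteq> W" "Ck_open k f W" shows "Ck_open k f V"
  using assms(2)
proof (induction k arbitrary: f)
  case 0
  then show ?case using assms(1) by (auto intro: continuous_on_subset)
next
  case (Suc k)
  then show ?case using assms(1) by auto
qed

lemma Ck_open_continuous_on:
  assumes "Ck_open k f W" shows "continuous_on W f"
proof (cases k)
  case (Suc m)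
  then show ?thesis
    using assms by (auto intro!: continuous_at_imp_continuous_on differentiable_imp_continuous_within)
qed (use assms in auto)

lemma Ck_open_Suc_lower:
  assumes "Ck_open (Suc k) f W" shows "Ck_open k f W"
  using assms
proof (induction k arbitrary: f)
  case 0
  then show ?case by (simp add: Ck_open_continuous_on[of "Suc 0"])
next
  case (Suc k)
  then show ?case by (metis Ck_open.simps(2))
qed

lemma Ck_open_mono:
  assumes "Ck_open m f W" "k \<le> m" shows "Ck_open k f W"
  using assms(2,1) by (induction rule: inc_induct) (auto intro: Ck_open_Suc_lower)

text \<open>Regularity is local. This glues functions that are given by different formulas on different
  open sets: the cut-off extension and the periodization below.\<close>

lemma Ck_open_local:
  assumes "\<And>x. x \<in> W \<Longrightarrow> \<exists>N. open N \<and> x \<in> N \<and> Ck_open k f N"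
  shows "Ck_open k f W"
  using assms
proof (induction k arbitrary: f)
  case 0
  then show ?case
    by (metis Ck_open.simps(1) continuous_at_imp_continuous_on continuous_on_eq_continuous_at)
next
  case (Suc k)
  have "f differentiable (at x)" if "x \<in> W" for x
    using Suc.prems[OF that] by auto
  moreover have "Ck_open k (\<lambda>x. frechet_derivative f (at x) v) W" for v
    by (rule Suc.IH) (use Suc.prems in fastforce)
  ultimately show ?case by simp
qed

lemma Ck_open_const [simp]: "Ck_open k (\<lambda>x. c) W"
proof (induction k arbitrary: c)
  case (Suc k) then show ?case by (simp add: frechet_derivative_const)
qed simp

lemma Ck_open_bounded_linear:
  assumes "open W" "bounded_linear f" shows "Ck_open k f W"
proof (cases k)
  case 0
  then show ?thesis using assms by (simp add: linear_continuous_on)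
next
  case (Suc m)
  show ?thesis unfolding Suc
    using assms by (intro Ck_open_SucI[where f' = "\<lambda>_. f"] bounded_linear_imp_has_derivative) auto
qed

lemma Ck_open_linear_compose:
  assumes "open W" "bounded_linear L" "Ck_open k f W"
  shows "Ck_open k (\<lambda>x. L (f x)) W"
  using assms(3)
proof (induction k arbitrary: f)
  case 0
  then show ?case using assms by (simp add: bounded_linear.continuous_on)
next
  case (Suc k)
  show ?case
    by (rule Ck_open_SucI[where f' = "\<lambda>x v. L (frechet_derivative f (at x) v)"])
      (use Suc assms in \<open>auto intro!: bounded_linear.has_derivative[OF assms(2)] simp: frechet_derivative_works\<close>)
qed

lemma Ck_open_add:
  assumes "open W" "Ck_open k f W" "Ck_open k g W"
  shows "Ck_open k (\<lambda>x. f x + g x) W"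
  using assms(2,3)
proof (induction k arbitrary: f g)
  case 0
  then show ?case by (simp add: continuous_on_add)
next
  case (Suc k)
  show ?case
    by (rule Ck_open_SucI[where f' = "\<lambda>x v. frechet_derivative f (at x) v + frechet_derivative g (at x) v"])
      (use Suc assms in \<open>auto intro!: has_derivative_add simp: frechet_derivative_works\<close>)
qed

lemma Ck_open_sum:
  assumes "open W" "\<And>i. i \<in> I \<Longrightarrow> Ck_open k (f i) W"
  shows "Ck_open k (\<lambda>x. \<Sum>i\<in>I. f i x) W"
  using assms(2)
  by (induction I rule: infinite_finite_induct) (auto intro: Ck_open_add assms(1))

lemma Ck_open_bilinear:
  fixes f :: "'a::euclidean_space \<Rightarrow> 'b::real_normed_vector" and g :: "'a \<Rightarrow> 'c::real_normed_vector"
    and B :: "'b \<Rightarrow> 'c \<Rightarrow> 'd::real_normed_vector"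
  assumes "open W" "bounded_bilinear B" "Ck_open k f W" "Ck_open k g W"
  shows "Ck_open k (\<lambda>x. B (f x) (g x)) W"
  using assms(3,4)
proof (induction k arbitrary: f g)
  case 0
  then show ?case by (simp add: bounded_bilinear.continuous_on[OF assms(2)])
next
  case (Suc k)
  have "Ck_open k f W" "Ck_open k g W"
    using Suc.prems by (blast intro: Ck_open_Suc_lower)+
  then show ?case
    by (intro Ck_open_SucI[OF assms(1) bounded_bilinear.FDERIV[OF assms(2),
            where f' = "frechet_derivative f (at x)" and g' = "frechet_derivative g (at x)" for x]]
          Ck_open_add Suc.IH)
      (use Suc.prems assms(1) in \<open>auto simp: frechet_derivative_works\<close>)
qed

lemmas Ck_open_scaleR = Ck_open_bilinear[OF _ bounded_bilinear_scaleR]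
lemmas Ck_open_mult = Ck_open_bilinear[OF _ bounded_bilinear_mult]

lemma Ck_open_minus: "open W \<Longrightarrow> Ck_open k f W \<Longrightarrow> Ck_open k (\<lambda>x. - f x) W"
  by (rule Ck_open_linear_compose) (auto intro: bounded_linear_minus bounded_linear_ident)

lemma Ck_open_diff:
  "open W \<Longrightarrow> Ck_open k f W \<Longrightarrow> Ck_open k g W \<Longrightarrow> Ck_open k (\<lambda>x. f x - g x) W"
  using Ck_open_add[of W k f "\<lambda>x. - g x"] Ck_open_minus[of W k g] by simp

lemma Ck_open_prod:
  fixes f :: "'i \<Rightarrow> 'a::euclidean_space \<Rightarrow> 'b::{real_normed_algebra_1, comm_ring_1}"
  assumes "open W" "\<And>i. i \<in> I \<Longrightarrow> Ck_open k (f i) W"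
  shows "Ck_open k (\<lambda>x. \<Prod>i\<in>I. f i x) W"
  using assms(2)
  by (induction I rule: infinite_finite_induct) (auto intro: Ck_open_mult assms(1))

lemma linear_expand_Basis:
  fixes L :: "'a::euclidean_space \<Rightarrow> 'b::real_normed_vector"
  assumes "linear L"
  shows "L v = (\<Sum>b\<in>Basis. (v \<bullet> b) *\<^sub>R L b)"
  by (subst euclidean_representation[of v, symmetric])
    (simp only: linear_sum[OF assms] linear_scale[OF assms])

text \<open>The chain rule gives \<open>D(f \<circ> h) v = Df(h) (Dh v)\<close>, in which the direction of \<open>Df\<close> varies with the
  point. Expanding \<open>Dh v\<close> in the basis turns it into a sum of products of functions that the
  induction hypothesis covers.\<close>

lemma Ck_open_compose:
  fixes f :: "'b::euclidean_space \<Rightarrow> 'c::real_normed_vector" and h :: "'a::euclidean_space \<Rightarrow> 'b"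
  assumes "open W" "h ` W \<subseteq> V" "Ck_open k f V" "Ck_open k h W"
  shows "Ck_open k (\<lambda>x. f (h x)) W"
  using assms(3,4)
proof (induction k arbitrary: f)
  case 0
  then show ?case using assms by (auto intro: continuous_on_compose2)
next
  case (Suc k)
  let ?h = "\<lambda>x. frechet_derivative h (at x)" and ?f = "\<lambda>y. frechet_derivative f (at y)"
  have hV: "h x \<in> V" if "x \<in> W" for x using assms(2) that by auto
  have der: "((\<lambda>x. f (h x)) has_derivative (\<lambda>v. ?f (h x) (?h x v))) (at x)" if "x \<in> W" for x
    by (rule has_derivative_compose[of h "?h x" _ _ f "?f (h x)"])
      (use Suc.prems that hV in \<open>auto simp: frechet_derivative_works\<close>)
  have exp: "?f (h x) (?h x v) = (\<Sum>b\<in>Basis. (?h x v \<bullet> b) *\<^sub>R ?f (h x) b)" if "x \<in> W" for x v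
    using Suc.prems that hV by (intro linear_expand_Basis linear_frechet_derivative) auto
  have hk: "Ck_open k h W" using Suc.prems by (rule_tac Ck_open_Suc_lower) auto
  show ?case
  proof (rule Ck_open_SucI[OF assms(1), where f' = "\<lambda>x v. \<Sum>b\<in>Basis. (?h x v \<bullet> b) *\<^sub>R ?f (h x) b"])
    show "((\<lambda>x. f (h x)) has_derivative (\<lambda>v. \<Sum>b\<in>Basis. (?h x v \<bullet> b) *\<^sub>R ?f (h x) b)) (at x)"
      if "x \<in> W" for x
      using der[OF that] exp[OF that] by simp
    show "Ck_open k (\<lambda>x. \<Sum>b\<in>Basis. (?h x v \<bullet> b) *\<^sub>R ?f (h x) b) W" for v
      using Suc.prems hk
      by (intro Ck_open_sum Ck_open_scaleR Suc.IH assms(1)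
            Ck_open_linear_compose[OF assms(1) bounded_linear_inner_left]) auto
  qed
qed

lemma Ck_open_inverse:
  fixes f :: "'a::euclidean_space \<Rightarrow> real"
  assumes "open W" "\<And>x. x \<in> W \<Longrightarrow> f x \<noteq> 0" "Ck_open k f W"
  shows "Ck_open k (\<lambda>x. inverse (f x)) W"
  using assms(3)
proof (induction k)
  case 0
  then show ?case using assms by (auto intro!: continuous_on_inverse)
next
  case (Suc k)
  have IH: "Ck_open k (\<lambda>x. inverse (f x)) W"
    using Suc Ck_open_Suc_lower by blast
  show ?case
    by (rule Ck_open_SucI[OF assms(1), where
          f' = "\<lambda>x v. - (inverse (f x) * frechet_derivative f (at x) v * inverse (f x))"])
      (use Suc.prems assms IH in
        \<open>auto intro!: has_derivative_inverse Ck_open_minus Ck_open_mult simp: frechet_derivative_works\<close>)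
qed

lemma Ck_open_divide:
  fixes f g :: "'a::euclidean_space \<Rightarrow> real"
  assumes "open W" "\<And>x. x \<in> W \<Longrightarrow> g x \<noteq> 0" "Ck_open k f W" "Ck_open k g W"
  shows "Ck_open k (\<lambda>x. f x / g x) W"
  unfolding divide_inverse using assms by (intro Ck_open_mult Ck_open_inverse)

lemma Ck_open_Basis:
  fixes f :: "'a::euclidean_space \<Rightarrow> 'b::euclidean_space"
  assumes "open W" "\<And>b. b \<in> Basis \<Longrightarrow> Ck_open k (\<lambda>x. f x \<bullet> b) W"
  shows "Ck_open k f W"
proof -
  have "Ck_open k (\<lambda>x. \<Sum>b\<in>Basis. (f x \<bullet> b) *\<^sub>R b) W"
    using assms by (intro Ck_open_sum Ck_open_scaleR) auto
  then show ?thesis by (simp add: euclidean_representation)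
qed

lemma Ck_open_vec:
  fixes f :: "'a::euclidean_space \<Rightarrow> real^'n"
  assumes "open W" "\<And>i. Ck_open k (\<lambda>x. f x $ i) W"
  shows "Ck_open k f W"
proof (rule Ck_open_Basis[OF assms(1)])
  fix b :: "real^'n" assume "b \<in> Basis"
  then obtain i where "b = axis i 1" by (auto simp: Basis_vec_def)
  then show "Ck_open k (\<lambda>x. f x \<bullet> b) W" using assms(2)[of i] by (simp add: inner_axis)
qed

lemma Ck_open_vec_nth:
  fixes f :: "'a::euclidean_space \<Rightarrow> real^'n"
  assumes "open W" "Ck_open k f W"
  shows "Ck_open k (\<lambda>x. f x $ i) W"
  using assms by (intro Ck_open_linear_compose[OF _ bounded_linear_vec_nth])

lemma Ck_open_Pair:
  fixes f :: "'a::euclidean_space \<Rightarrow> 'b::euclidean_space" and g :: "'a \<Rightarrow> 'c::euclidean_space"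
  assumes "open W" "Ck_open k f W" "Ck_open k g W"
  shows "Ck_open k (\<lambda>x. (f x, g x)) W"
proof -
  have "Ck_open k (\<lambda>x. (f x, 0) + (0, g x)) W"
    using assms
    by (intro Ck_open_add Ck_open_linear_compose[where L = "\<lambda>y. (y, 0)"]
        Ck_open_linear_compose[where L = "\<lambda>y. (0, y)"])
      (auto intro: bounded_linear_Pair bounded_linear_ident bounded_linear_zero)
  then show ?thesis by simp
qed

lemma Ck_open_det:
  fixes A :: "'a::euclidean_space \<Rightarrow> real^'n^'n"
  assumes "open W" "\<And>i j. Ck_open k (\<lambda>x. A x $ i $ j) W"
  shows "Ck_open k (\<lambda>x. det (A x)) W"
  unfolding det_def
  by (rule Ck_open_sum[OF assms(1)], rule Ck_open_mult[OF assms(1)], simp,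
      rule Ck_open_prod[OF assms(1)], rule assms(2))

text \<open>By Cramer's rule the solution of a regular linear system is a rational expression in the
  entries, so it is as smooth as the system itself.\<close>

lemma Ck_open_solve_linear:
  fixes A :: "'a::euclidean_space \<Rightarrow> real^'n^'n"
  assumes "open W" "\<And>i j. Ck_open k (\<lambda>x. A x $ i $ j) W" "Ck_open k b W"
    and "\<And>x. x \<in> W \<Longrightarrow> det (A x) \<noteq> 0" "\<And>x. x \<in> W \<Longrightarrow> A x *v u x = b x"
  shows "Ck_open k u W"
proof -
  have eq: "u x = (\<chi> j. det (\<chi> i l. if l = j then b x $ i else A x $ i $ l) / det (A x))" if "x \<in> W" for x
    using iffD1[OF cramer[OF assms(4)[OF that]] assms(5)[OF that]] .
  have ent: "Ck_open k (\<lambda>x. (\<chi> i l. if l = j then b x $ i else A x $ i $ l) $ i $ l) W" for i j l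
    using assms(2)[of i l] Ck_open_vec_nth[OF assms(1,3), of i] by (cases "l = j") simp_all
  have "Ck_open k (\<lambda>x. (\<chi> j. det (\<chi> i l. if l = j then b x $ i else A x $ i $ l) / det (A x))) W"
  proof (rule Ck_open_vec[OF assms(1)])
    fix j
    show "Ck_open k (\<lambda>x. (\<chi> j. det (\<chi> i l. if l = j then b x $ i else A x $ i $ l) / det (A x)) $ j) W"
      unfolding vec_lambda_beta[of _ j]
      by (rule Ck_open_divide[OF assms(1,4)], assumption, rule Ck_open_det[OF assms(1) ent],
          rule Ck_open_det[OF assms(1,2)])
  qed
  then show ?thesis
    by (rule Ck_open_cong[OF assms(1), rotated]) (simp add: eq)
qed

text \<open>Leibniz's rule on a fixed interval. The mean field and the corrector are written as integrals over
  \<open>[0, 1]\<close> in order that it applies to both.\<close>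

lemma has_derivative_integral_param:
  fixes f :: "'a::euclidean_space \<times> real \<Rightarrow> 'b::euclidean_space"
  assumes "Ck_open 1 f UNIV"
  shows "((\<lambda>x. integral {0..1} (\<lambda>s. f (x, s))) has_derivative
    (\<lambda>v. integral {0..1} (\<lambda>s. frechet_derivative f (at (x, s)) (v, 0)))) (at x)"
proof -
  let ?f = "\<lambda>z. frechet_derivative f (at z)"
  let ?D = "\<lambda>z. Blinfun (\<lambda>v. ?f z (v, 0))"
  have smooth: "Ck_open (Suc 0) f UNIV" using assms by simp
  have der: "(f has_derivative ?f z) (at z)" for z
    by (rule Ck_open_Suc_has_derivative[OF smooth]) simp
  have bl: "bounded_linear (\<lambda>v. ?f z (v, 0))" for z
    using has_derivative_bounded_linear[OF der]
    by (rule bounded_linear_compose) (auto intro: bounded_linear_Pair bounded_linear_ident bounded_linear_zero)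
  have app: "blinfun_apply (?D z) v = ?f z (v, 0)" for z v
    by (simp add: bounded_linear_Blinfun_apply[OF bl])
  have cont: "continuous_on UNIV (\<lambda>z. ?f z v)" for v
    by (rule Ck_open_continuous_on[OF Ck_open_SucD[OF smooth]])
  have contDz: "continuous_on UNIV ?D"
    by (rule continuous_on_blinfun_componentwise) (unfold app, rule cont)
  then have contD: "continuous_on (UNIV \<times> cbox 0 1) (\<lambda>(x, s). ?D (x, s))"
    by (auto simp: case_prod_beta intro: continuous_on_subset)
  have contf: "continuous_on UNIV f" by (rule Ck_open_continuous_on[OF smooth])
  have int: "(\<lambda>s. f (x, s)) integrable_on cbox 0 1" for x
    by (intro integrable_continuous continuous_on_compose2[OF contf] continuous_intros) auto
  have intD: "(\<lambda>s. ?D (x, s)) integrable_on cbox 0 1" for x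
    by (intro integrable_continuous continuous_on_compose2[OF contDz] continuous_intros) auto
  have main: "((\<lambda>x. integral (cbox 0 1) (\<lambda>s. f (x, s))) has_derivative
      blinfun_apply (integral (cbox 0 1) (\<lambda>s. ?D (x, s)))) (at x within UNIV)" for x
  proof (rule leibniz_rule[OF _ int contD])
    fix x s
    have "((\<lambda>x. f (x, s)) has_derivative (\<lambda>v. ?f (x, s) (v, 0))) (at x)"
      by (rule has_derivative_compose[OF _ der]) (auto intro!: derivative_eq_intros)
    then show "((\<lambda>x. f (x, s)) has_derivative blinfun_apply (?D (x, s))) (at x within UNIV)"
      by (simp add: app[abs_def] bounded_linear_Blinfun_apply[OF bl])
  qed auto
  have eq: "blinfun_apply (integral (cbox 0 1) (\<lambda>s. ?D (x, s))) =
      (\<lambda>v. integral {0..1} (\<lambda>s. ?f (x, s) (v, 0)))" for x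
    by (rule ext, subst blinfun_apply_integral[OF intD]) (simp add: app)
  show ?thesis using main[of x] unfolding eq by simp
qed

lemma Ck_open_integral:
  fixes f :: "'a::euclidean_space \<times> real \<Rightarrow> 'b::euclidean_space"
  assumes "Ck_open k f UNIV"
  shows "Ck_open k (\<lambda>x. integral {0..1} (\<lambda>s. f (x, s))) UNIV"
  using assms
proof (induction k arbitrary: f)
  case 0
  have "continuous_on (UNIV \<times> cbox 0 1) (\<lambda>(x, s). f (x, s))"
    using 0 by (auto intro: continuous_on_subset simp: case_prod_eta)
  then have "continuous_on UNIV (\<lambda>x. integral (cbox 0 1) (\<lambda>s. f (x, s)))"
    by (intro integral_continuous_on_param) auto
  then show ?case by simp
next
  case (Suc k)
  have "Ck_open 1 f UNIV" using Suc.prems by (rule Ck_open_mono) simp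
  from has_derivative_integral_param[OF this] show ?case
    by (rule Ck_open_SucI[OF open_UNIV _ Suc.IH[OF Ck_open_SucD[OF Suc.prems]]])
qed

section \<open>Smooth cutoffs and periodic extension of the vector field\<close>

lemma ramp_power_has_derivative:
  "((\<lambda>s::real. (max 0 s) ^ Suc (Suc k)) has_real_derivative real (Suc (Suc k)) * (max 0 s) ^ Suc k) (at s)"
proof (cases s "0::real" rule: linorder_cases)
  case less
  have "((\<lambda>s::real. 0) has_real_derivative 0) (at s)" by simp
  then have "((\<lambda>s::real. (max 0 s) ^ Suc (Suc k)) has_real_derivative 0) (at s)"
    by (rule has_field_derivative_transform_within_open[of _ _ _ "{..<0}"]) (use less in auto)
  then show ?thesis using less by simp
next
  case greater
  have "((\<lambda>s::real. s ^ Suc (Suc k)) has_real_derivative real (Suc (Suc k)) * s ^ Suc k) (at s)"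
    using DERIV_pow[of "Suc (Suc k)" s] by simp
  then have "((\<lambda>s::real. (max 0 s) ^ Suc (Suc k)) has_real_derivative real (Suc (Suc k)) * s ^ Suc k) (at s)"
    by (rule has_field_derivative_transform_within_open[of _ _ _ "{0<..}"]) (use greater in auto)
  then show ?thesis using greater by simp
next
  case equal
  have "((\<lambda>h::real. \<bar>h\<bar> ^ Suc k) \<longlongrightarrow> \<bar>0\<bar> ^ Suc k) (at 0)"
    by (intro tendsto_intros)
  then have lim: "((\<lambda>h::real. \<bar>h\<bar> ^ Suc k) \<longlongrightarrow> 0) (at 0)" by simp
  have "norm ((max 0 h) ^ Suc (Suc k) / h) \<le> \<bar>h\<bar> ^ Suc k" for h :: real
    by (cases "h \<le> 0") (auto simp: max_def abs_mult power_abs intro: mult_nonpos_nonneg)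
  then have "((\<lambda>h::real. (max 0 h) ^ Suc (Suc k) / h) \<longlongrightarrow> 0) (at 0)"
    by (intro Lim_null_comparison[OF always_eventually lim]) blast
  then show ?thesis using equal by (simp add: DERIV_def)
qed

text \<open>Up to a factor the derivative of such a power is the next lower one. For a prescribed finite order
  of smoothness this function replaces the flat function \<open>exp (-1/s)\<close> in the construction of cutoffs.\<close>

lemma Ck_open_ramp_power: "Ck_open k (\<lambda>s::real. (max 0 s) ^ Suc k) UNIV"
proof (induction k)
  case 0
  show ?case by (auto intro!: continuous_intros)
next
  case (Suc k)
  show ?case
  proof (rule Ck_open_SucI[where f' = "\<lambda>s v. (real (Suc (Suc k)) * v) *\<^sub>R (max 0 s) ^ Suc k"])
    show "((\<lambda>s::real. (max 0 s) ^ Suc (Suc k)) has_derivative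
        (\<lambda>v. (real (Suc (Suc k)) * v) *\<^sub>R (max 0 s) ^ Suc k)) (at s)" for s
    proof -
      have "(\<lambda>v. (real (Suc (Suc k)) * v) *\<^sub>R (max 0 s) ^ Suc k) = (\<lambda>v. real (Suc (Suc k)) * (max 0 s) ^ Suc k * v)"
        by (rule ext) (simp add: mult_ac del: power_Suc of_nat_Suc)
      then show ?thesis
        using ramp_power_has_derivative[of k s] unfolding has_field_derivative_def by simp
    qed
    show "Ck_open k (\<lambda>s::real. (real (Suc (Suc k)) * v) *\<^sub>R (max 0 s) ^ Suc k) UNIV" for v
      by (rule Ck_open_scaleR) (simp_all add: Suc.IH del: power_Suc)
  qed simp
qed

lemma Ck_step_exists:
  "\<exists>\<sigma>::real \<Rightarrow> real. Ck_open k \<sigma> UNIV \<and> (\<forall>s\<le>0. \<sigma> s = 0) \<and> (\<forall>s\<ge>1. \<sigma> s = 1)"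
proof -
  \<comment> \<open>The denominator vanishes nowhere, since \<open>s\<close> and \<open>1 - s\<close> are not both nonpositive.\<close>
  let ?\<rho> = "\<lambda>s::real. (max 0 s) ^ Suc k"
  let ?\<sigma> = "\<lambda>s. ?\<rho> s / (?\<rho> s + ?\<rho> (1 - s))"
  have refl: "Ck_open k (\<lambda>s. ?\<rho> (1 - s)) UNIV"
    by (rule Ck_open_compose[OF _ _ Ck_open_ramp_power])
      (simp_all add: Ck_open_diff Ck_open_bounded_linear[OF _ bounded_linear_ident])
  have nz: "?\<rho> s + ?\<rho> (1 - s) \<noteq> 0" for s
  proof -
    have "0 < max 0 s ^ Suc k \<or> 0 < max 0 (1 - s) ^ Suc k"
      by (cases "s > 0") auto
    moreover have "0 \<le> max 0 s ^ Suc k" "0 \<le> max 0 (1 - s) ^ Suc k" by auto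
    ultimately show ?thesis by linarith
  qed
  have "Ck_open k ?\<sigma> UNIV"
    by (intro Ck_open_divide Ck_open_add refl Ck_open_ramp_power nz open_UNIV)
  moreover have "?\<sigma> s = 0" if "s \<le> 0" for s using that by simp
  moreover have "?\<sigma> s = 1" if "s \<ge> 1" for s using that by simp
  ultimately show ?thesis by blast
qed

text \<open>Each point of \<open>K\<close> has a radial bump that equals 1 on a ball and vanishes off the concentric ball
  of twice the radius. The union of finitely many bumps is smooth if it is written as
  \<open>1 - \<Prod> (1 - b\<^sub>a)\<close> instead of a maximum.\<close>

lemma Ck_cutoff_exists:
  fixes K W :: "'a::euclidean_space set"
  assumes "compact K" "open W" "K \<subseteq> W"
  shows "\<exists>(\<theta>::'a \<Rightarrow> real) C. Ck_open k \<theta> UNIV \<and> compact C \<and> C \<subseteq> W \<and>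
    (\<forall>z\<in>K. \<theta> z = 1) \<and> (\<forall>z. z \<notin> C \<longrightarrow> \<theta> z = 0)"
proof -
  obtain \<sigma> :: "real \<Rightarrow> real" where \<sigma>: "Ck_open k \<sigma> UNIV" "\<And>s. s \<le> 0 \<Longrightarrow> \<sigma> s = 0" "\<And>s. s \<ge> 1 \<Longrightarrow> \<sigma> s = 1"
    using Ck_step_exists[of k] by blast
  have "\<forall>a\<in>K. \<exists>\<rho>>0. cball a (2 * \<rho>) \<subseteq> W"
  proof
    fix a assume "a \<in> K"
    then obtain e where "e > 0" "cball a e \<subseteq> W"
      using assms open_contains_cball by blast
    then show "\<exists>\<rho>>0. cball a (2 * \<rho>) \<subseteq> W" by (intro exI[of _ "e/2"]) auto
  qed
  then obtain \<rho> where \<rho>: "\<And>a. a \<in> K \<Longrightarrow> \<rho> a > 0" "\<And>a. a \<in> K \<Longrightarrow> cball a (2 * \<rho> a) \<subseteq> W"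
    by metis
  obtain F where F: "F \<subseteq> K" "finite F" "K \<subseteq> (\<Union>a\<in>F. ball a (\<rho> a))"
    by (rule compactE_image[OF assms(1), of K "\<lambda>a. ball a (\<rho> a)"]) (use \<rho> in \<open>auto 0 3\<close>)
  define b where "b a z = \<sigma> ((4 * (\<rho> a)\<^sup>2 - (z - a) \<bullet> (z - a)) / (3 * (\<rho> a)\<^sup>2))" for a z
  define \<theta> where "\<theta> z = 1 - (\<Prod>a\<in>F. 1 - b a z)" for z
  have Ckb: "Ck_open k (b a) UNIV" for a
    unfolding b_def[abs_def] divide_inverse
    by (rule Ck_open_compose[OF _ _ \<sigma>(1)])
      (intro open_UNIV subset_UNIV Ck_open_mult Ck_open_diff Ck_open_const
         Ck_open_bilinear[OF _ bounded_bilinear_inner] Ck_open_bounded_linear[OF _ bounded_linear_ident])+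
  have "Ck_open k \<theta> UNIV"
    unfolding \<theta>_def[abs_def] using Ckb
    by (intro Ck_open_diff Ck_open_prod open_UNIV Ck_open_const)
  moreover have "\<theta> z = 1" if "z \<in> K" for z
  proof -
    obtain a where a: "a \<in> F" "dist a z < \<rho> a" using F(3) \<open>z \<in> K\<close> by auto
    have r: "\<rho> a > 0" using F a \<rho> by auto
    have "(z - a) \<bullet> (z - a) \<le> (\<rho> a)\<^sup>2"
      using a power_mono[of "norm (z - a)" "\<rho> a" 2]
      by (simp add: dot_square_norm dist_norm norm_minus_commute)
    then have "b a z = 1"
      unfolding b_def using r by (intro \<sigma>(3)) (simp add: field_simps)
    then show ?thesis
      unfolding \<theta>_def using a F(2) by auto
  qed
  moreover have "\<theta> z = 0" if "z \<notin> (\<Union>a\<in>F. cball a (2 * \<rho> a))" for z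
  proof -
    have "b a z = 0" if "a \<in> F" for a
    proof -
      have r: "\<rho> a > 0" using F that \<rho> by auto
      have "2 * \<rho> a \<le> norm (z - a)"
        using \<open>z \<notin> _\<close> that by (auto simp: dist_norm norm_minus_commute)
      then have "(2 * \<rho> a)\<^sup>2 \<le> (norm (z - a))\<^sup>2" using r by (intro power_mono) auto
      then show ?thesis
        unfolding b_def using r
        by (intro \<sigma>(2)) (simp add: dot_square_norm power_mult_distrib divide_nonpos_pos)
    qed
    then show ?thesis by (simp add: \<theta>_def)
  qed
  moreover have "compact (\<Union>a\<in>F. cball a (2 * \<rho> a))" using F by auto
  moreover have "(\<Union>a\<in>F. cball a (2 * \<rho> a)) \<subseteq> W" using F \<rho> by blast
  ultimately show ?thesis by blast
qed

lemma Ck_extension_exists: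
  fixes F :: "'a::euclidean_space \<Rightarrow> 'b::real_normed_vector"
  assumes "compact K" "open W" "K \<subseteq> W" "Ck_open k F W"
  shows "\<exists>F' C. Ck_open k F' UNIV \<and> compact C \<and> (\<forall>z\<in>K. F' z = F z) \<and> (\<forall>z. z \<notin> C \<longrightarrow> F' z = 0)"
proof -
  obtain \<theta> C where \<theta>: "Ck_open k \<theta> UNIV" "compact C" "C \<subseteq> W"
    "\<And>z. z \<in> K \<Longrightarrow> \<theta> z = (1::real)" "\<And>z. z \<notin> C \<Longrightarrow> \<theta> z = 0"
    using Ck_cutoff_exists[OF assms(1-3), of k] by metis
  let ?F = "\<lambda>z. if z \<in> W then \<theta> z *\<^sub>R F z else 0"
  have "Ck_open k ?F UNIV"
  proof (rule Ck_open_local)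
    fix z :: 'a
    show "\<exists>N. open N \<and> z \<in> N \<and> Ck_open k ?F N"
    proof (cases "z \<in> W")
      case True
      have "Ck_open k ?F W"
        by (rule Ck_open_cong[OF assms(2) _ Ck_open_scaleR[OF assms(2) Ck_open_subset[OF _ \<theta>(1)] assms(4)]])
          auto
      then show ?thesis using True assms(2) by blast
    next
      case False
      have "open (- C)" using \<theta>(2) by (simp add: compact_imp_closed open_Compl)
      moreover have "Ck_open k ?F (- C)"
        by (rule Ck_open_cong[OF \<open>open (- C)\<close> _ Ck_open_const[of _ 0]]) (simp add: \<theta>(5))
      ultimately show ?thesis using False \<theta>(3) by blast
    qed
  qed
  moreover have "\<forall>z\<in>K. ?F z = F z" using assms(3) \<theta>(4) by auto
  moreover have "\<forall>z. z \<notin> C \<longrightarrow> ?F z = 0" using \<theta>(5) by simp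
  ultimately show ?thesis using \<theta>(2) by blast
qed

lemma periodic_shift_multiple:
  fixes f :: "real \<Rightarrow> 'b" assumes "\<And>t. f (t + T) = f t" shows "f (t + of_int j * T) = f t"
proof -
  have n: "f (t + real n * T) = f t" for n t
  proof (induction n)
    case (Suc n)
    have "f (t + real (Suc n) * T) = f (t + real n * T + T)" by (simp add: algebra_simps)
    then show ?case using assms Suc by simp
  qed simp
  show ?thesis
  proof (cases "j \<ge> 0")
    case True
    then show ?thesis using n[of t "nat j"] by simp
  next
    case False
    then show ?thesis using n[of "t + of_int j * T" "nat (- j)"] by simp
  qed
qed

text \<open>A \<open>C\<^sup>k\<close> extension of \<open>g\<close> off \<open>D\<close> has no reason to be periodic. The functions
  \<open>\<phi>(t - jT)\<close>, \<open>j\<close> an integer, form a partition of unity, where \<open>\<phi>\<close> has support in \<open>[-T, T]\<close>.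
  Summing the translates of \<open>\<phi> F'\<close>, with \<open>F'\<close> a compactly supported extension, yields a periodic
  function, and it is unchanged where the extension was already periodic, that is, on \<open>D\<close>. At most
  two summands are nonzero at a time, those with \<open>j = \<lfloor>t/T\<rfloor>\<close> and \<open>j = \<lfloor>t/T\<rfloor> + 1\<close>.\<close>

lemma periodic_Ck_extension_exists:
  fixes g :: "'a::euclidean_space \<Rightarrow> real \<Rightarrow> real \<Rightarrow> 'b::real_normed_vector"
  assumes "compact D" "compact I" "0 < T"
    and per: "\<forall>x\<in>D. \<forall>t. \<forall>e\<in>I. g x (t + T) e = g x t e"
    and smooth: "Ck_on k (\<lambda>(x, t, e). g x t e) (D \<times> UNIV \<times> I)"
  shows "\<exists>(G :: 'a \<times> real \<times> real \<Rightarrow> 'b) R. Ck_open k G UNIV \<and>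
    (\<forall>x t e. G (x, t + T, e) = G (x, t, e)) \<and> (\<forall>x t e. R < norm x \<longrightarrow> G (x, t, e) = 0) \<and>
    (\<forall>x\<in>D. \<forall>t. \<forall>e\<in>I. G (x, t, e) = g x t e)"
proof -
  obtain W F where W: "open W" "D \<times> UNIV \<times> I \<subseteq> W" "Ck_open k F W"
    "\<And>z. z \<in> D \<times> UNIV \<times> I \<Longrightarrow> F z = (\<lambda>(x, t, e). g x t e) z"
    using smooth unfolding Ck_on_def by blast
  have "compact (D \<times> {-T..T} \<times> I)" using assms by (intro compact_Times) auto
  moreover have "D \<times> {-T..T} \<times> I \<subseteq> W" using W(2) by auto
  ultimately obtain F' C where F': "Ck_open k F' UNIV" "compact C"
    "\<And>z. z \<in> D \<times> {-T..T} \<times> I \<Longrightarrow> F' z = F z" "\<And>z. z \<notin> C \<Longrightarrow> F' z = 0"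
    using Ck_extension_exists[OF _ W(1) _ W(3), of "D \<times> {-T..T} \<times> I"] by metis
  have F'g: "F' (x, t, e) = g x t e" if "x \<in> D" "e \<in> I" "- T \<le> t" "t \<le> T" for x t e
    using that F'(3)[of "(x, t, e)"] W(4)[of "(x, t, e)"] by auto
  obtain R where R: "\<And>z. z \<in> C \<Longrightarrow> norm z \<le> R"
    using compact_imp_bounded[OF F'(2)] unfolding bounded_iff by blast
  obtain \<sigma> :: "real \<Rightarrow> real" where \<sigma>: "Ck_open k \<sigma> UNIV" "\<And>s. s \<le> 0 \<Longrightarrow> \<sigma> s = 0" "\<And>s. s \<ge> 1 \<Longrightarrow> \<sigma> s = 1"
    using Ck_step_exists[of k] by blast
  \<comment> \<open>A telescoping choice, so that the translates of \<open>\<phi>\<close> by multiples of \<open>T\<close> sum to 1.\<close>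
  define \<phi> where "\<phi> t = \<sigma> (t / T + 1) - \<sigma> (t / T)" for t
  have \<phi>0: "\<phi> t = 0" if "t \<le> - T \<or> T \<le> t" for t
  proof (cases "t \<le> - T")
    case True
    then have "t / T + 1 \<le> 0" using assms(3) by (simp add: field_simps)
    then show ?thesis by (simp add: \<phi>_def \<sigma>(2))
  next
    case False
    then have "1 \<le> t / T" using assms(3) that by (simp add: field_simps)
    then show ?thesis by (simp add: \<phi>_def \<sigma>(3))
  qed
  have \<phi>1: "\<phi> u + \<phi> (u - T) = 1" if "0 \<le> u" "u < T" for u
  proof -
    have "(u - T) / T + 1 = u / T" "u / T + 1 \<ge> 1" "(u - T) / T \<le> 0"
      using assms(3) that by (auto simp: field_simps)
    then show ?thesis unfolding \<phi>_def using \<sigma>(2)[of "(u - T) / T"] \<sigma>(3)[of "u / T + 1"] by simp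
  qed
  define H where "H z = \<phi> (fst (snd z)) *\<^sub>R F' z" for z :: "'a \<times> real \<times> real"
  have \<sigma>comp: "Ck_open k (\<lambda>z::'a \<times> real \<times> real. \<sigma> (fst (snd z) / T + c)) UNIV" for c
  proof (rule Ck_open_compose[OF _ _ \<sigma>(1)])
    have "bounded_linear (\<lambda>z::'a \<times> real \<times> real. fst (snd z) / T)"
      by (intro bounded_linear_divide bounded_linear_compose[OF bounded_linear_divide]
          bounded_linear_compose[OF bounded_linear_fst] bounded_linear_snd)
    then show "Ck_open k (\<lambda>z::'a \<times> real \<times> real. fst (snd z) / T + c) UNIV"
      by (intro Ck_open_add Ck_open_bounded_linear Ck_open_const open_UNIV)
  qed auto
  have CkH: "Ck_open k H UNIV"
    unfolding H_def[abs_def] \<phi>_def[abs_def]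
    using \<sigma>comp[of 1] \<sigma>comp[of 0] F'(1)
    by (intro Ck_open_scaleR Ck_open_diff open_UNIV) auto
  have H0: "H (x, t, e) = 0" if "t \<le> - T \<or> T \<le> t" for x t e
    using \<phi>0[OF that] by (simp add: H_def)
  define S where "S j z = H (fst z, fst (snd z) - of_int j * T, snd (snd z))" for j and z :: "'a \<times> real \<times> real"
  have CkS: "Ck_open k (S j) UNIV" for j
  proof -
    have "Ck_open k (\<lambda>z::'a \<times> real \<times> real. z + (0, - of_int j * T, 0)) UNIV"
      by (intro Ck_open_add Ck_open_bounded_linear[OF _ bounded_linear_ident] Ck_open_const open_UNIV)
    moreover have "(\<lambda>z::'a \<times> real \<times> real. (fst z, fst (snd z) - of_int j * T, snd (snd z))) =
        (\<lambda>z. z + (0, - of_int j * T, 0))"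
      by (auto simp: fun_eq_iff)
    ultimately have "Ck_open k (\<lambda>z::'a \<times> real \<times> real. (fst z, fst (snd z) - of_int j * T, snd (snd z))) UNIV"
      by simp
    then show ?thesis
      unfolding S_def[abs_def] by (intro Ck_open_compose[OF _ _ CkH]) auto
  qed
  define G where "G z = S \<lfloor>fst (snd z) / T\<rfloor> z + S (\<lfloor>fst (snd z) / T\<rfloor> + 1) z" for z :: "'a \<times> real \<times> real"
  have "Ck_open k G UNIV"
  proof (rule Ck_open_local)
    fix z :: "'a \<times> real \<times> real"
    obtain x0 t0 e0 where z: "z = (x0, t0, e0)" by (cases z)
    define j where "j = \<lfloor>t0 / T\<rfloor>"
    define N where "N = (UNIV :: 'a set) \<times> {(of_int j - 1) * T <..< (of_int j + 1) * T} \<times> (UNIV :: real set)"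
    have N: "open N" unfolding N_def by (intro open_Times) auto
    have "of_int j \<le> t0 / T" "t0 / T < of_int j + 1" unfolding j_def by linarith+
    then have "of_int j * T \<le> t0" "t0 < (of_int j + 1) * T"
      using assms(3) by (auto simp: field_simps)
    then have zN: "z \<in> N" using assms(3) by (auto simp: N_def z algebra_simps)
    \<comment> \<open>The floor jumps at \<open>t = jT\<close>, but on either side the extra summand vanishes, so near the point
      one formula holds on both sides.\<close>
    have "G y = S (j - 1) y + S j y + S (j + 1) y" if "y \<in> N" for y
    proof -
      obtain x t e where y: "y = (x, t, e)" by (cases y)
      have b: "(of_int j - 1) * T < t" "t < (of_int j + 1) * T" using that by (auto simp: N_def y)
      show ?thesis
      proof (cases "t < of_int j * T")
        case True
        have "\<lfloor>t / T\<rfloor> = j - 1"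
          using True b assms(3) by (intro floor_unique) (auto simp: field_simps)
        moreover have "S (j + 1) y = 0"
          using True by (auto simp: S_def y algebra_simps intro!: H0)
        ultimately show ?thesis by (simp add: G_def y)
      next
        case False
        have "\<lfloor>t / T\<rfloor> = j"
          using False b assms(3) by (intro floor_unique) (auto simp: field_simps)
        moreover have "S (j - 1) y = 0"
          using False by (auto simp: S_def y algebra_simps intro!: H0)
        ultimately show ?thesis by (simp add: G_def y)
      qed
    qed
    moreover have "Ck_open k (\<lambda>y. S (j - 1) y + S j y + S (j + 1) y) N"
      using N CkS by (intro Ck_open_add) (auto intro: Ck_open_subset)
    ultimately have "Ck_open k G N"
      using Ck_open_cong[OF N, of "\<lambda>y. S (j - 1) y + S j y + S (j + 1) y" G k] by simp
    then show "\<exists>N. open N \<and> z \<in> N \<and> Ck_open k G N" using N zN by blast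
  qed
  moreover have "G (x, t + T, e) = G (x, t, e)" for x t e
  proof -
    have "\<lfloor>(t + T) / T\<rfloor> = \<lfloor>t / T\<rfloor> + 1"
      using assms(3) by (simp add: add_divide_distrib)
    then show ?thesis by (simp add: G_def S_def algebra_simps)
  qed
  moreover have "G (x, t, e) = 0" if "R < norm x" for x t e
  proof -
    have "(x, s, e) \<notin> C" for s
      using that R[of "(x, s, e)"] norm_fst_le[of x "(s, e)"] by force
    then show ?thesis by (simp add: G_def S_def H_def F'(4))
  qed
  moreover have "G (x, t, e) = g x t e" if "x \<in> D" "e \<in> I" for x t e
  proof -
    have peri: "g x (t - of_int j * T) e = g x t e" for j t
      using periodic_shift_multiple[of "\<lambda>t. g x t e" T t "- j"] per that by simp
    define j where "j = \<lfloor>t / T\<rfloor>"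
    define u where "u = t - of_int j * T"
    have "of_int j \<le> t / T" "t / T < of_int j + 1" unfolding j_def by linarith+
    then have u: "0 \<le> u" "u < T" using assms(3) by (auto simp: u_def field_simps)
    have uT: "t - of_int (j + 1) * T = u - T" by (simp add: u_def algebra_simps)
    have "G (x, t, e) = H (x, u, e) + H (x, u - T, e)"
      unfolding G_def S_def fst_conv snd_conv j_def[symmetric] uT by (simp add: u_def)
    also have "\<dots> = \<phi> u *\<^sub>R g x u e + \<phi> (u - T) *\<^sub>R g x (u - T) e"
      using u that by (simp add: H_def F'g)
    also have "g x u e = g x t e" by (simp add: u_def peri)
    also have "g x (u - T) e = g x t e" unfolding uT[symmetric] by (rule peri)
    also have "\<phi> u *\<^sub>R g x t e + \<phi> (u - T) *\<^sub>R g x t e = g x t e"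
      using \<phi>1[OF u] by (simp flip: scaleR_add_left)
    finally show ?thesis .
  qed
  ultimately show ?thesis by blast
qed

section \<open>Uniform bounds, the mean field and the corrector\<close>

text \<open>The support condition restricts \<open>x\<close> alone. The \<open>\<epsilon>\<close>-variable is confined by the slab
  \<open>0 \<le> \<epsilon> \<le> \<epsilon>0\<close> instead, so that the mean field and the corrector, which are constant in \<open>\<epsilon>\<close>, belong to
  the same class as the vector field and share its bounds.\<close>

definition periodic_field :: "real \<Rightarrow> ('a::euclidean_space \<times> real \<times> real \<Rightarrow> 'b::real_normed_vector) \<Rightarrow> bool" where
  "periodic_field T G \<longleftrightarrow> (\<forall>x t e. G (x, t + T, e) = G (x, t, e)) \<and>
     (\<exists>R. \<forall>x t e. R < norm x \<longrightarrow> G (x, t, e) = 0)"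

abbreviation slab :: "real \<Rightarrow> ('a \<times> real \<times> real) set" where
  "slab e0 \<equiv> UNIV \<times> UNIV \<times> {0..e0}"

lemma C1_has_derivative:
  "Ck_open 1 f UNIV \<Longrightarrow> (f has_derivative frechet_derivative f (at z)) (at z)"
  using Ck_open_Suc_has_derivative[of 0 f UNIV z] by simp

lemma C1_differentiable: "Ck_open 1 f UNIV \<Longrightarrow> f differentiable (at z)"
  using C1_has_derivative unfolding differentiable_def by blast

lemma periodic_reduce:
  fixes f :: "real \<Rightarrow> 'b" assumes "\<And>t. f (t + T) = f t" "0 < T"
  obtains s where "0 \<le> s" "s < T" "f s = f t"
proof -
  define j where "j = \<lfloor>t / T\<rfloor>"
  have "of_int j \<le> t / T" "t / T < of_int j + 1" unfolding j_def by linarith+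
  then have "0 \<le> t - of_int j * T" "t - of_int j * T < T" using assms(2) by (auto simp: field_simps)
  moreover have "f (t - of_int j * T) = f t"
    using periodic_shift_multiple[of f T t "- j", OF assms(1)] by simp
  ultimately show ?thesis using that by blast
qed

text \<open>Up to a shift by periods, the values on the slab are those on a compact set.\<close>

lemma periodic_field_bounded:
  assumes "periodic_field T f" "continuous_on UNIV f" "0 < T"
  obtains M where "0 \<le> M" "\<And>z. z \<in> slab e0 \<Longrightarrow> norm (f z) \<le> M"
proof -
  obtain R where R: "\<And>x t e. R < norm x \<Longrightarrow> f (x, t, e) = 0"
    using assms(1) unfolding periodic_field_def by blast
  let ?K = "cball 0 R \<times> {0..T} \<times> {0..e0}"
  have "compact (f ` ?K)"
    by (intro compact_continuous_image continuous_on_subset[OF assms(2)] compact_Times) auto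
  then have "bounded (f ` ?K)" by (rule compact_imp_bounded)
  then obtain B where B: "\<And>z. z \<in> ?K \<Longrightarrow> norm (f z) \<le> B"
    unfolding bounded_iff by blast
  have "norm (f z) \<le> max 0 B" if "z \<in> slab e0" for z
  proof -
    obtain x t e where z: "z = (x, t, e)" by (cases z)
    show ?thesis
    proof (cases "R < norm x")
      case False
      obtain s where s: "0 \<le> s" "s < T" "f (x, s, e) = f (x, t, e)"
        by (rule periodic_reduce[of "\<lambda>t. f (x, t, e)" T t])
          (use assms in \<open>auto simp: periodic_field_def\<close>)
      then have "(x, s, e) \<in> ?K" using False that by (auto simp: z)
      then show ?thesis using B[of "(x, s, e)"] s by (simp add: z)
    qed (simp add: z R)
  qed
  then show ?thesis using that[of "max 0 B"] by auto
qed

lemma periodic_field_derivative: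
  assumes "periodic_field T G" "\<And>z. G differentiable (at z)"
  shows "periodic_field T (\<lambda>z. frechet_derivative G (at z) v)"
proof -
  obtain R where R: "\<And>x t e. R < norm x \<Longrightarrow> G (x, t, e) = 0"
    using assms(1) unfolding periodic_field_def by blast
  have der: "(G has_derivative frechet_derivative G (at z)) (at z)" for z
    using assms(2) by (simp flip: frechet_derivative_works)
  have "frechet_derivative G (at (x, t + T, e)) = frechet_derivative G (at (x, t, e))" for x t e
  proof -
    have "((\<lambda>z. G (z + (0, T, 0))) has_derivative frechet_derivative G (at ((x, t, e) + (0, T, 0)))) (at (x, t, e))"
      by (rule has_derivative_compose[OF _ der, where f' = "\<lambda>v. v", simplified])
        (auto intro!: derivative_eq_intros)
    moreover have "(\<lambda>z. G (z + (0, T, 0))) = G"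
      using assms(1) by (auto simp: periodic_field_def)
    ultimately show ?thesis using frechet_derivative_at[of G] by simp
  qed
  moreover have "frechet_derivative G (at (x, t, e)) v = 0" if "R < norm x" for x t e
  proof -
    let ?U = "{x. R < norm x} \<times> (UNIV :: (real \<times> real) set)"
    have "open ?U" by (intro open_Times open_Collect_less continuous_intros) auto
    then have "((\<lambda>_. 0) has_derivative frechet_derivative G (at (x, t, e))) (at (x, t, e))"
      by (rule has_derivative_transform_within_open[OF der]) (use that in \<open>auto simp: R\<close>)
    then show ?thesis using has_derivative_unique[OF _ has_derivative_const] by fastforce
  qed
  ultimately show ?thesis
    unfolding periodic_field_def by (intro conjI allI exI[of _ R] impI) simp_all
qed

text \<open>Directional derivatives are bounded one direction at a time. This assembles them into a bound on
  the total derivative.\<close>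

lemma norm_linear_le_Basis:
  fixes L :: "'a::euclidean_space \<Rightarrow> 'b::real_normed_vector" and M :: real
  assumes "linear L" "\<And>b. b \<in> Basis \<Longrightarrow> norm (L b) \<le> M"
  shows "norm (L v) \<le> DIM('a) * M * norm v"
proof -
  have "norm (L v) = norm (\<Sum>b\<in>Basis. (v \<bullet> b) *\<^sub>R L b)"
    by (subst linear_expand_Basis[OF assms(1)]) simp
  also have "\<dots> \<le> (\<Sum>b\<in>(Basis::'a set). norm v * M)"
    by (intro sum_norm_le) (auto intro!: mult_mono assms(2) Basis_le_norm)
  finally show ?thesis by (simp add: mult_ac)
qed

lemma periodic_field_derivative_bounded:
  fixes G :: "'a::euclidean_space \<times> real \<times> real \<Rightarrow> 'b::real_normed_vector"
  assumes "0 < T" "Ck_open 1 G UNIV" "periodic_field T G"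
  obtains K where "0 \<le> K" "\<And>z v. z \<in> slab e0 \<Longrightarrow> norm (frechet_derivative G (at z) v) \<le> K * norm v"
proof -
  let ?D = "\<lambda>z. frechet_derivative G (at z)"
  have dG: "G differentiable (at z)" for z using C1_differentiable[OF assms(2)] .
  have "\<exists>M\<ge>0. \<forall>z\<in>slab e0. norm (?D z b) \<le> M" for b
  proof -
    have "continuous_on UNIV (\<lambda>z. ?D z b)"
      using Ck_open_SucD[of 0 G UNIV b] assms(2) by simp
    from periodic_field_bounded[OF periodic_field_derivative[OF assms(3) dG] this assms(1)]
    show ?thesis by metis
  qed
  then obtain M where M: "\<And>b. M b \<ge> 0" "\<And>b z. z \<in> slab e0 \<Longrightarrow> norm (?D z b) \<le> M b"
    by metis
  let ?M = "\<Sum>b\<in>Basis. M b"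
  have "norm (?D z v) \<le> DIM('a \<times> real \<times> real) * ?M * norm v" if "z \<in> slab e0" for z v
  proof (rule norm_linear_le_Basis[of "?D z"])
    show "linear (?D z)" using dG by (rule linear_frechet_derivative)
    show "norm (?D z b) \<le> ?M" if "b \<in> Basis" for b
      using M(2)[OF \<open>z \<in> slab e0\<close>, of b] member_le_sum[of b Basis M] M(1) that by simp
  qed
  moreover have "0 \<le> DIM('a \<times> real \<times> real) * ?M" by (simp add: M(1) sum_nonneg)
  ultimately show ?thesis using that by blast
qed

lemma convex_slab: "convex (slab e0)"
  by (intro convex_Times) auto

lemma periodic_field_Lipschitz:
  fixes G :: "'a::euclidean_space \<times> real \<times> real \<Rightarrow> 'b::real_normed_vector"
  assumes "0 < T" "Ck_open 1 G UNIV" "periodic_field T G"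
  obtains K where "0 \<le> K"
    "\<And>z z'. z \<in> slab e0 \<Longrightarrow> z' \<in> slab e0 \<Longrightarrow> norm (G z' - G z) \<le> K * norm (z' - z)"
proof -
  obtain K where K: "0 \<le> K" "\<And>z v. z \<in> slab e0 \<Longrightarrow> norm (frechet_derivative G (at z) v) \<le> K * norm v"
    using periodic_field_derivative_bounded[OF assms] by metis
  have "norm (G z' - G z) \<le> K * norm (z' - z)" if "z \<in> slab e0" "z' \<in> slab e0" for z z'
  proof (rule differentiable_bound[OF convex_slab _ _ that(2,1)])
    show "(G has_derivative frechet_derivative G (at y)) (at y within slab e0)" for y
      by (rule has_derivative_at_withinI[OF C1_has_derivative[OF assms(2)]])
    show "onorm (frechet_derivative G (at y)) \<le> K" if "y \<in> slab e0" for y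
      using K that by (intro onorm_le) (auto simp: mult.commute)
  qed
  then show ?thesis using K(1) that by blast
qed

text \<open>All quantitative input of the theorem: one constant for the size, the derivative, its Lipschitz
  constant and the quadratic Taylor remainder. The class is closed under directional derivatives and
  the slab is convex, so everything follows from boundedness and the mean value inequality.\<close>

lemma periodic_field_bounds:
  fixes G :: "'a::euclidean_space \<times> real \<times> real \<Rightarrow> 'b::real_normed_vector"
  assumes "0 < T" "Ck_open 2 G UNIV" "periodic_field T G"
  obtains K where "0 < K"
    "\<And>z. z \<in> slab e0 \<Longrightarrow> norm (G z) \<le> K"
    "\<And>z v. z \<in> slab e0 \<Longrightarrow> norm (frechet_derivative G (at z) v) \<le> K * norm v"
    "\<And>z z'. z \<in> slab e0 \<Longrightarrow> z' \<in> slab e0 \<Longrightarrow> norm (G z' - G z) \<le> K * norm (z' - z)"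
    "\<And>z z' v. z \<in> slab e0 \<Longrightarrow> z' \<in> slab e0 \<Longrightarrow>
       norm (frechet_derivative G (at z') v - frechet_derivative G (at z) v) \<le> K * norm (z' - z) * norm v"
    "\<And>z z'. z \<in> slab e0 \<Longrightarrow> z' \<in> slab e0 \<Longrightarrow>
       norm (G z' - G z - frechet_derivative G (at z) (z' - z)) \<le> K * (norm (z' - z))\<^sup>2"
proof -
  let ?D = "\<lambda>z. frechet_derivative G (at z)"
  have C2: "Ck_open (Suc 1) G UNIV" using assms(2) by (simp add: numeral_2_eq_2)
  have C1: "Ck_open 1 G UNIV" using C2 by (rule Ck_open_Suc_lower)
  have dG: "G differentiable (at z)" for z using C1_differentiable[OF C1] .
  have lin: "linear (?D z)" for z using dG by (rule linear_frechet_derivative)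
  obtain K1 where K1: "0 \<le> K1" "\<And>z. z \<in> slab e0 \<Longrightarrow> norm (G z) \<le> K1"
    using periodic_field_bounded[OF assms(3) Ck_open_continuous_on[OF C1] assms(1)] by metis
  obtain K2 where K2: "0 \<le> K2" "\<And>z v. z \<in> slab e0 \<Longrightarrow> norm (?D z v) \<le> K2 * norm v"
    using periodic_field_derivative_bounded[OF assms(1) C1 assms(3)] by metis
  obtain K3 where K3: "0 \<le> K3"
    "\<And>z z'. z \<in> slab e0 \<Longrightarrow> z' \<in> slab e0 \<Longrightarrow> norm (G z' - G z) \<le> K3 * norm (z' - z)"
    using periodic_field_Lipschitz[OF assms(1) C1 assms(3)] by metis
  have "\<exists>M\<ge>0. \<forall>z\<in>slab e0. \<forall>z'\<in>slab e0. norm (?D z' b - ?D z b) \<le> M * norm (z' - z)" for b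
    using periodic_field_Lipschitz[OF assms(1) Ck_open_SucD[OF C2] periodic_field_derivative[OF assms(3) dG],
        of e0 b] by metis
  then obtain M where M: "\<And>b. M b \<ge> 0"
    "\<And>b z z'. z \<in> slab e0 \<Longrightarrow> z' \<in> slab e0 \<Longrightarrow> norm (?D z' b - ?D z b) \<le> M b * norm (z' - z)"
    by metis
  define K4 where "K4 = DIM('a \<times> real \<times> real) * (\<Sum>b\<in>Basis. M b)"
  have K4: "0 \<le> K4" by (simp add: K4_def M(1) sum_nonneg)
  have D4: "norm (?D z' v - ?D z v) \<le> K4 * norm (z' - z) * norm v"
    if "z \<in> slab e0" "z' \<in> slab e0" for z z' v
  proof -
    have "norm (?D z' v - ?D z v) \<le> DIM('a \<times> real \<times> real) * ((\<Sum>b\<in>Basis. M b) * norm (z' - z)) * norm v"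
    proof (rule norm_linear_le_Basis[of "\<lambda>v. ?D z' v - ?D z v"])
      show "linear (\<lambda>v. ?D z' v - ?D z v)" by (intro linear_compose_sub lin)
      show "norm (?D z' b - ?D z b) \<le> (\<Sum>b\<in>Basis. M b) * norm (z' - z)" if "b \<in> Basis" for b
      proof -
        have "M b * norm (z' - z) \<le> (\<Sum>b\<in>Basis. M b) * norm (z' - z)"
          using member_le_sum[of b Basis M] M(1) that by (intro mult_right_mono) auto
        then show ?thesis using M(2)[OF \<open>z \<in> slab e0\<close> \<open>z' \<in> slab e0\<close>, of b] by linarith
      qed
    qed
    then show ?thesis by (simp add: K4_def mult_ac)
  qed
  have D5: "norm (G z' - G z - ?D z (z' - z)) \<le> K4 * (norm (z' - z))\<^sup>2"
    if z: "z \<in> slab e0" "z' \<in> slab e0" for z z'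
  proof -
    let ?S = "closed_segment z z'"
    have S: "?S \<subseteq> slab e0" using convex_slab z by (rule closed_segment_subset[rotated 2])
    have "norm ((G z' - ?D z z') - (G z - ?D z z)) \<le> (K4 * norm (z' - z)) * norm (z' - z)"
    proof (rule differentiable_bound[of ?S "\<lambda>y. G y - ?D z y" "\<lambda>y v. ?D y v - ?D z v"])
      fix y assume y: "y \<in> ?S"
      have "bounded_linear (?D z)" using lin by (simp add: linear_conv_bounded_linear)
      then show "((\<lambda>y. G y - ?D z y) has_derivative (\<lambda>v. ?D y v - ?D z v)) (at y within ?S)"
        by (rule has_derivative_diff[OF has_derivative_at_withinI[OF C1_has_derivative[OF C1]]
              bounded_linear_imp_has_derivative])
      have "norm (y - z) \<le> norm (z' - z)"
        using segment_bound(1)[OF y] by simp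
      then have "K4 * norm (y - z) * norm v \<le> K4 * norm (z' - z) * norm v" for v :: "'a \<times> real \<times> real"
        using K4 by (intro mult_right_mono mult_left_mono) auto
      then have "norm (?D y v - ?D z v) \<le> K4 * norm (z' - z) * norm v" for v
        using D4[OF z(1), of y v] S y by (meson order_trans subsetD)
      then show "onorm (\<lambda>v. ?D y v - ?D z v) \<le> K4 * norm (z' - z)"
        by (rule onorm_le)
    qed auto
    moreover have "?D z z' - ?D z z = ?D z (z' - z)" using linear_diff[OF lin] by metis
    ultimately show ?thesis by (simp add: power2_eq_square algebra_simps)
  qed
  define K where "K = K1 + K2 + K3 + K4 + 1"
  have le: "K1 \<le> K" "K2 \<le> K" "K3 \<le> K" "K4 \<le> K" "0 < K"
    using K1(1) K2(1) K3(1) K4 by (auto simp: K_def)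
  show ?thesis
  proof (rule that[OF le(5)])
    show "norm (G z) \<le> K" if "z \<in> slab e0" for z
      using K1(2)[OF that] le by linarith
    show "norm (?D z v) \<le> K * norm v" if "z \<in> slab e0" for z v
      using K2(2)[OF that, of v] mult_right_mono[OF le(2), of "norm v"] by simp
    show "norm (G z' - G z) \<le> K * norm (z' - z)" if "z \<in> slab e0" "z' \<in> slab e0" for z z'
      using K3(2)[OF that] mult_right_mono[OF le(3), of "norm (z' - z)"] by simp
    show "norm (?D z' v - ?D z v) \<le> K * norm (z' - z) * norm v" if "z \<in> slab e0" "z' \<in> slab e0" for z z' v
      using D4[OF that, of v] mult_right_mono[OF le(4), of "norm (z' - z) * norm v"] by (simp add: mult_ac)
    show "norm (G z' - G z - ?D z (z' - z)) \<le> K * (norm (z' - z))\<^sup>2" if "z \<in> slab e0" "z' \<in> slab e0" for z z'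
      using D5[OF that] mult_right_mono[OF le(4), of "(norm (z' - z))\<^sup>2"] by simp
  qed
qed

text \<open>The average of the field at \<open>\<epsilon> = 0\<close>, with the period rescaled to \<open>[0, 1]\<close>. It is taken as
  a function of all three variables in order to be a \<open>periodic_field\<close> itself.\<close>

definition mean_field :: "real \<Rightarrow> ('a::euclidean_space \<times> real \<times> real \<Rightarrow> 'b::euclidean_space) \<Rightarrow> 'a \<times> real \<times> real \<Rightarrow> 'b" where
  "mean_field T G z = integral {0..1} (\<lambda>s. G (fst z, T * s, 0))"

text \<open>This is \<open>\<integral>\<^sub>0\<^sup>t (G(y, s, 0) - m(y)) ds\<close> after the substitution \<open>s \<mapsto> t s\<close>, which makes the
  integration interval independent of the point and covers both signs of \<open>t\<close>.\<close>

definition corrector :: "real \<Rightarrow> ('a::euclidean_space \<times> real \<times> real \<Rightarrow> 'b::euclidean_space) \<Rightarrow> 'a \<times> real \<times> real \<Rightarrow> 'b" where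
  "corrector T G z = fst (snd z) *\<^sub>R integral {0..1} (\<lambda>s. G (fst z, fst (snd z) * s, 0) - mean_field T G z)"

lemma mean_field_cong: "mean_field T G (x, t, e) = mean_field T G (x, 0, 0)"
  by (simp add: mean_field_def)

lemma Ck_open_mean_field:
  assumes "Ck_open k G UNIV" shows "Ck_open k (mean_field T G) UNIV"
proof -
  have "Ck_open k (\<lambda>q::('a \<times> real \<times> real) \<times> real. G (fst (fst q), T * snd q, 0)) UNIV"
    by (rule Ck_open_compose[OF _ _ assms])
      (auto intro!: Ck_open_bounded_linear bounded_linear_Pair bounded_linear_zero
        bounded_linear_const_mult bounded_linear_snd bounded_linear_compose[OF bounded_linear_fst]
        bounded_linear_fst)
  from Ck_open_integral[OF this] show ?thesis
    by (simp add: mean_field_def[abs_def])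
qed

lemma Ck_open_corrector:
  assumes "Ck_open k G UNIV" shows "Ck_open k (corrector T G) UNIV"
proof -
  let ?E = "UNIV :: (('a \<times> real \<times> real) \<times> real) set"
  have bl: "bounded_linear (\<lambda>q::('a \<times> real \<times> real) \<times> real. fst (fst q))"
    "bounded_linear (\<lambda>q::('a \<times> real \<times> real) \<times> real. fst (snd (fst q)))"
    by (intro bounded_linear_compose[OF bounded_linear_fst] bounded_linear_compose[OF bounded_linear_snd] bounded_linear_fst)+
  have "Ck_open k (\<lambda>q::('a \<times> real \<times> real) \<times> real. (fst (fst q), fst (snd (fst q)) * snd q, 0::real)) ?E"
    by (intro Ck_open_Pair Ck_open_mult Ck_open_const open_UNIV Ck_open_bounded_linear bl bounded_linear_snd)
  then have "Ck_open k (\<lambda>q. G (fst (fst q), fst (snd (fst q)) * snd q, 0)) ?E"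
    by (intro Ck_open_compose[OF _ _ assms]) auto
  moreover have "Ck_open k (\<lambda>q. mean_field T G (fst q)) ?E"
    by (intro Ck_open_compose[OF _ _ Ck_open_mean_field[OF assms]] Ck_open_bounded_linear bounded_linear_fst) auto
  ultimately have "Ck_open k (\<lambda>q. G (fst (fst q), fst (snd (fst q)) * snd q, 0) - mean_field T G (fst q)) ?E"
    by (intro Ck_open_diff open_UNIV)
  from Ck_open_integral[OF this]
  have int: "Ck_open k (\<lambda>z. integral {0..1} (\<lambda>s. G (fst z, fst (snd z) * s, 0) - mean_field T G z)) UNIV"
    by simp
  show ?thesis
    unfolding corrector_def[abs_def]
    by (rule Ck_open_scaleR[OF open_UNIV Ck_open_bounded_linear[OF open_UNIV
          bounded_linear_compose[OF bounded_linear_fst bounded_linear_snd]] int])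
qed

lemma periodic_field_mean_field:
  assumes "periodic_field T G" shows "periodic_field T (mean_field T G)"
proof -
  obtain R where "\<And>x t e. R < norm x \<Longrightarrow> G (x, t, e) = 0"
    using assms unfolding periodic_field_def by blast
  then show ?thesis
    unfolding periodic_field_def mean_field_def by (intro conjI allI exI[of _ R] impI) simp_all
qed

lemma periodic_field_continuous_line:
  assumes "continuous_on UNIV G"
  shows "continuous_on S (\<lambda>t. G (x, t, e))"
  by (rule continuous_on_compose2[OF assms]) (auto intro!: continuous_intros)

text \<open>The rescaled integral is a difference of values of any primitive \<open>P\<close> of the integrand. The point of
  the auxiliary interval \<open>[a, b]\<close> is that primitives are available on compact intervals.\<close>

lemma corrector_eq_integral_diff:
  assumes "\<And>s. s \<in> {a..b} \<Longrightarrow> (P has_vector_derivative (G (x, s, 0) - mean_field T G (x, 0, 0))) (at s within {a..b})"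
    and "a \<le> 0" "0 \<le> b" "t \<in> {a..b}"
  shows "corrector T G (x, t, e) = P t - P 0"
proof -
  let ?h = "\<lambda>s. G (x, s, 0) - mean_field T G (x, 0, 0)"
  have "((\<lambda>s. t *\<^sub>R ?h (t * s)) has_integral P (t * 1) - P (t * 0)) {0..1}"
  proof (rule fundamental_theorem_of_calculus)
    fix s :: real assume s: "s \<in> {0..1}"
    have sub: "(\<lambda>s. t * s) ` {0..1} \<subseteq> {a..b}"
    proof
      fix u assume "u \<in> (\<lambda>s. t * s) ` {0..1}"
      then obtain s where s: "0 \<le> s" "s \<le> 1" "u = t * s" by auto
      have "0 \<le> t \<Longrightarrow> t * s \<le> t" "t \<le> 0 \<Longrightarrow> t \<le> t * s"
        using s mult_left_le[of s t] mult_left_le[of s "- t"] by auto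
      moreover have "0 \<le> t \<Longrightarrow> 0 \<le> t * s" "t \<le> 0 \<Longrightarrow> t * s \<le> 0"
        using s by (auto simp: mult_nonpos_nonneg)
      ultimately have "0 \<le> t * s \<and> t * s \<le> t \<or> t \<le> t * s \<and> t * s \<le> 0"
        by (cases "0 \<le> t") auto
      then show "u \<in> {a..b}" using assms(2-4) unfolding s(3) atLeastAtMost_iff by linarith
    qed
    have "((\<lambda>s. P (t * s)) has_vector_derivative t *\<^sub>R ?h (t * s)) (at s within {0..1})"
    proof -
      have "((\<lambda>s. t * s) has_vector_derivative t) (at s within {0..1})"
        by (auto intro!: derivative_eq_intros)
      moreover have "(P has_vector_derivative ?h (t * s)) (at (t * s) within (\<lambda>s. t * s) ` {0..1})"
        by (rule has_vector_derivative_within_subset[OF assms(1) sub]) (use sub s in blast)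
      ultimately show ?thesis
        using vector_diff_chain_within unfolding o_def by fast
    qed
    then show "((\<lambda>s. P (t * s)) has_vector_derivative t *\<^sub>R ?h (t * s)) (at s within {0..1})" .
  qed simp
  from integral_unique[OF this] have "integral {0..1} (\<lambda>s. t *\<^sub>R ?h (t * s)) = P t - P 0"
    by simp
  then show ?thesis
    by (simp add: corrector_def mean_field_cong[of T G x t e])
qed

lemma corrector_has_time_derivative:
  assumes "continuous_on UNIV G"
  shows "((\<lambda>t. corrector T G (x, t, e)) has_vector_derivative G (x, t, 0) - mean_field T G (x, t, e)) (at t)"
proof -
  let ?h = "\<lambda>s. G (x, s, 0) - mean_field T G (x, 0, 0)"
  let ?a = "- \<bar>t\<bar> - 1" and ?b = "\<bar>t\<bar> + 1"
  have "continuous_on {?a..?b} ?h"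
    by (intro continuous_intros periodic_field_continuous_line assms)
  from antiderivative_continuous[OF this] obtain P where
    P: "\<And>s. s \<in> {?a..?b} \<Longrightarrow> (P has_vector_derivative ?h s) (at s within {?a..?b})" by metis
  have "(P has_vector_derivative ?h t) (at t)"
    using P[of t] by (simp add: at_within_Icc_at abs_if split: if_splits)
  then have "((\<lambda>t. P t - P 0) has_vector_derivative ?h t) (at t)"
    by (auto intro!: derivative_eq_intros)
  moreover have "corrector T G (x, s, e) = P s - P 0" if "s \<in> {?a..?b}" for s
    by (rule corrector_eq_integral_diff[OF P _ _ that]) auto
  ultimately have "((\<lambda>t. corrector T G (x, t, e)) has_vector_derivative ?h t) (at t)"
    by (elim has_vector_derivative_transform_within_open[where S = "{?a<..<?b}"]) auto
  then show ?thesis by (simp add: mean_field_cong[of T G x t e])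
qed

text \<open>The increment over one period has derivative zero in time because the integrand is periodic, and
  it vanishes at \<open>t = 0\<close> because the integrand has mean zero.\<close>

lemma periodic_field_corrector:
  assumes "periodic_field T G" "continuous_on UNIV G"
  shows "periodic_field T (corrector T G)"
proof -
  let ?w = "\<lambda>x t e. corrector T G (x, t, e)"
  obtain R where R: "\<And>x t e. R < norm x \<Longrightarrow> G (x, t, e) = 0"
    using assms(1) unfolding periodic_field_def by blast
  have "?w x (t + T) e = ?w x t e" for x t e
  proof -
    have "((\<lambda>t. ?w x (t + T) e - ?w x t e) has_vector_derivative 0) (at t within UNIV)" for t
    proof -
      have "((\<lambda>t. ?w x (t + T) e) has_vector_derivative G (x, t + T, 0) - mean_field T G (x, t + T, e)) (at t)"
      proof -
        have "((\<lambda>t. t + T) has_vector_derivative 1) (at t)"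
          by (auto intro!: derivative_eq_intros)
        from vector_diff_chain_at[OF this corrector_has_time_derivative[OF assms(2)]]
        show ?thesis by (simp add: o_def)
      qed
      from has_vector_derivative_diff[OF this corrector_has_time_derivative[OF assms(2), of T x e t]]
      show ?thesis
        using assms(1) by (simp add: periodic_field_def mean_field_cong[of T G x t e] mean_field_cong[of T G x "t + T" e])
    qed
    then obtain c where "\<And>t. t \<in> UNIV \<Longrightarrow> ?w x (t + T) e - ?w x t e = c"
      by (rule has_vector_derivative_zero_constant[OF convex_UNIV]) fast
    then have c: "\<And>t. ?w x (t + T) e - ?w x t e = c" by blast
    have "?w x T e = 0"
    proof -
      have "(\<lambda>s. G (x, T * s, 0)) integrable_on {0..1}"
        by (rule integrable_continuous_real, rule continuous_on_compose2[OF assms(2)])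
          (auto intro!: continuous_intros)
      then have "integral {0..1} (\<lambda>s. G (x, T * s, 0) - mean_field T G (x, T, e)) =
          integral {0..1} (\<lambda>s. G (x, T * s, 0)) - integral {0..1} (\<lambda>s::real. mean_field T G (x, T, e))"
        by (rule Henstock_Kurzweil_Integration.integral_diff) (rule integrable_const_ivl)
      then show ?thesis by (simp add: corrector_def mean_field_def)
    qed
    moreover have "?w x 0 e = 0" by (simp add: corrector_def)
    ultimately have "c = 0" using c[of 0] by simp
    then show ?thesis using c[of t] by simp
  qed
  moreover have "?w x t e = 0" if "R < norm x" for x t e
    using R[OF that] by (simp add: corrector_def mean_field_def)
  ultimately show ?thesis unfolding periodic_field_def by blast
qed

lemma corrector_derivative_time:
  assumes "Ck_open 1 G UNIV"
  shows "frechet_derivative (corrector T G) (at (x, t, e)) (0, 1, 0) = G (x, t, 0) - mean_field T G (x, t, e)"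
proof -
  let ?W = "corrector T G"
  have "(?W has_derivative frechet_derivative ?W (at (x, t, e))) (at (x, t, e))"
    by (rule C1_has_derivative[OF Ck_open_corrector[OF assms]])
  then have "((\<lambda>t. ?W (x, t, e)) has_derivative (\<lambda>h. frechet_derivative ?W (at (x, t, e)) (0, h, 0))) (at t)"
    by (intro has_derivative_compose[of "\<lambda>t. (x, t, e)" "\<lambda>h. (0, h, 0)" t UNIV ?W])
      (auto intro!: derivative_eq_intros)
  moreover have "((\<lambda>t. ?W (x, t, e)) has_derivative (\<lambda>h. h *\<^sub>R (G (x, t, 0) - mean_field T G (x, t, e)))) (at t)"
    using corrector_has_time_derivative[OF Ck_open_continuous_on[OF assms], of T x e t]
    by (simp add: has_vector_derivative_def)
  ultimately have "(\<lambda>h. frechet_derivative ?W (at (x, t, e)) (0, h, 0)) = (\<lambda>h. h *\<^sub>R (G (x, t, 0) - mean_field T G (x, t, e)))"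
    by (rule has_derivative_unique)
  from fun_cong[OF this, of 1] show ?thesis by simp
qed

lemma integral_rescale:
  fixes f :: "real \<Rightarrow> 'b::euclidean_space"
  assumes "0 < T" "continuous_on {0..T} f"
  shows "integral {0..T} f = T *\<^sub>R integral {0..1} (\<lambda>s. f (T * s))"
proof -
  have "(f has_integral integral {0..T} f) (cbox 0 T)"
    using integrable_continuous_real[OF assms(2)] by (simp add: integrable_integral)
  from has_integral_affinity[OF this, of T 0]
  have "((\<lambda>s. f (T * s)) has_integral (1 / T) *\<^sub>R integral {0..T} f) {0..1}"
    using assms(1) by simp
  from integral_unique[OF this] show ?thesis using assms(1) by simp
qed

lemma time_average_eq_mean_field:
  assumes "0 < T" "\<And>t. G (x, t, 0) = g x t 0" "continuous_on UNIV G"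
  shows "time_average T g x = mean_field T G (x, t, e)"
  using integral_rescale[OF assms(1) periodic_field_continuous_line[OF assms(3)], of x 0] assms(1)
  by (simp add: time_average_def mean_field_def assms(2))

lemma mean_field_derivative:
  assumes "Ck_open 1 G UNIV"
  shows "frechet_derivative (mean_field T G) (at z) v =
    integral {0..1} (\<lambda>s. frechet_derivative G (at (fst z, T * s, 0)) (fst v, 0, 0))"
proof -
  let ?l = "\<lambda>q::('a \<times> real \<times> real) \<times> real. (fst (fst q), T * snd q, 0::real)"
  let ?f = "\<lambda>q. G (?l q)"
  have bl: "bounded_linear ?l"
    by (intro bounded_linear_Pair bounded_linear_zero bounded_linear_const_mult bounded_linear_snd
        bounded_linear_compose[OF bounded_linear_fst] bounded_linear_fst)
  have C: "Ck_open 1 ?f UNIV"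
    by (rule Ck_open_compose[OF open_UNIV _ assms Ck_open_bounded_linear[OF open_UNIV bl]]) simp
  have "(?f has_derivative (\<lambda>u. frechet_derivative G (at (?l q)) (?l u))) (at q)" for q
    by (rule has_derivative_compose[OF bounded_linear_imp_has_derivative[OF bl] C1_has_derivative[OF assms]])
  from frechet_derivative_at[OF this]
  have fD: "frechet_derivative ?f (at q) = (\<lambda>u. frechet_derivative G (at (?l q)) (?l u))" for q by simp
  have "(mean_field T G has_derivative (\<lambda>v. integral {0..1} (\<lambda>s. frechet_derivative ?f (at (z, s)) (v, 0)))) (at z)"
    using has_derivative_integral_param[OF C, of z] by (simp add: mean_field_def[abs_def])
  from frechet_derivative_at[OF this] show ?thesis unfolding fD by (auto dest: fun_cong[of _ _ v])
qed

section \<open>Averaging over long times and the near-identity change of coordinates\<close>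

text \<open>Gronwall's inequality in a form that avoids the nondifferentiable norm: the square \<open>|u|\<^sup>2\<close> satisfies
  \<open>(|u|\<^sup>2)' \<le> 3a |u|\<^sup>2 + b\<^sup>2/a\<close>, since \<open>2 b |u| \<le> a |u|\<^sup>2 + b\<^sup>2/a\<close>.\<close>

lemma linear_growth_bound:
  fixes u :: "real \<Rightarrow> 'a::real_inner"
  assumes der: "\<And>t. t \<in> {0..\<tau>} \<Longrightarrow> (u has_vector_derivative u' t) (at t within {0..\<tau>})"
    and bnd: "\<And>t. t \<in> {0..\<tau>} \<Longrightarrow> norm (u' t) \<le> a * norm (u t) + b"
    and "0 < a" "0 \<le> b" and t: "t \<in> {0..\<tau>}"
  shows "(norm (u t))\<^sup>2 \<le> exp (3 * a * t) * ((norm (u 0))\<^sup>2 + b\<^sup>2 / a * t)"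
proof -
  \<comment> \<open>Nonincreasing by the differential inequality.\<close>
  define h where "h s = exp (- (3 * a * s)) * (u s \<bullet> u s) - b\<^sup>2 / a * s" for s
  have cont: "continuous_on {0..\<tau>} u"
    using continuous_on_vector_derivative der by blast
  have "h t \<le> h 0"
  proof (rule DERIV_nonpos_imp_decreasing_open[of 0 t h])
    show "0 \<le> t" using t by simp
    show "continuous_on {0..t} h"
      unfolding h_def[abs_def] using t
      by (intro continuous_intros continuous_on_subset[OF cont]) auto
    fix s assume s: "0 < s" "s < t"
    then have "(u has_vector_derivative u' s) (at s)"
      using der[of s] t by (simp add: at_within_Icc_at)
    then have "((\<lambda>s. u s \<bullet> u s) has_real_derivative (2 * (u s \<bullet> u' s))) (at s)"
      unfolding has_vector_derivative_def has_field_derivative_def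
      by (auto intro!: derivative_eq_intros simp: inner_commute algebra_simps)
    then have d: "(h has_real_derivative
        (exp (- (3 * a * s)) * (2 * (u s \<bullet> u' s) - 3 * a * (u s \<bullet> u s)) - b\<^sup>2 / a)) (at s)"
      unfolding h_def[abs_def] using assms(3) by (auto intro!: derivative_eq_intros simp: algebra_simps)
    have "u s \<bullet> u' s \<le> norm (u s) * norm (u' s)" by (rule norm_cauchy_schwarz)
    also have "\<dots> \<le> norm (u s) * (a * norm (u s) + b)"
      using bnd[of s] s t by (intro mult_left_mono) auto
    finally have 1: "2 * (u s \<bullet> u' s) \<le> 2 * a * (norm (u s))\<^sup>2 + 2 * b * norm (u s)"
      by (simp add: algebra_simps power2_eq_square)
    have "0 \<le> (a * norm (u s) - b)\<^sup>2 / a" using assms(3) by simp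
    also have "\<dots> = a * (norm (u s))\<^sup>2 - 2 * b * norm (u s) + b\<^sup>2 / a"
      using assms(3) by (simp add: field_simps power2_eq_square)
    finally have 2: "2 * (u s \<bullet> u' s) - 3 * a * (u s \<bullet> u s) \<le> b\<^sup>2 / a"
      using 1 by (simp add: dot_square_norm)
    have "exp (- (3 * a * s)) * (2 * (u s \<bullet> u' s) - 3 * a * (u s \<bullet> u s)) \<le> exp (- (3 * a * s)) * (b\<^sup>2 / a)"
      using 2 by (intro mult_left_mono) auto
    also have "\<dots> \<le> 1 * (b\<^sup>2 / a)"
      using assms(3) s by (intro mult_right_mono) auto
    finally show "\<exists>y. (h has_real_derivative y) (at s) \<and> y \<le> 0" using d by force
  qed
  then have "exp (- (3 * a * t)) * (norm (u t))\<^sup>2 \<le> (norm (u 0))\<^sup>2 + b\<^sup>2 / a * t"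
    by (simp add: h_def dot_square_norm)
  then have "exp (3 * a * t) * (exp (- (3 * a * t)) * (norm (u t))\<^sup>2) \<le> exp (3 * a * t) * ((norm (u 0))\<^sup>2 + b\<^sup>2 / a * t)"
    by (intro mult_left_mono) auto
  moreover have "exp (3 * a * t) * (exp (- (3 * a * t)) * (norm (u t))\<^sup>2) = (norm (u t))\<^sup>2"
    by (simp flip: mult.assoc exp_add)
  ultimately show ?thesis by simp
qed

lemma corrector_slice_derivative:
  fixes G :: "'a::euclidean_space \<times> real \<times> real \<Rightarrow> 'b::euclidean_space"
  assumes C1: "Ck_open 1 G UNIV" and x: "(x has_vector_derivative x') (at t within J)"
  shows "((\<lambda>t. corrector T G (x t, t, e)) has_vector_derivative
      frechet_derivative (corrector T G) (at (x t, t, e)) (x', 0, 0) + (G (x t, t, 0) - mean_field T G (x t, t, e)))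
    (at t within J)"
proof -
  let ?D = "frechet_derivative (corrector T G) (at (x t, t, e))"
  have D: "(corrector T G has_derivative ?D) (at (x t, t, e))"
    by (rule C1_has_derivative[OF Ck_open_corrector[OF C1]])
  have lin: "linear ?D" using has_derivative_linear[OF D] .
  have "((\<lambda>t. (x t, t, e)) has_derivative (\<lambda>h. (h *\<^sub>R x', h, 0))) (at t within J)"
    using x unfolding has_vector_derivative_def by (auto intro!: derivative_eq_intros)
  from has_derivative_compose[OF this D]
  have "((\<lambda>t. corrector T G (x t, t, e)) has_derivative (\<lambda>h. ?D (h *\<^sub>R x', h, 0))) (at t within J)" .
  moreover have "?D (h *\<^sub>R x', h, 0) = h *\<^sub>R (?D (x', 0, 0) + (G (x t, t, 0) - mean_field T G (x t, t, e)))" for h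
  proof -
    have "?D (h *\<^sub>R x', h, 0) = ?D (h *\<^sub>R ((x', 0, 0) + (0, 1, 0)))" by simp
    also have "\<dots> = h *\<^sub>R (?D (x', 0, 0) + ?D (0, 1, 0))"
      by (simp only: linear_scale[OF lin] linear_add[OF lin])
    finally show ?thesis using corrector_derivative_time[OF C1] by simp
  qed
  ultimately show ?thesis by (simp add: has_vector_derivative_def)
qed

text \<open>The change of variables enters in its explicit direction, \<open>z = x - \<epsilon> w(x, t)\<close>, which makes sense
  for every \<open>\<epsilon>\<close>. The difference \<open>u = z - y\<close> satisfies
  \<open>|u'| \<le> \<epsilon> K3 |u| + \<epsilon>\<^sup>2 B\<close>, which over a time \<open>c/\<epsilon>\<close> allows growth by a bounded factor and a forcing
  of total size \<open>O(\<epsilon>)\<close>.\<close>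

lemma averaging_estimate:
  fixes G :: "'a::euclidean_space \<times> real \<times> real \<Rightarrow> 'a" and K :: real
  assumes "0 < T" "Ck_open 2 G UNIV" "periodic_field T G" "0 < c" "0 < e0"
  shows "\<exists>C. \<forall>e\<in>{0<..e0}. \<forall>\<tau> x y. \<tau> \<le> c / e \<longrightarrow>
    (\<forall>t\<in>{0..\<tau>}. (x has_vector_derivative e *\<^sub>R G (x t, t, e)) (at t within {0..\<tau>})) \<longrightarrow>
    (\<forall>t\<in>{0..\<tau>}. (y has_vector_derivative e *\<^sub>R mean_field T G (y t, t, e)) (at t within {0..\<tau>})) \<longrightarrow>
    norm (x 0 - y 0) \<le> K * e \<longrightarrow> (\<forall>t\<in>{0..\<tau>}. norm (x t - y t) \<le> C * e)"
proof -
  let ?W = "corrector T G" and ?m = "mean_field T G"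
  have C1: "Ck_open 1 G UNIV" using assms(2) by (rule Ck_open_mono) simp
  have cG: "continuous_on UNIV G" using C1 by (rule Ck_open_continuous_on)
  obtain K1 where K1: "0 < K1" "\<And>z. z \<in> slab e0 \<Longrightarrow> norm (G z) \<le> K1"
    "\<And>z z'. z \<in> slab e0 \<Longrightarrow> z' \<in> slab e0 \<Longrightarrow> norm (G z' - G z) \<le> K1 * norm (z' - z)"
    by (rule periodic_field_bounds[OF assms(1-3), of e0]) blast
  obtain K2 where K2: "0 < K2" "\<And>z. z \<in> slab e0 \<Longrightarrow> norm (?W z) \<le> K2"
    "\<And>z v. z \<in> slab e0 \<Longrightarrow> norm (frechet_derivative ?W (at z) v) \<le> K2 * norm v"
    by (rule periodic_field_bounds[OF assms(1) Ck_open_corrector[OF assms(2)]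
          periodic_field_corrector[OF assms(3) cG], of e0]) blast
  obtain K3 where K3: "0 < K3"
    "\<And>z z'. z \<in> slab e0 \<Longrightarrow> z' \<in> slab e0 \<Longrightarrow> norm (?m z' - ?m z) \<le> K3 * norm (z' - z)"
    by (rule periodic_field_bounds[OF assms(1) Ck_open_mean_field[OF assms(2)]
          periodic_field_mean_field[OF assms(3)], of e0]) blast
  define B where "B = K1 + K1 * K2 + K2 * K3"
  define M where "M = sqrt (exp (3 * K3 * c) * ((K + K2)\<^sup>2 + B\<^sup>2 / K3 * c))"
  have B: "0 \<le> B" using K1(1) K2(1) K3(1) by (simp add: B_def)
  show ?thesis
  proof (intro exI[of _ "M + K2"] ballI allI impI)
    fix e \<tau> x y t
    assume e: "e \<in> {0<..e0}" and \<tau>: "\<tau> \<le> c / e"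
      and x: "\<forall>t\<in>{0..\<tau>}. (x has_vector_derivative e *\<^sub>R G (x t, t, e)) (at t within {0..\<tau>})"
      and y: "\<forall>t\<in>{0..\<tau>}. (y has_vector_derivative e *\<^sub>R ?m (y t, t, e)) (at t within {0..\<tau>})"
      and init: "norm (x 0 - y 0) \<le> K * e" and t: "t \<in> {0..\<tau>}"
    have e0: "0 < e" and slab: "(a, s, e) \<in> slab e0" "(a, s, 0) \<in> slab e0" for a :: 'a and s :: real
      using e by auto
    define u where "u s = x s - e *\<^sub>R ?W (x s, s, e) - y s" for s
    define DW where "DW s = frechet_derivative ?W (at (x s, s, e))" for s
    define u' where "u' s = e *\<^sub>R G (x s, s, e)
        - e *\<^sub>R (DW s (e *\<^sub>R G (x s, s, e), 0, 0) + (G (x s, s, 0) - ?m (x s, s, e))) - e *\<^sub>R ?m (y s, s, e)" for s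
    have xu: "norm (x s - y s) \<le> norm (u s) + e * K2" for s
    proof -
      have "norm (x s - y s) = norm (u s + e *\<^sub>R ?W (x s, s, e))" by (simp add: u_def)
      also have "\<dots> \<le> norm (u s) + e * K2"
        using K2(2)[OF slab(1)] e0 by (intro norm_triangle_le add_left_mono) simp
      finally show ?thesis .
    qed
    have "(norm (u t))\<^sup>2 \<le> exp (3 * (e * K3) * t) * ((norm (u 0))\<^sup>2 + (e\<^sup>2 * B)\<^sup>2 / (e * K3) * t)"
    proof (rule linear_growth_bound[OF _ _ _ _ t])
      fix s assume s: "s \<in> {0..\<tau>}"
      show "(u has_vector_derivative u' s) (at s within {0..\<tau>})"
        unfolding u_def[abs_def] u'_def DW_def using x y s
        by (intro has_vector_derivative_diff
              bounded_linear.has_vector_derivative[OF bounded_linear_scaleR_right]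
              corrector_slice_derivative[OF C1]) auto
      have "u' s = e *\<^sub>R (G (x s, s, e) - G (x s, s, 0)) - e *\<^sub>R DW s (e *\<^sub>R G (x s, s, e), 0, 0)
          + e *\<^sub>R (?m (x s, s, e) - ?m (y s, s, e))"
        by (simp add: u'_def algebra_simps)
      also have "norm \<dots> \<le> e * (K1 * e) + e * (K2 * (e * K1)) + e * (K3 * norm (x s - y s))"
      proof -
        have tri: "norm (a - b + d) \<le> p + q + r" if "norm a \<le> p" "norm b \<le> q" "norm d \<le> r"
          for a b d :: 'a and p q r
          using that norm_triangle_ineq[of "a - b" d] norm_triangle_ineq4[of a b] by linarith
        show ?thesis
        proof (rule tri)
          have "norm ((x s, s, e) - (x s, s, 0)) = e" using e0 by (simp add: norm_Pair)
          then show "norm (e *\<^sub>R (G (x s, s, e) - G (x s, s, 0))) \<le> e * (K1 * e)"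
            using K1(3)[OF slab(2) slab(1), of "x s" s "x s" s] e0 by (simp add: norm_minus_commute)
          have "norm (DW s (e *\<^sub>R G (x s, s, e), 0, 0)) \<le> K2 * norm (e *\<^sub>R G (x s, s, e), 0::real, 0::real)"
            unfolding DW_def by (rule K2(3)[OF slab(1)])
          also have "\<dots> \<le> K2 * (e * K1)"
            using K1(2)[OF slab(1)] e0 K2(1) by (intro mult_left_mono) (auto simp: norm_Pair)
          finally show "norm (e *\<^sub>R DW s (e *\<^sub>R G (x s, s, e), 0, 0)) \<le> e * (K2 * (e * K1))"
            using e0 by simp
          have "norm ((x s, s, e) - (y s, s, e)) = norm (x s - y s)" by (simp add: norm_Pair)
          then show "norm (e *\<^sub>R (?m (x s, s, e) - ?m (y s, s, e))) \<le> e * (K3 * norm (x s - y s))"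
            using K3(2)[OF slab(1) slab(1), of "x s" s "y s" s] e0 by (simp add: norm_minus_commute)
        qed
      qed
      also have "\<dots> \<le> e * (K1 * e) + e * (K2 * (e * K1)) + e * (K3 * (norm (u s) + e * K2))"
        using xu[of s] e0 K3(1) by (intro add_left_mono mult_left_mono) auto
      also have "\<dots> = e * K3 * norm (u s) + e\<^sup>2 * B"
        by (simp add: B_def algebra_simps power2_eq_square)
      finally show "norm (u' s) \<le> e * K3 * norm (u s) + e\<^sup>2 * B" .
    qed (use e0 K3(1) B in auto)
    also have "\<dots> \<le> exp (3 * K3 * c) * (((K + K2) * e)\<^sup>2 + e\<^sup>2 * (B\<^sup>2 / K3 * c))"
    proof -
      have "e * t \<le> e * \<tau>" using t e0 by (intro mult_left_mono) auto
      moreover have "e * \<tau> \<le> c" using \<tau> e0 by (simp add: field_simps)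
      ultimately have "e * t \<le> c" by (rule order_trans)
      moreover have "0 \<le> e * t" using t e0 by simp
      ultimately have tc: "e * t \<le> c" "0 \<le> e * t" by blast+
      have "norm (u 0) = norm (x 0 - y 0 - e *\<^sub>R ?W (x 0, 0, e))" by (simp add: u_def algebra_simps)
      also have "\<dots> \<le> K * e + e * K2"
      proof -
        have "norm (e *\<^sub>R ?W (x 0, 0, e)) \<le> e * K2" using K2(2)[OF slab(1), of "x 0" 0] e0 by simp
        then show ?thesis
          using init norm_triangle_ineq4[of "x 0 - y 0" "e *\<^sub>R ?W (x 0, 0, e)"] by linarith
      qed
      finally have 1: "(norm (u 0))\<^sup>2 \<le> ((K + K2) * e)\<^sup>2"
        by (intro power_mono) (auto simp: algebra_simps)
      have "(e\<^sup>2 * B)\<^sup>2 / (e * K3) * t = e\<^sup>2 * (B\<^sup>2 / K3 * (e * t))"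
        using e0 K3(1) by (simp add: field_simps power2_eq_square)
      also have "\<dots> \<le> e\<^sup>2 * (B\<^sup>2 / K3 * c)"
        using tc K3(1) by (intro mult_left_mono) auto
      finally have 2: "(e\<^sup>2 * B)\<^sup>2 / (e * K3) * t \<le> e\<^sup>2 * (B\<^sup>2 / K3 * c)" .
      have "3 * (e * K3) * t = 3 * K3 * (e * t)" by simp
      also have "\<dots> \<le> 3 * K3 * c" using tc K3(1) by (intro mult_left_mono) auto
      finally have "exp (3 * (e * K3) * t) \<le> exp (3 * K3 * c)" by simp
      moreover have "0 \<le> (norm (u 0))\<^sup>2 + (e\<^sup>2 * B)\<^sup>2 / (e * K3) * t"
        using e0 K3(1) t by (intro add_nonneg_nonneg mult_nonneg_nonneg divide_nonneg_pos) auto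
      ultimately show ?thesis by (intro mult_mono[OF _ add_mono[OF 1 2]]; (assumption | simp))
    qed
    also have "\<dots> = (M * e)\<^sup>2"
    proof -
      have "0 \<le> exp (3 * K3 * c) * ((K + K2)\<^sup>2 + B\<^sup>2 / K3 * c)"
        using K3(1) assms(4) by (intro mult_nonneg_nonneg add_nonneg_nonneg divide_nonneg_pos) auto
      then have "M\<^sup>2 = exp (3 * K3 * c) * ((K + K2)\<^sup>2 + B\<^sup>2 / K3 * c)" by (simp add: M_def)
      then show ?thesis unfolding power_mult_distrib by (simp add: distrib_left distrib_right mult_ac)
    qed
    finally have "norm (u t) \<le> M * e"
      by (rule power2_le_imp_le) (use e0 K3(1) assms(4) in \<open>auto simp: M_def intro!: mult_nonneg_nonneg add_nonneg_nonneg\<close>)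
    then show "norm (x t - y t) \<le> (M + K2) * e"
      using xu[of t] by (simp add: algebra_simps)
  qed
qed


lemma linear_matrix_vec:
  fixes L :: "real^'n \<Rightarrow> real^'n"
  assumes "linear L" shows "matrix L *v u = L u"
  using matrix_works[of L] assms by (simp add: matrix_vector_mul(1))

lemma matrix_inv_inverse:
  fixes A :: "real^'n^'n"
  assumes "det A \<noteq> 0"
  shows "A ** matrix_inv A = mat 1" "matrix_inv A ** A = mat 1"
proof -
  have "\<exists>B. A ** B = mat 1 \<and> B ** A = mat 1"
    using assms by (simp flip: invertible_det_nz add: invertible_def)
  from someI_ex[OF this] show "A ** matrix_inv A = mat 1" "matrix_inv A ** A = mat 1"
    by (simp_all add: matrix_inv_def)
qed

lemma near_identity_injective_matrix:
  fixes L :: "real^'n \<Rightarrow> real^'n"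
  assumes "linear L" "\<And>u. norm (L u) \<le> norm u / 2"
  shows "det (matrix (\<lambda>u. u + L u)) \<noteq> 0"
proof -
  have lin: "linear (\<lambda>u. u + L u)"
    using assms(1) by (intro linear_compose_add linear_ident)
  have "u = 0" if "matrix (\<lambda>u. u + L u) *v u = 0" for u
  proof -
    have "u = - L u" using that linear_matrix_vec[OF lin] by (simp add: eq_neg_iff_add_eq_0)
    then have "norm u \<le> norm u / 2" using assms(2)[of u] by (metis norm_minus_cancel)
    then show ?thesis by simp
  qed
  then have "invertible (matrix (\<lambda>u. u + L u))"
    using matrix_left_invertible_ker[of "matrix (\<lambda>u. u + L u)"] by (simp add: invertible_left_inverse)
  then show ?thesis by (simp add: invertible_det_nz)
qed

lemma matrix_vec_nth: "matrix L $ i $ j = L (axis j 1) $ i"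
  by (simp add: matrix_def)

text \<open>Bijectivity is Banach's fixed point theorem for \<open>y \<mapsto> x - e w(y, t)\<close>, a contraction with
  constant 1/2. The derivative of the inverse solves a linear system whose coefficients involve
  \<open>Dw\<close> at the preimage, so if the inverse is \<open>C\<^sup>k\<close> and \<open>w\<close> is \<open>C\<^sup>k\<^sup>+\<^sup>1\<close>, the inverse is \<open>C\<^sup>k\<^sup>+\<^sup>1\<close>.\<close>

lemma near_identity_diffeo:
  fixes w :: "(real^'n) \<times> real \<Rightarrow> real^'n" and e K :: real
  assumes Ckw: "Ck_open r w UNIV" and r: "1 \<le> r"
    and Dw_bnd: "\<And>p v. norm (frechet_derivative w (at p) v) \<le> K * norm v"
    and small: "\<bar>e\<bar> * K \<le> 1 / 2"
  defines "\<Phi> \<equiv> \<lambda>p. (fst p + e *\<^sub>R w p, snd p)"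
  shows "bij \<Phi>" and "Ck_open r \<Phi> UNIV" and "Ck_open r (inv \<Phi>) UNIV"
proof -
  have Ckw1: "Ck_open 1 w UNIV" using Ckw r by (rule Ck_open_mono)
  have lip: "norm (w p - w q) \<le> K * norm (p - q)" for p q
    by (rule differentiable_bound[where S = UNIV and f' = "\<lambda>p. frechet_derivative w (at p)"])
      (use C1_has_derivative[OF Ckw1] Dw_bnd in \<open>auto intro!: onorm_le simp: mult.commute\<close>)
  have lip': "norm (e *\<^sub>R (w p - w q)) \<le> norm (p - q) / 2" for p q
  proof -
    have "norm (e *\<^sub>R (w p - w q)) \<le> \<bar>e\<bar> * (K * norm (p - q))"
      using lip[of p q] by (simp add: mult_left_mono)
    also have "\<dots> \<le> 1 / 2 * norm (p - q)"
      using mult_right_mono[OF small, of "norm (p - q)"] by (simp add: mult.assoc)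
    finally show ?thesis by simp
  qed
  have "inj \<Phi>"
  proof (rule injI)
    fix p q assume eq: "\<Phi> p = \<Phi> q"
    then have s: "snd p = snd q" and "fst p - fst q = - (e *\<^sub>R (w p - w q))"
      by (auto simp: \<Phi>_def algebra_simps)
    then have "norm (fst p - fst q) \<le> norm (p - q) / 2" using lip'[of p q] by simp
    moreover have "norm (p - q) = norm (fst p - fst q)" using s by (simp add: norm_prod_def)
    ultimately have "fst p = fst q" by simp
    then show "p = q" using s by (simp add: prod_eq_iff)
  qed
  moreover have "surj \<Phi>"
    unfolding surj_def
  proof
    fix q :: "(real^'n) \<times> real"
    have "\<exists>!y. fst q - e *\<^sub>R w (y, snd q) = y"
    proof (rule banach_fix_type[of "1/2"])
      show "\<forall>x y. dist (fst q - e *\<^sub>R w (x, snd q)) (fst q - e *\<^sub>R w (y, snd q)) \<le> 1/2 * dist x y"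
      proof (intro allI)
        fix x y
        have "dist (fst q - e *\<^sub>R w (x, snd q)) (fst q - e *\<^sub>R w (y, snd q)) = norm (e *\<^sub>R (w (y, snd q) - w (x, snd q)))"
          by (simp add: dist_norm algebra_simps)
        also have "\<dots> \<le> norm ((y, snd q) - (x, snd q)) / 2" by (rule lip')
        finally show "dist (fst q - e *\<^sub>R w (x, snd q)) (fst q - e *\<^sub>R w (y, snd q)) \<le> 1/2 * dist x y"
          by (simp add: norm_Pair dist_norm norm_minus_commute)
      qed
    qed auto
    then obtain y where "fst q - e *\<^sub>R w (y, snd q) = y" by blast
    then have "q = \<Phi> (y, snd q)" by (simp add: \<Phi>_def prod_eq_iff algebra_simps)
    then show "\<exists>p. q = \<Phi> p" by blast
  qed
  ultimately show bij: "bij \<Phi>" by (simp add: bij_def)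
  show "Ck_open r \<Phi> UNIV"
    unfolding \<Phi>_def
    by (intro Ck_open_Pair Ck_open_add Ck_open_scaleR[OF _ Ck_open_const] Ckw open_UNIV
        Ck_open_bounded_linear[OF _ bounded_linear_fst] Ck_open_bounded_linear[OF _ bounded_linear_snd])
  define \<Psi> where "\<Psi> = inv \<Phi>"
  have \<Phi>\<Psi>: "\<Phi> (\<Psi> q) = q" and \<Psi>\<Phi>: "\<Psi> (\<Phi> p) = p" for p q
    using bij by (auto simp: \<Psi>_def bij_def surj_f_inv_f)
  have \<Psi>lip: "norm (\<Psi> p - \<Psi> q) \<le> 4 * norm (p - q)" for p q
  proof -
    have "p = \<Phi> (\<Psi> p)" "q = \<Phi> (\<Psi> q)" using \<Phi>\<Psi> by auto
    then have "\<Psi> p - \<Psi> q = (p - q) - (e *\<^sub>R (w (\<Psi> p) - w (\<Psi> q)), 0)"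
      by (simp add: \<Phi>_def prod_eq_iff algebra_simps)
    then have "norm (\<Psi> p - \<Psi> q) \<le> norm (p - q) + norm (e *\<^sub>R (w (\<Psi> p) - w (\<Psi> q)), 0::real)"
      by (metis norm_triangle_ineq4)
    also have "\<dots> \<le> norm (p - q) + norm (\<Psi> p - \<Psi> q) / 2"
      using lip'[of "\<Psi> p" "\<Psi> q"] by (simp add: norm_Pair)
    finally show ?thesis using norm_ge_zero[of "p - q"] by linarith
  qed
  have \<Psi>cont: "continuous_on UNIV \<Psi>"
    by (rule lipschitz_on_continuous_on[of 4], rule lipschitz_onI) (use \<Psi>lip in \<open>auto simp: dist_norm\<close>)
  let ?Dw = "\<lambda>p. frechet_derivative w (at p)"
  have Dw: "(w has_derivative ?Dw p) (at p)" for p by (rule C1_has_derivative[OF Ckw1])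
  have linDw: "linear (?Dw p)" for p using Dw by (rule has_derivative_linear)
  have linDw1: "linear (\<lambda>u. e *\<^sub>R ?Dw p (u, 0))" for p
    by (intro linear_compose_scale_right linear_compose[OF _ linDw, unfolded o_def])
      (auto intro: linearI)
  have Dw_le: "norm (e *\<^sub>R ?Dw p (u, 0)) \<le> norm u / 2" for p u
  proof -
    have "norm (e *\<^sub>R ?Dw p (u, 0)) \<le> \<bar>e\<bar> * (K * norm u)"
      using Dw_bnd[of p "(u, 0)"] by (simp add: mult_left_mono norm_Pair)
    also have "\<dots> \<le> 1 / 2 * norm u"
      using mult_right_mono[OF small, of "norm u"] by (simp add: mult.assoc)
    finally show ?thesis by simp
  qed
  define A where "A q = matrix (\<lambda>u. u + e *\<^sub>R ?Dw (\<Psi> q) (u, 0))" for q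
  have Adet: "det (A q) \<noteq> 0" for q
    unfolding A_def by (rule near_identity_injective_matrix[OF linDw1 Dw_le])
  have Av: "A q *v u = u + e *\<^sub>R ?Dw (\<Psi> q) (u, 0)" for q u
    unfolding A_def by (rule linear_matrix_vec) (intro linear_compose_add linear_ident linDw1)
  \<comment> \<open>The time component of the map is the identity, so only an \<open>n \<times> n\<close> system has to be solved.\<close>
  define u where "u q v = matrix_inv (A q) *v (fst v - e *\<^sub>R ?Dw (\<Psi> q) (0, snd v))" for q and v :: "(real^'n) \<times> real"
  have Au: "A q *v u q v = fst v - e *\<^sub>R ?Dw (\<Psi> q) (0, snd v)" for q v
    using Adet[of q] by (simp add: u_def matrix_vector_mul_assoc matrix_inv_inverse)
  have \<Psi>der: "(\<Psi> has_derivative (\<lambda>v. (u q v, snd v))) (at q)" for q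
  proof (rule has_derivative_inverse_basic[where f = \<Phi> and T = UNIV])
    show "(\<Phi> has_derivative (\<lambda>v. (fst v + e *\<^sub>R ?Dw (\<Psi> q) v, snd v))) (at (\<Psi> q))"
      unfolding \<Phi>_def by (auto intro!: derivative_eq_intros Dw)
    have "linear (\<lambda>v. u q v)"
      unfolding u_def
      by (intro linear_compose[OF _ matrix_vector_mul_linear, unfolded o_def] linear_compose_sub
          linear_compose_scale_right linear_compose[OF _ linDw, unfolded o_def])
        (auto intro: linearI)
    then have "linear (\<lambda>v. (u q v, snd v))"
      by (auto simp: linear_iff)
    then show "bounded_linear (\<lambda>v. (u q v, snd v))" by (simp add: linear_conv_bounded_linear)
    show "(\<lambda>v. (u q v, snd v)) \<circ> (\<lambda>v. (fst v + e *\<^sub>R ?Dw (\<Psi> q) v, snd v)) = id"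
    proof
      fix v :: "(real^'n) \<times> real"
      have "?Dw (\<Psi> q) v = ?Dw (\<Psi> q) (fst v, 0) + ?Dw (\<Psi> q) (0, snd v)"
        by (subst linear_add[OF linDw, symmetric]) simp
      then have "A q *v fst v = (fst v + e *\<^sub>R ?Dw (\<Psi> q) v) - e *\<^sub>R ?Dw (\<Psi> q) (0, snd v)"
        by (simp add: Av algebra_simps)
      then have "u q (fst v + e *\<^sub>R ?Dw (\<Psi> q) v, snd v) = matrix_inv (A q) *v (A q *v fst v)"
        by (simp add: u_def)
      then have "u q (fst v + e *\<^sub>R ?Dw (\<Psi> q) v, snd v) = fst v"
        using Adet[of q] by (simp add: matrix_vector_mul_assoc matrix_inv_inverse)
      then show "((\<lambda>v. (u q v, snd v)) \<circ> (\<lambda>v. (fst v + e *\<^sub>R ?Dw (\<Psi> q) v, snd v))) v = id v"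
        by simp
    qed
    show "isCont \<Psi> q" using \<Psi>cont continuous_on_eq_continuous_at[OF open_UNIV] by blast
  qed (auto simp: \<Phi>\<Psi>)
  have "Ck_open k \<Psi> UNIV" if "k \<le> r" for k
    using that
  proof (induction k)
    case 0
    then show ?case using \<Psi>cont by simp
  next
    case (Suc k)
    have IH: "Ck_open k \<Psi> UNIV" using Suc by simp
    have Ckw': "Ck_open (Suc k) w UNIV" using Ckw Suc.prems by (rule Ck_open_mono)
    have CkDw: "Ck_open k (\<lambda>q. ?Dw (\<Psi> q) v) UNIV" for v
      by (rule Ck_open_compose[OF open_UNIV _ Ck_open_SucD[OF Ckw'] IH]) simp
    show ?case
    proof (rule Ck_open_SucI[OF open_UNIV \<Psi>der])
      fix v
      have "Ck_open k (\<lambda>q. u q v) UNIV"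
      proof (rule Ck_open_solve_linear[OF open_UNIV _ _ Adet Au])
        have "Ck_open k (\<lambda>q. (axis j 1 + e *\<^sub>R ?Dw (\<Psi> q) (axis j 1, 0)) $ i) UNIV" for i j
          by (intro Ck_open_vec_nth Ck_open_add Ck_open_scaleR[OF _ Ck_open_const] CkDw Ck_open_const open_UNIV)
        then show "Ck_open k (\<lambda>q. A q $ i $ j) UNIV" for i j
          unfolding A_def matrix_vec_nth .
        show "Ck_open k (\<lambda>q. fst v - e *\<^sub>R ?Dw (\<Psi> q) (0, snd v)) UNIV"
          by (intro Ck_open_diff Ck_open_scaleR[OF _ Ck_open_const] CkDw Ck_open_const open_UNIV)
      qed
      then show "Ck_open k (\<lambda>q. (u q v, snd v)) UNIV"
        by (intro Ck_open_Pair Ck_open_const open_UNIV)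
    qed
  qed
  then show "Ck_open r (inv \<Phi>) UNIV" by (simp add: \<Psi>_def)
qed


lemma Ck_open_apply_derivative:
  fixes F :: "'b::euclidean_space \<Rightarrow> 'c::real_normed_vector" and h v :: "'a::euclidean_space \<Rightarrow> 'b"
  assumes "Ck_open (Suc k) F UNIV" "Ck_open k h UNIV" "Ck_open k v UNIV"
  shows "Ck_open k (\<lambda>x. frechet_derivative F (at (h x)) (v x)) UNIV"
proof -
  have "Ck_open k (\<lambda>x. \<Sum>b\<in>Basis. (v x \<bullet> b) *\<^sub>R frechet_derivative F (at (h x)) b) UNIV"
    by (intro Ck_open_sum Ck_open_scaleR open_UNIV
        Ck_open_linear_compose[OF _ bounded_linear_inner_left assms(3)]
        Ck_open_compose[OF open_UNIV _ Ck_open_SucD[OF assms(1)] assms(2)]) simp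
  moreover have "linear (frechet_derivative F (at y))" for y
    using Ck_open_Suc_has_derivative[OF assms(1)] by (intro has_derivative_linear) auto
  ultimately show ?thesis by (simp flip: linear_expand_Basis)
qed

lemma integral_derivative_along_segment:
  fixes G :: "'a::euclidean_space \<Rightarrow> 'b::euclidean_space"
  assumes "Ck_open 1 G UNIV"
  shows "e *\<^sub>R integral {0..1} (\<lambda>s. frechet_derivative G (at (p + (s * e) *\<^sub>R v)) v) = G (p + e *\<^sub>R v) - G p"
proof -
  let ?D = "\<lambda>s. frechet_derivative G (at (p + (s * e) *\<^sub>R v))"
  have "((\<lambda>s. e *\<^sub>R ?D s v) has_integral G (p + (1 * e) *\<^sub>R v) - G (p + (0 * e) *\<^sub>R v)) {0..1}"
  proof (rule fundamental_theorem_of_calculus)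
    fix s :: real
    have "((\<lambda>s. p + (s * e) *\<^sub>R v) has_derivative (\<lambda>h. h *\<^sub>R (e *\<^sub>R v))) (at s within {0..1})"
      by (auto intro!: derivative_eq_intros)
    from has_derivative_compose[OF this C1_has_derivative[OF assms]]
    show "((\<lambda>s. G (p + (s * e) *\<^sub>R v)) has_vector_derivative e *\<^sub>R ?D s v) (at s within {0..1})"
      unfolding has_vector_derivative_def
      by (simp add: linear_scale[OF has_derivative_linear[OF C1_has_derivative[OF assms]]])
  qed simp
  from integral_unique[OF this] show ?thesis by simp
qed

text \<open>Differentiating \<open>x = y + e w(y, t)\<close> and inserting \<open>\<partial>\<^sub>t w = G(\<cdot>, \<cdot>, 0) - m\<close> shows that the equation
  for \<open>x\<close> becomes \<open>(I + e Dw) y' = e m + e (G(x, t, e) - G(y, t, 0))\<close>. Solving for \<open>y'\<close>,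
  the remainder is \<open>g1 = (I + e Dw)\<^sup>-\<^sup>1 b\<close> with
  \<open>b = (G(x, t, e) - G(y, t, 0)) / e - Dw m\<close>. The quotient is singular in form at \<open>e = 0\<close>. Writing it
  as the integral of the derivative of \<open>G\<close> along a segment exhibits its continuity there.\<close>

lemma near_identity_transform:
  fixes G :: "(real^'n) \<times> real \<times> real \<Rightarrow> real^'n"
  assumes "0 < T" "Ck_open r G UNIV" "2 \<le> r" "periodic_field T G" "0 < e0"
  obtains e1 g1 where "0 < e1" "e1 \<le> e0"
    "\<And>y t e. g1 (y, t + T, e) = g1 (y, t, e)"
    "continuous_on (UNIV \<times> UNIV \<times> {0..e1}) g1"
    "\<And>e. e \<in> {0..e1} \<Longrightarrow> bij (\<lambda>(y, t). (y + e *\<^sub>R corrector T G (y, t, 0), t))"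
    "\<And>e. e \<in> {0..e1} \<Longrightarrow> Ck_open r (\<lambda>(y, t). (y + e *\<^sub>R corrector T G (y, t, 0), t)) UNIV"
    "\<And>e. e \<in> {0..e1} \<Longrightarrow> Ck_open r (inv (\<lambda>(y, t). (y + e *\<^sub>R corrector T G (y, t, 0), t))) UNIV"
    "\<And>e J x y t. e \<in> {0..e1} \<Longrightarrow> \<forall>t\<in>J. x t = y t + e *\<^sub>R corrector T G (y t, t, 0) \<Longrightarrow> t \<in> J \<Longrightarrow>
      (x has_vector_derivative e *\<^sub>R G (x t, t, e)) (at t within J) \<longleftrightarrow>
      (y has_vector_derivative e *\<^sub>R mean_field T G (y t, t, 0) + e\<^sup>2 *\<^sub>R g1 (y t, t, e)) (at t within J)"
proof -
  let ?W = "corrector T G" and ?m = "mean_field T G"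
  let ?DW = "\<lambda>z. frechet_derivative ?W (at z)" and ?DG = "\<lambda>z. frechet_derivative G (at z)"
  have C2: "Ck_open (Suc 1) G UNIV" "Ck_open 2 G UNIV"
    using Ck_open_mono[OF assms(2), of 2] assms(3) by (simp_all add: numeral_2_eq_2)
  have C1: "Ck_open 1 G UNIV" using C2(1) by (rule Ck_open_Suc_lower)
  have cG: "continuous_on UNIV G" using C1 by (rule Ck_open_continuous_on)
  have perW: "periodic_field T ?W" by (rule periodic_field_corrector[OF assms(4) cG])
  have perm: "periodic_field T ?m" by (rule periodic_field_mean_field[OF assms(4)])
  have CW: "Ck_open r ?W UNIV" "Ck_open 2 ?W UNIV" "Ck_open 1 ?W UNIV"
    by (rule Ck_open_corrector[OF assms(2)], rule Ck_open_corrector[OF C2(2)], rule Ck_open_corrector[OF C1])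
  have DW: "(?W has_derivative ?DW z) (at z)" for z by (rule C1_has_derivative[OF CW(3)])
  have linDW: "linear (?DW z)" for z using DW by (rule has_derivative_linear)
  obtain K where K: "0 < K" "\<And>z v. z \<in> slab e0 \<Longrightarrow> norm (?DW z v) \<le> K * norm v"
    by (rule periodic_field_bounds[OF assms(1) CW(2) perW, of e0]) blast
  have z0: "(y, t, 0) \<in> slab e0" for y :: "real^'n" and t :: real using assms(5) by simp
  \<comment> \<open>Twice as small as needed: continuity of the remainder is shown on a neighbourhood of
    \<open>[0, e1]\<close> on which \<open>I + e Dw\<close> is still regular.\<close>
  define e1 where "e1 = min e0 (1 / (4 * K))"
  have e1: "0 < e1" "e1 \<le> e0" "e1 * K \<le> 1 / 4"
    using assms(5) K(1) by (auto simp: e1_def min_def field_simps)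

  define w where "w p = ?W (fst p, snd p, 0)" for p :: "(real^'n) \<times> real"
  define \<iota> where "\<iota> p = (fst p, snd p, 0::real)" for p :: "(real^'n) \<times> real"
  have bl\<iota>: "bounded_linear \<iota>"
    unfolding \<iota>_def by (intro bounded_linear_Pair bounded_linear_fst bounded_linear_snd bounded_linear_zero)
  have w\<iota>: "w = (\<lambda>p. ?W (\<iota> p))" by (simp add: w_def \<iota>_def fun_eq_iff)
  have Ckw: "Ck_open r w UNIV"
    unfolding w\<iota> by (rule Ck_open_compose[OF open_UNIV _ CW(1) Ck_open_bounded_linear[OF open_UNIV bl\<iota>]]) simp
  have wder: "(w has_derivative (\<lambda>v. ?DW (\<iota> p) (\<iota> v))) (at p)" for p
    unfolding w\<iota> by (rule has_derivative_compose[OF bounded_linear_imp_has_derivative[OF bl\<iota>] DW])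
  have Dw_bnd: "norm (frechet_derivative w (at p) v) \<le> K * norm v" for p v
    using K(2)[OF z0, of "fst p" "snd p" "\<iota> v"] frechet_derivative_at[OF wder, of p, symmetric]
    by (simp add: \<iota>_def norm_prod_def)

  define \<Phi> where "\<Phi> e p = (fst p + e *\<^sub>R w p, snd p)" for e and p :: "(real^'n) \<times> real"
  have \<Phi>_eq: "(\<lambda>(y, t). (y + e *\<^sub>R ?W (y, t, 0), t)) = \<Phi> e" for e
    by (auto simp: \<Phi>_def w_def fun_eq_iff)
  have small: "\<bar>e\<bar> * K \<le> 1 / 2" if "e \<in> {0..e1}" for e
  proof -
    have "e * K \<le> e1 * K" using that K(1) by (intro mult_right_mono) auto
    moreover have "\<bar>e\<bar> = e" using that by simp
    ultimately show ?thesis using e1(3) by linarith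
  qed
  have diffeo: "bij (\<Phi> e)" "Ck_open r (\<Phi> e) UNIV" "Ck_open r (inv (\<Phi> e)) UNIV" if "e \<in> {0..e1}" for e
    using near_identity_diffeo[OF Ckw _ Dw_bnd small[OF that]] assms(3) by (auto simp: \<Phi>_def[abs_def])

  define A where "A z = matrix (\<lambda>u. u + snd (snd z) *\<^sub>R ?DW (fst z, fst (snd z), 0) (u, 0, 0))"
    for z :: "(real^'n) \<times> real \<times> real"
  define wz where "wz z = ?W (fst z, fst (snd z), 0)" for z :: "(real^'n) \<times> real \<times> real"
  define b where "b z = integral {0..1} (\<lambda>s. ?DG ((fst z, fst (snd z), 0) + (s * snd (snd z)) *\<^sub>R (wz z, 0, 1)) (wz z, 0, 1))
      - ?DW (fst z, fst (snd z), 0) (?m z, 0, 0)" for z :: "(real^'n) \<times> real \<times> real"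
  define g1 where "g1 z = matrix_inv (A z) *v b z" for z
  have linA: "linear (\<lambda>u. e *\<^sub>R ?DW z (u, 0, 0))" for e z
    by (intro linear_compose_scale_right linear_compose[OF _ linDW, unfolded o_def])
      (auto intro: linearI)
  have Av: "A (y, t, e) *v u = u + e *\<^sub>R ?DW (y, t, 0) (u, 0, 0)" for y t e u
    unfolding A_def fst_conv snd_conv
    by (rule linear_matrix_vec) (intro linear_compose_add linear_ident linA)
  have Adet: "det (A (y, t, e)) \<noteq> 0" if "\<bar>e\<bar> * K \<le> 1 / 2" for y t e
    unfolding A_def fst_conv snd_conv
  proof (rule near_identity_injective_matrix[OF linA])
    fix u :: "real^'n"
    have "norm (e *\<^sub>R ?DW (y, t, 0) (u, 0, 0)) \<le> \<bar>e\<bar> * (K * norm u)"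
      using K(2)[OF z0, of y t "(u, 0, 0)"] by (simp add: mult_left_mono norm_Pair)
    also have "\<dots> \<le> 1 / 2 * norm u"
      using mult_right_mono[OF that, of "norm u"] by (simp add: mult.assoc)
    finally show "norm (e *\<^sub>R ?DW (y, t, 0) (u, 0, 0)) \<le> norm u / 2" by simp
  qed
  have Ag1: "A (y, t, e) *v g1 (y, t, e) = b (y, t, e)" if "\<bar>e\<bar> * K \<le> 1 / 2" for y t e
    using Adet[OF that] by (simp add: g1_def matrix_vector_mul_assoc matrix_inv_inverse)

  have cont: "continuous_on (UNIV \<times> UNIV \<times> {0..e1}) g1"
  proof -
    define V where "V = (UNIV :: (real^'n) set) \<times> (UNIV :: real set) \<times> {- (1 / (2 * K)) <..< 1 / (2 * K)}"
    have V: "open V" unfolding V_def by (intro open_Times) auto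
    have VK: "\<bar>e\<bar> * K \<le> 1 / 2" if "(y, t, e) \<in> V" for y t e
    proof -
      have "\<bar>e\<bar> < 1 / (2 * K)" using that by (auto simp: V_def)
      then show ?thesis using K(1) by (simp add: field_simps)
    qed
    have lin: "Ck_open 0 (\<lambda>z::(real^'n) \<times> real \<times> real. (fst z, fst (snd z), 0::real)) UNIV"
      "Ck_open 0 (\<lambda>z::(real^'n) \<times> real \<times> real. snd (snd z)) UNIV"
      by (auto intro!: continuous_intros)
    have wz: "Ck_open 0 wz UNIV"
      unfolding wz_def[abs_def]
      by (rule Ck_open_compose[OF open_UNIV _ _ lin(1)]) (use Ck_open_mono[OF CW(1), of 0] in auto)
    have DWC: "Ck_open 0 (\<lambda>z. ?DW (fst z, fst (snd z), 0) (v z)) UNIV" if "Ck_open 0 v UNIV"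
      for v :: "(real^'n) \<times> real \<times> real \<Rightarrow> (real^'n) \<times> real \<times> real"
      by (rule Ck_open_apply_derivative[OF _ lin(1) that]) (use CW(3) in simp)
    have "Ck_open 0 g1 V"
    proof (rule Ck_open_solve_linear[OF V, of _ A b])
      fix i j
      have "Ck_open 0 (\<lambda>z. (axis j 1 + snd (snd z) *\<^sub>R ?DW (fst z, fst (snd z), 0) (axis j 1, 0, 0)) $ i) UNIV"
        by (intro Ck_open_vec_nth Ck_open_add Ck_open_scaleR lin DWC Ck_open_const open_UNIV)
      then show "Ck_open 0 (\<lambda>z. A z $ i $ j) V"
        unfolding A_def matrix_vec_nth by (rule Ck_open_subset[OF subset_UNIV])
    next
      let ?E = "UNIV :: (((real^'n) \<times> real \<times> real) \<times> real) set"
      have wq: "Ck_open 0 (\<lambda>q. wz (fst q)) ?E"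
        by (rule Ck_open_compose[OF open_UNIV _ wz]) (auto intro!: continuous_intros)
      have "Ck_open 0 (\<lambda>q. ?DG ((fst (fst q), fst (snd (fst q)), 0) + (snd q * snd (snd (fst q))) *\<^sub>R (wz (fst q), 0, 1))
          (wz (fst q), 0, 1)) ?E"
      proof (rule Ck_open_apply_derivative)
        show "Ck_open (Suc 0) G UNIV" using C1 by simp
        show c: "Ck_open 0 (\<lambda>q. (wz (fst q), 0::real, 1::real)) ?E"
          by (intro Ck_open_Pair wq Ck_open_const open_UNIV)
        have "Ck_open 0 (\<lambda>q::((real^'n) \<times> real \<times> real) \<times> real. (fst (fst q), fst (snd (fst q)), 0::real)) ?E"
          "Ck_open 0 (\<lambda>q::((real^'n) \<times> real \<times> real) \<times> real. snd q * snd (snd (fst q))) ?E"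
          by (auto intro!: continuous_intros)
        then show "Ck_open 0 (\<lambda>q. (fst (fst q), fst (snd (fst q)), 0::real) +
            (snd q * snd (snd (fst q))) *\<^sub>R (wz (fst q), 0::real, 1::real)) ?E"
          by (intro Ck_open_add Ck_open_scaleR c open_UNIV)
      qed
      from Ck_open_integral[OF this]
      have "Ck_open 0 (\<lambda>z. integral {0..1} (\<lambda>s. ?DG ((fst z, fst (snd z), 0) + (s * snd (snd z)) *\<^sub>R (wz z, 0, 1)) (wz z, 0, 1))) UNIV"
        by simp
      moreover have "Ck_open 0 ?m UNIV" using Ck_open_mean_field[OF assms(2)] by (rule Ck_open_mono) simp
      ultimately have "Ck_open 0 b UNIV"
        unfolding b_def[abs_def]
        by (intro Ck_open_diff DWC Ck_open_Pair Ck_open_const open_UNIV)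
      then show "Ck_open 0 b V" by (rule Ck_open_subset[OF subset_UNIV])
    next
      fix z assume "z \<in> V"
      then show "det (A z) \<noteq> 0" "A z *v g1 z = b z"
        by (cases z; metis VK Adet Ag1)+
    qed
    moreover have "UNIV \<times> UNIV \<times> {0..e1} \<subseteq> V"
    proof -
      have "e1 \<le> 1 / (4 * K)" "1 / (4 * K) < 1 / (2 * K)" using K(1) by (auto simp: e1_def field_simps)
      then show ?thesis using K(1) unfolding V_def by (auto intro: less_le_trans[OF _ order.refl] simp: less_le_trans)
    qed
    ultimately show ?thesis by (auto intro: continuous_on_subset)
  qed

  have per: "g1 (y, t + T, e) = g1 (y, t, e)" for y t e
  proof -
    have DWp: "?DW (y, t + T, 0) v = ?DW (y, t, 0) v" for v
      using periodic_field_derivative[OF perW C1_differentiable[OF CW(3)], of v] by (simp add: periodic_field_def)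
    have DGp: "?DG (x, t + T, s) v = ?DG (x, t, s) v" for x s v
      using periodic_field_derivative[OF assms(4) C1_differentiable[OF C1], of v] by (simp add: periodic_field_def)
    have "wz (y, t + T, e) = wz (y, t, e)" "?m (y, t + T, e) = ?m (y, t, e)"
      using perW perm by (simp_all add: wz_def periodic_field_def)
    then show ?thesis by (simp add: g1_def A_def b_def DWp DGp)
  qed

  have equiv: "(x has_vector_derivative e *\<^sub>R G (x t, t, e)) (at t within J) \<longleftrightarrow>
      (y has_vector_derivative e *\<^sub>R ?m (y t, t, 0) + e\<^sup>2 *\<^sub>R g1 (y t, t, e)) (at t within J)"
    if e: "e \<in> {0..e1}" and xy: "\<forall>t\<in>J. x t = y t + e *\<^sub>R ?W (y t, t, 0)" and t: "t \<in> J" for e J x y t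
  proof -
    define Y where "Y = e *\<^sub>R ?m (y t, t, 0) + e\<^sup>2 *\<^sub>R g1 (y t, t, e)"
    let ?D = "?DW (y t, t, 0)"
    have xt: "x t = y t + e *\<^sub>R ?W (y t, t, 0)" using xy t by blast
    have m0: "?m (y t, t, e) = ?m (y t, t, 0)" by (simp add: mean_field_def)
    have "e *\<^sub>R b (y t, t, e) = e *\<^sub>R integral {0..1} (\<lambda>s. ?DG ((y t, t, 0) + (s * e) *\<^sub>R (wz (y t, t, e), 0, 1)) (wz (y t, t, e), 0, 1))
        - e *\<^sub>R ?D (?m (y t, t, 0), 0, 0)"
      by (simp add: b_def scaleR_diff_right m0)
    also have "\<dots> = G (x t, t, e) - G (y t, t, 0) - e *\<^sub>R ?D (?m (y t, t, 0), 0, 0)"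
      unfolding integral_derivative_along_segment[OF C1] by (simp add: xt wz_def)
    finally have eb: "e *\<^sub>R b (y t, t, e) = G (x t, t, e) - G (y t, t, 0) - e *\<^sub>R ?D (?m (y t, t, 0), 0, 0)" .
    have "Y + e *\<^sub>R ?D (Y, 0, 0) = A (y t, t, e) *v Y" by (simp add: Av)
    also have "\<dots> = e *\<^sub>R (A (y t, t, e) *v ?m (y t, t, 0)) + e *\<^sub>R (e *\<^sub>R b (y t, t, e))"
      using Ag1[OF small[OF e]]
      by (simp add: Y_def matrix_vector_right_distrib vector_scaleR_matrix_ac matrix_vector_mult_scaleR power2_eq_square)
    also have "\<dots> = e *\<^sub>R ?m (y t, t, 0) + e *\<^sub>R (G (x t, t, e) - G (y t, t, 0))"
      by (simp add: eb Av algebra_simps)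
    finally have key: "Y + e *\<^sub>R (?D (Y, 0, 0) + (G (y t, t, 0) - ?m (y t, t, 0))) = e *\<^sub>R G (x t, t, e)"
      by (simp add: algebra_simps)
    show ?thesis
      unfolding Y_def[symmetric]
    proof
      assume "(y has_vector_derivative Y) (at t within J)"
      then have "((\<lambda>t. y t + e *\<^sub>R ?W (y t, t, 0)) has_vector_derivative
          Y + e *\<^sub>R (?D (Y, 0, 0) + (G (y t, t, 0) - ?m (y t, t, 0)))) (at t within J)"
        by (intro has_vector_derivative_add corrector_slice_derivative[OF C1]
              bounded_linear.has_vector_derivative[OF bounded_linear_scaleR_right])
      then show "(x has_vector_derivative e *\<^sub>R G (x t, t, e)) (at t within J)"
        unfolding key by (rule has_vector_derivative_transform[rotated 2]) (use xy t in auto)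
    next
      assume x: "(x has_vector_derivative e *\<^sub>R G (x t, t, e)) (at t within J)"
      let ?\<Psi> = "inv (\<Phi> e)"
      have inv: "?\<Psi> (\<Phi> e p) = p" for p using diffeo(1)[OF e] by (simp add: bij_def)
      have \<Phi>p: "\<Phi> e (y s, s) = (x s, s)" if "s \<in> J" for s
        using xy that by (simp add: \<Phi>_def w_def)
      have C1\<Psi>: "Ck_open 1 ?\<Psi> UNIV"
        using diffeo(3)[OF e] by (rule Ck_open_mono) (use assms(3) in simp)
      define D\<Psi> where "D\<Psi> = frechet_derivative ?\<Psi> (at (x t, t))"
      have D\<Psi>: "(?\<Psi> has_derivative D\<Psi>) (at (x t, t))"
        unfolding D\<Psi>_def by (rule C1_has_derivative[OF C1\<Psi>])
      have \<Phi>der: "(\<Phi> e has_derivative (\<lambda>v. (fst v + e *\<^sub>R ?DW (\<iota> (y t, t)) (\<iota> v), snd v))) (at (y t, t))"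
        unfolding \<Phi>_def[abs_def] by (auto intro!: derivative_eq_intros wder)
      have "(?\<Psi> has_derivative D\<Psi>) (at (\<Phi> e (y t, t)))"
        unfolding \<Phi>p[OF t] by (rule D\<Psi>)
      from has_derivative_compose[OF \<Phi>der this]
      have "((\<lambda>p. p) has_derivative (\<lambda>v. D\<Psi> (fst v + e *\<^sub>R ?DW (\<iota> (y t, t)) (\<iota> v), snd v))) (at (y t, t))"
        unfolding inv .
      from fun_cong[OF has_derivative_unique[OF this has_derivative_ident], of "(Y, 1)"]
      have "D\<Psi> (Y + e *\<^sub>R ?DW (\<iota> (y t, t)) (\<iota> (Y, 1)), 1) = (Y, 1)"
        unfolding fst_conv snd_conv .
      moreover have "?DW (\<iota> (y t, t)) (\<iota> (Y, 1)) = ?D (Y, 0, 0) + (G (y t, t, 0) - ?m (y t, t, 0))"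
        using linear_add[OF linDW, of "(y t, t, 0)" "(Y, 0, 0)" "(0, 1, 0)"] corrector_derivative_time[OF C1, of T "y t" t 0]
        by (simp add: \<iota>_def)
      ultimately have D1: "D\<Psi> (e *\<^sub>R G (x t, t, e), 1) = (Y, 1)" using key by simp
      have "((\<lambda>s. (x s, s)) has_derivative (\<lambda>h. (h *\<^sub>R (e *\<^sub>R G (x t, t, e)), h))) (at t within J)"
        using x unfolding has_vector_derivative_def by (auto intro!: derivative_eq_intros)
      from has_derivative_compose[OF this D\<Psi>]
      have "((\<lambda>s. fst (?\<Psi> (x s, s))) has_derivative (\<lambda>h. fst (D\<Psi> (h *\<^sub>R (e *\<^sub>R G (x t, t, e)), h)))) (at t within J)"
        by (rule has_derivative_fst)
      moreover have "fst (D\<Psi> (h *\<^sub>R (e *\<^sub>R G (x t, t, e)), h)) = h *\<^sub>R Y" for h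
        using linear_scale[OF has_derivative_linear[OF D\<Psi>], of h "(e *\<^sub>R G (x t, t, e), 1)"] D1 by simp
      ultimately have "((\<lambda>s. fst (?\<Psi> (x s, s))) has_vector_derivative Y) (at t within J)"
        by (simp add: has_vector_derivative_def)
      then show "(y has_vector_derivative Y) (at t within J)"
      proof (rule has_vector_derivative_transform[rotated 2])
        show "y s = fst (?\<Psi> (x s, s))" if "s \<in> J" for s
          using inv[of "(y s, s)"] \<Phi>p[OF that] by simp
      qed (use t in auto)
    qed
  qed
  show ?thesis
    by (rule that[OF e1(1,2) per cont, unfolded \<Phi>_eq, OF diffeo equiv])
qed

section \<open>The time-T flow of a slow system\<close>

lemma increment_bound:
  fixes u :: "real \<Rightarrow> 'a::real_normed_vector"
  assumes der: "\<And>t. t \<in> {0..T} \<Longrightarrow> (u has_vector_derivative u' t) (at t within {0..T})"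
    and bnd: "\<And>t. t \<in> {0..T} \<Longrightarrow> norm (u' t) \<le> B" and "0 \<le> B" and t: "t \<in> {0..T}"
  shows "norm (u t - u 0) \<le> B * T"
proof -
  have "norm (u t - u 0) \<le> B * norm (t - 0)"
  proof (rule differentiable_bound[of "{0..T}" u "\<lambda>r h. h *\<^sub>R u' r"])
    show "(u has_derivative (\<lambda>h. h *\<^sub>R u' r)) (at r within {0..T})" if "r \<in> {0..T}" for r
      using der[OF that] by (simp add: has_vector_derivative_def)
    show "onorm (\<lambda>h. h *\<^sub>R u' r) \<le> B" if "r \<in> {0..T}" for r
      using bnd[OF that] by (intro onorm_le) (simp add: mult.commute[of B] mult_left_mono)
  qed (use t in auto)
  also have "\<dots> \<le> B * T" using t assms(3) by (intro mult_left_mono) auto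
  finally show ?thesis .
qed

lemma has_vector_derivative_Un:
  assumes "(f has_vector_derivative d) (at t within A)" "(f has_vector_derivative d) (at t within B)"
  shows "(f has_vector_derivative d) (at t within A \<union> B)"
  using assms unfolding has_vector_derivative_def has_derivative_within
  by (auto simp: at_within_union intro: filterlim_sup)

text \<open>On an interval with \<open>a T \<le> 1/2\<close> a differential inequality can be read off at the maximum of \<open>|u|\<close>,
  without exponentials. It provides uniqueness, Lipschitz dependence and the differentiability
  of the flow.\<close>

lemma short_time_bound:
  fixes u :: "real \<Rightarrow> 'a::real_normed_vector"
  assumes der: "\<And>t. t \<in> {0..T} \<Longrightarrow> (u has_vector_derivative u' t) (at t within {0..T})"
    and bnd: "\<And>t. t \<in> {0..T} \<Longrightarrow> norm (u' t) \<le> a * norm (u t) + b"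
    and ab: "0 \<le> a" "0 \<le> b" "a * T \<le> 1 / 2" and t: "t \<in> {0..T}"
  shows "norm (u t) \<le> 2 * (norm (u 0) + b * T)"
proof -
  have "continuous_on {0..T} u"
    using continuous_on_vector_derivative der by blast
  then have "continuous_on {0..T} (\<lambda>t. norm (u t))" by (intro continuous_intros)
  moreover have "{0..T} \<noteq> {}" using t by auto
  ultimately obtain s where s: "s \<in> {0..T}" "\<And>r. r \<in> {0..T} \<Longrightarrow> norm (u r) \<le> norm (u s)"
    using continuous_attains_sup[OF compact_Icc, of 0 T "\<lambda>t. norm (u t)"] by blast
  have "norm (u s - u 0) \<le> (a * norm (u s) + b) * T"
  proof (rule increment_bound[OF der _ _ s(1)])
    fix r assume r: "r \<in> {0..T}"
    have "a * norm (u r) \<le> a * norm (u s)" using s(2)[OF r] ab(1) by (rule mult_left_mono)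
    then show "norm (u' r) \<le> a * norm (u s) + b" using bnd[OF r] by linarith
  qed (use ab in auto)
  also have "\<dots> = (a * T) * norm (u s) + b * T" by (simp add: algebra_simps)
  also have "\<dots> \<le> 1 / 2 * norm (u s) + b * T" using ab(3) by (intro add_right_mono mult_right_mono) auto
  finally have "norm (u s - u 0) \<le> norm (u s) / 2 + b * T" by simp
  then have "norm (u s) \<le> 2 * norm (u 0) + 2 * (b * T)"
    using norm_triangle_sub[of "u s" "u 0"] by linarith
  then have "norm (u s) \<le> 2 * (norm (u 0) + b * T)" by (simp only: distrib_left)
  then show ?thesis using s(2)[OF t] by linarith
qed

text \<open>Picard iteration in the space of bounded continuous functions on the line. A function on
  \<open>[0, T]\<close> is continued by its end values, through the clamp \<open>cl\<close>, to live in that space.\<close>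

lemma short_time_solution_exists:
  fixes f :: "real \<Rightarrow> 'a::euclidean_space \<Rightarrow> 'a"
  assumes "0 < T" "0 \<le> L" "L * T \<le> 1 / 2"
    and cont: "continuous_on ({0..T} \<times> UNIV) (\<lambda>(t, x). f t x)"
    and lip: "\<And>t x y. t \<in> {0..T} \<Longrightarrow> norm (f t x - f t y) \<le> L * norm (x - y)"
  shows "\<exists>x. x 0 = p \<and> (\<forall>t\<in>{0..T}. (x has_vector_derivative f t (x t)) (at t within {0..T}))"
proof -
  define cl where "cl t = max 0 (min T t)" for t
  have cl: "cl t \<in> {0..T}" for t using assms(1) by (auto simp: cl_def)
  have cl_id: "cl t = t" if "t \<in> {0..T}" for t using that by (auto simp: cl_def)
  have cl_cont: "continuous_on UNIV cl" unfolding cl_def[abs_def] by (intro continuous_intros)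
  have contf: "continuous_on {0..T} (\<lambda>s. f s (u s))" if "continuous_on {0..T} u" for u
  proof -
    have "continuous_on {0..T} (\<lambda>s. (\<lambda>(t, x). f t x) (s, u s))"
      by (rule continuous_on_compose2[OF cont]) (auto intro!: continuous_intros that)
    then show ?thesis by simp
  qed
  have intf: "(\<lambda>s. f s (u s)) integrable_on {0..t}" if "continuous_on {0..T} u" "t \<in> {0..T}" for u t
    using that by (intro integrable_continuous_real continuous_on_subset[OF contf]) auto
  define I where "I u t = p + integral {0..cl t} (\<lambda>s. f s (u s))" for u :: "real \<Rightarrow> 'a" and t
  have I_bcont: "I u \<in> bcontfun" if u: "continuous_on {0..T} u" for u
  proof -
    have c: "continuous_on {0..T} (\<lambda>t. integral {0..t} (\<lambda>s. f s (u s)))"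
      by (rule indefinite_integral_continuous_1[OF integrable_continuous_real[OF contf[OF u]]])
    then have "bounded ((\<lambda>t. integral {0..t} (\<lambda>s. f s (u s))) ` {0..T})"
      by (intro compact_imp_bounded compact_continuous_image) auto
    then obtain B where B: "\<And>t. t \<in> {0..T} \<Longrightarrow> norm (integral {0..t} (\<lambda>s. f s (u s))) \<le> B"
      unfolding bounded_iff by blast
    show ?thesis
    proof (rule bcontfun_normI)
      show "continuous_on UNIV (I u)"
        unfolding I_def[abs_def] using cl
        by (intro continuous_on_add continuous_on_const continuous_on_compose2[OF c cl_cont]) auto
      show "norm (I u t) \<le> norm p + B" for t
        unfolding I_def using B[OF cl] by (intro norm_triangle_le add_left_mono)
    qed
  qed
  have uc: "continuous_on {0..T} (apply_bcontfun U)" for U :: "real \<Rightarrow>\<^sub>C 'a" by simp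
  have "\<exists>!U. Bcontfun (I (apply_bcontfun U)) = U"
  proof (rule banach_fix_type[of "1/2"])
    show "\<forall>U V. dist (Bcontfun (I (apply_bcontfun U))) (Bcontfun (I (apply_bcontfun V))) \<le> 1/2 * dist U V"
    proof (intro allI dist_bound)
      fix U V :: "real \<Rightarrow>\<^sub>C 'a" and t
      let ?u = "apply_bcontfun U" and ?v = "apply_bcontfun V"
      have "dist (I ?u t) (I ?v t) = norm (integral {0..cl t} (\<lambda>s. f s (?u s) - f s (?v s)))"
        using Henstock_Kurzweil_Integration.integral_diff[OF intf[OF uc[of U] cl[of t]] intf[OF uc[of V] cl[of t]]]
        by (simp add: I_def dist_norm)
      also have "\<dots> \<le> (L * dist U V) * (cl t - 0)"
      proof (rule integral_bound)
        show "continuous_on {0..cl t} (\<lambda>s. f s (?u s) - f s (?v s))"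
          using cl[of t] by (intro continuous_on_diff continuous_on_subset[OF contf[OF uc]]) auto
        show "norm (f s (?u s) - f s (?v s)) \<le> L * dist U V" if "s \<in> {0..cl t}" for s
        proof -
          have "norm (f s (?u s) - f s (?v s)) \<le> L * norm (?u s - ?v s)"
            using that cl[of t] by (intro lip) auto
          also have "\<dots> \<le> L * dist U V"
            using dist_bounded[of U s V] assms(2) by (intro mult_left_mono) (auto simp: dist_norm)
          finally show ?thesis .
        qed
      qed (use cl[of t] in auto)
      also have "\<dots> \<le> L * dist U V * T"
        using cl[of t] assms(2) by (intro mult_left_mono) auto
      also have "\<dots> = (L * T) * dist U V" by simp
      also have "\<dots> \<le> 1/2 * dist U V" using assms(3) by (intro mult_right_mono) auto
      finally show "dist (apply_bcontfun (Bcontfun (I ?u)) t) (apply_bcontfun (Bcontfun (I ?v)) t) \<le> 1/2 * dist U V"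
        by (simp add: Bcontfun_inverse I_bcont)
    qed
  qed auto
  then obtain U where U: "Bcontfun (I (apply_bcontfun U)) = U" by blast
  define x where "x = apply_bcontfun U"
  have x: "x t = I x t" for t
    using Bcontfun_inverse[OF I_bcont[OF uc[of U]]] U by (metis x_def)
  have cx: "continuous_on {0..T} x" by (simp add: x_def)
  have "(x has_vector_derivative f t (x t)) (at t within {0..T})" if t: "t \<in> {0..T}" for t
  proof -
    have "((\<lambda>t. p + integral {0..t} (\<lambda>s. f s (x s))) has_vector_derivative f t (x t)) (at t within {0..T})"
      using integral_has_vector_derivative[OF contf[OF cx] t] by (auto intro!: derivative_eq_intros)
    then show ?thesis
    proof (rule has_vector_derivative_transform[rotated 2])
      show "x s = p + integral {0..s} (\<lambda>s. f s (x s))" if "s \<in> {0..T}" for s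
        using x[of s] cl_id[OF that] by (simp add: I_def)
    qed (use t in auto)
  qed
  moreover have "x 0 = p" using x[of 0] cl_id[of 0] assms(1) by (simp add: I_def)
  ultimately show ?thesis by blast
qed

text \<open>The standing bounds for \<open>x' = e F(x, t, e)\<close>. Two instances are needed: the original field and its
  average.\<close>

locale slow_system =
  fixes F :: "'a::euclidean_space \<times> real \<times> real \<Rightarrow> 'a" and T e0 K :: real
  assumes T_pos: "0 < T" and e0_pos: "0 < e0" and K_pos: "0 < K"
    and smooth: "Ck_open 1 F UNIV"
    and F_bound: "\<And>z. z \<in> slab e0 \<Longrightarrow> norm (F z) \<le> K"
    and DF_bound: "\<And>z v. z \<in> slab e0 \<Longrightarrow> norm (frechet_derivative F (at z) v) \<le> K * norm v"
    and F_Lipschitz: "\<And>z z'. z \<in> slab e0 \<Longrightarrow> z' \<in> slab e0 \<Longrightarrow> norm (F z' - F z) \<le> K * norm (z' - z)"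
    and DF_Lipschitz: "\<And>z z' v. z \<in> slab e0 \<Longrightarrow> z' \<in> slab e0 \<Longrightarrow>
       norm (frechet_derivative F (at z') v - frechet_derivative F (at z) v) \<le> K * norm (z' - z) * norm v"
    and F_Taylor: "\<And>z z'. z \<in> slab e0 \<Longrightarrow> z' \<in> slab e0 \<Longrightarrow>
       norm (F z' - F z - frechet_derivative F (at z) (z' - z)) \<le> K * (norm (z' - z))\<^sup>2"
begin

abbreviation DF :: "'a \<times> real \<times> real \<Rightarrow> 'a \<times> real \<times> real \<Rightarrow> 'a" where
  "DF z \<equiv> frechet_derivative F (at z)"

text \<open>For these \<open>e\<close> one period is short enough for the contraction argument, because \<open>e K\<close> is a Lipschitz
  constant of the right-hand side.\<close>

definition small :: "real \<Rightarrow> bool" where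
  "small e \<longleftrightarrow> 0 \<le> e \<and> e \<le> e0 \<and> e * K * T \<le> 1 / 2"

definition is_sol :: "real \<Rightarrow> (real \<Rightarrow> 'a) \<Rightarrow> bool" where
  "is_sol e x \<longleftrightarrow> (\<forall>t\<in>{0..T}. (x has_vector_derivative e *\<^sub>R F (x t, t, e)) (at t within {0..T}))"

definition flow :: "real \<Rightarrow> 'a \<Rightarrow> real \<Rightarrow> 'a" where
  "flow e p = (SOME x. x 0 = p \<and> is_sol e x)"

definition mean_deriv :: "'a \<Rightarrow> 'a \<Rightarrow> 'a" where
  "mean_deriv q h = frechet_derivative (mean_field T F) (at (q, 0, 0)) (h, 0, 0)"

lemma linear_DF: "linear (DF z)"
  using C1_has_derivative[OF smooth] by (rule has_derivative_linear)

lemma continuous_F: "continuous_on UNIV F" using smooth by (rule Ck_open_continuous_on)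

lemma smallD: assumes "small e" shows "0 \<le> e" "(x, t, e) \<in> slab e0" "(x, t, 0) \<in> slab e0" "0 \<le> e * K"
  using assms K_pos by (auto simp: small_def)

lemma norm_diff_slice: "norm ((x, t, e) - (y, t, e')) \<le> norm (x - y) + \<bar>e - e'\<bar>"
  using norm_Pair_le[of "x - y" "(t - t, e - e')"] by (simp add: norm_Pair)

lemma F_Lipschitz_slice:
  assumes "small e" shows "norm (F (x, t, e) - F (y, t, e)) \<le> K * norm (x - y)"
  using F_Lipschitz[OF smallD(2)[OF assms] smallD(2)[OF assms], of x t y t] by (simp add: norm_Pair)

lemma flow_solves:
  assumes "small e" shows "flow e p 0 = p" "is_sol e (flow e p)"
proof -
  have "\<exists>x. x 0 = p \<and> is_sol e x"
    unfolding is_sol_def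
  proof (rule short_time_solution_exists[where L = "e * K" and f = "\<lambda>t x. e *\<^sub>R F (x, t, e)"])
    show "continuous_on ({0..T} \<times> UNIV) (\<lambda>(t, x). e *\<^sub>R F (x, t, e))"
      unfolding case_prod_beta
      by (intro continuous_intros continuous_on_compose2[OF continuous_F]) auto
    show "norm (e *\<^sub>R F (x, t, e) - e *\<^sub>R F (y, t, e)) \<le> e * K * norm (x - y)" for t x y
      using mult_left_mono[OF F_Lipschitz_slice[OF assms, of x t y] smallD(1)[OF assms]] smallD(1)[OF assms]
      by (simp flip: scaleR_diff_right add: mult.assoc)
  qed (use assms T_pos K_pos in \<open>auto simp: small_def\<close>)
  from someI_ex[OF this] show "flow e p 0 = p" "is_sol e (flow e p)"
    by (auto simp: flow_def)
qed

lemma is_solD: "is_sol e x \<Longrightarrow> t \<in> {0..T} \<Longrightarrow> (x has_vector_derivative e *\<^sub>R F (x t, t, e)) (at t within {0..T})"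
  by (simp add: is_sol_def)

lemma is_sol_continuous: assumes "is_sol e x" shows "continuous_on {0..T} x"
  by (rule continuous_on_vector_derivative[OF is_solD[OF assms]])

lemma sol_displacement:
  assumes "small e" "is_sol e x" "t \<in> {0..T}" shows "norm (x t - x 0) \<le> e * K * T"
proof (rule increment_bound[OF is_solD[OF assms(2)] _ _ assms(3)])
  show "norm (e *\<^sub>R F (x t, t, e)) \<le> e * K" for t
    using F_bound[OF smallD(2)[OF assms(1)], of "x t" t] smallD(1)[OF assms(1)] by (simp add: mult_left_mono)
qed (use smallD[OF assms(1)] in auto)

lemma sol_Lipschitz:
  assumes e: "small e" and "is_sol e x" "is_sol e y" "t \<in> {0..T}"
  shows "norm (x t - y t) \<le> 2 * norm (x 0 - y 0)"
proof -
  have "norm (x t - y t) \<le> 2 * (norm (x 0 - y 0) + 0 * T)"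
  proof (rule short_time_bound[OF _ _ _ _ _ assms(4), where a = "e * K"
        and u' = "\<lambda>t. e *\<^sub>R F (x t, t, e) - e *\<^sub>R F (y t, t, e)"])
    show "((\<lambda>t. x t - y t) has_vector_derivative e *\<^sub>R F (x t, t, e) - e *\<^sub>R F (y t, t, e)) (at t within {0..T})"
      if "t \<in> {0..T}" for t
      using assms that by (intro has_vector_derivative_diff is_solD)
    show "norm (e *\<^sub>R F (x t, t, e) - e *\<^sub>R F (y t, t, e)) \<le> e * K * norm (x t - y t) + 0" for t
      using mult_left_mono[OF F_Lipschitz_slice[OF e, of "x t" t "y t"] smallD(1)[OF e]] smallD(1)[OF e]
      by (simp flip: scaleR_diff_right add: mult.assoc)
  qed (use smallD[OF e] e in \<open>auto simp: small_def\<close>)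
  then show ?thesis by simp
qed

lemma flow_unique:
  assumes "small e" "is_sol e x" "t \<in> {0..T}" shows "x t = flow e (x 0) t"
  using sol_Lipschitz[OF assms(1,2) flow_solves(2)[OF assms(1), of "x 0"] assms(3)]
    flow_solves(1)[OF assms(1), of "x 0"] by simp

lemma continuous_flow_end:
  assumes "small e" shows "continuous_on UNIV (\<lambda>p. flow e p T)"
proof (rule lipschitz_on_continuous_on[of 2], rule lipschitz_onI)
  fix p q
  show "dist (flow e p T) (flow e q T) \<le> 2 * dist p q"
    using sol_Lipschitz[OF assms flow_solves(2)[OF assms] flow_solves(2)[OF assms], of T p q]
      flow_solves(1)[OF assms] T_pos by (simp add: dist_norm)
qed simp

text \<open>Within a period the solution moves by \<open>O(e)\<close>, so replacing it by its initial value inside \<open>F\<close>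
  changes the increment by \<open>O(e\<^sup>2)\<close>.\<close>

lemma first_order:
  assumes e: "small e"
  shows "norm (flow e p T - p - (e * T) *\<^sub>R mean_field T F (p, 0, 0)) \<le> e\<^sup>2 * (K * (K * T + 1) * T)"
proof -
  let ?x = "flow e p"
  define w where "w t = integral {0..t} (\<lambda>s. F (p, s, 0))" for t
  have c: "continuous_on {0..T} (\<lambda>s. F (p, s, 0))" by (rule periodic_field_continuous_line[OF continuous_F])
  define u where "u t = ?x t - e *\<^sub>R w t" for t
  have "norm (u T - u 0) \<le> (e * (K * (e * K * T + e))) * T"
  proof (rule increment_bound)
    show "(u has_vector_derivative e *\<^sub>R F (?x t, t, e) - e *\<^sub>R F (p, t, 0)) (at t within {0..T})" if "t \<in> {0..T}" for t
      unfolding u_def[abs_def] w_def[abs_def]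
      by (intro has_vector_derivative_diff is_solD flow_solves e that
          bounded_linear.has_vector_derivative[OF bounded_linear_scaleR_right]
          integral_has_vector_derivative c)
    show "norm (e *\<^sub>R F (?x t, t, e) - e *\<^sub>R F (p, t, 0)) \<le> e * (K * (e * K * T + e))" if "t \<in> {0..T}" for t
    proof -
      have "norm ((?x t, t, e) - (p, t, 0)) \<le> norm (?x t - p) + e"
        using norm_diff_slice[of "?x t" t e p 0] smallD(1)[OF e] by simp
      also have "\<dots> \<le> e * K * T + e"
        using sol_displacement[OF e flow_solves(2)[OF e] that, of p] flow_solves(1)[OF e] by simp
      finally have "norm (F (?x t, t, e) - F (p, t, 0)) \<le> K * (e * K * T + e)"
        using F_Lipschitz[OF smallD(3)[OF e] smallD(2)[OF e], of "?x t" t p t] K_pos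
        by (meson mult_left_mono less_imp_le order_trans)
      then show ?thesis
        using smallD(1)[OF e] by (simp flip: scaleR_diff_right add: mult_left_mono)
    qed
  qed (use smallD[OF e] K_pos T_pos in auto)
  moreover have "w T = T *\<^sub>R mean_field T F (p, 0, 0)"
    unfolding w_def by (subst integral_rescale[OF T_pos c]) (simp add: mean_field_def)
  moreover have "w 0 = 0" by (simp add: w_def)
  ultimately show ?thesis
    by (simp add: u_def flow_solves(1)[OF e] algebra_simps power2_eq_square)
qed

lemma continuous_DF:
  assumes "continuous_on S h" "continuous_on S v"
  shows "continuous_on S (\<lambda>x. DF (h x) (v x))"
proof -
  have "Ck_open 0 (\<lambda>p. DF (fst p) (snd p)) UNIV"
    by (rule Ck_open_apply_derivative) (use smooth in \<open>auto intro!: continuous_intros\<close>)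
  then have "continuous_on UNIV (\<lambda>p. DF (fst p) (snd p))" by simp
  from continuous_on_compose2[OF this, of S "\<lambda>x. (h x, v x)"] assms show ?thesis
    by (auto intro!: continuous_intros)
qed

text \<open>The derivative at \<open>p\<close> sends \<open>h\<close> to the end value of the solution \<open>V h\<close> of the variational equation
  \<open>v' = e DF(x, t, e) v\<close>, \<open>v(0) = h\<close>. By uniqueness \<open>V\<close> is linear in \<open>h\<close>, and by the Taylor bound it
  approximates the difference of two solutions up to \<open>4 |h|\<^sup>2\<close>. The second claim compares \<open>V\<close> with the
  integral of the frozen coefficient \<open>DF(q, t, 0)\<close>, whose mean over a period is the derivative of
  the mean field.\<close>

lemma flow_end_derivative:
  assumes e: "small e" and pq: "norm (p - q) \<le> \<rho>"
  obtains \<Lambda> where "((\<lambda>p. flow e p T) has_derivative \<Lambda>) (at p)"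
    "\<And>h. norm (\<Lambda> h - h - (e * T) *\<^sub>R mean_deriv q h) \<le> T * e * K * (2 * (\<rho> + e * K * T + e) + 2 * e * K * T) * norm h"
proof -
  let ?x = "flow e p"
  note e1 = smallD(1)[OF e] and sl = smallD(2)[OF e]
  have xs: "is_sol e ?x" "?x 0 = p" using flow_solves[OF e] by auto
  have eKT: "e * K * T \<le> 1 / 2" using e by (simp add: small_def)
  have lin: "linear (\<lambda>v. DF z (v, 0, 0))" for z
    by (rule linear_compose[OF _ linear_DF, unfolded o_def]) (auto intro: linearI)
  have DFb: "norm (DF (?x t, t, e) (v, 0, 0)) \<le> K * norm v" for t v
    using DF_bound[OF sl, of "?x t" t "(v, 0, 0)"] by (simp add: norm_Pair)
  have "\<exists>v. v 0 = h \<and> (\<forall>t\<in>{0..T}. (v has_vector_derivative e *\<^sub>R DF (?x t, t, e) (v t, 0, 0)) (at t within {0..T}))" for h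
  proof (rule short_time_solution_exists[where L = "e * K" and f = "\<lambda>t v. e *\<^sub>R DF (?x t, t, e) (v, 0, 0)"])
    have "continuous_on ({0..T} \<times> UNIV) (\<lambda>q::real \<times> 'a. ?x (fst q))"
      by (rule continuous_on_compose2[OF is_sol_continuous[OF xs(1)]]) (auto intro!: continuous_intros)
    then show "continuous_on ({0..T} \<times> UNIV) (\<lambda>(t, v). e *\<^sub>R DF (?x t, t, e) (v, 0, 0))"
      unfolding case_prod_beta by (intro continuous_intros continuous_DF)
    show "norm (e *\<^sub>R DF (?x t, t, e) (v, 0, 0) - e *\<^sub>R DF (?x t, t, e) (w, 0, 0)) \<le> e * K * norm (v - w)" for t v w
      using mult_left_mono[OF DFb[of t "v - w"] e1] e1
      by (simp flip: scaleR_diff_right linear_diff[OF lin] add: mult.assoc)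
  qed (use T_pos smallD[OF e] eKT in auto)
  then obtain V where V0: "\<And>h. V h 0 = h" and
    V: "\<And>h t. t \<in> {0..T} \<Longrightarrow> (V h has_vector_derivative e *\<^sub>R DF (?x t, t, e) (V h t, 0, 0)) (at t within {0..T})"
    by metis
  have Vzero: "v t = 0"
    if "\<And>t. t \<in> {0..T} \<Longrightarrow> (v has_vector_derivative e *\<^sub>R DF (?x t, t, e) (v t, 0, 0)) (at t within {0..T})"
      "v 0 = 0" "t \<in> {0..T}" for v t
  proof -
    have "norm (v t) \<le> 2 * (norm (v 0) + 0 * T)"
      by (rule short_time_bound[OF that(1) _ _ _ eKT that(3)])
        (use mult_left_mono[OF DFb e1] e1 smallD(4)[OF e] in \<open>auto simp: mult.assoc\<close>)
    then show ?thesis using that(2) by simp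
  qed
  define \<Lambda> where "\<Lambda> h = V h T" for h
  have TT: "T \<in> {0..T}" using T_pos by simp
  have linear: "linear \<Lambda>"
  proof (rule linearI)
    fix a b :: 'a and c :: real
    have "V (a + b) T - (V a T + V b T) = 0"
    proof (rule Vzero[OF _ _ TT, where v = "\<lambda>t. V (a + b) t - (V a t + V b t)"])
      fix t assume t: "t \<in> {0..T}"
      have "((\<lambda>t. V (a + b) t - (V a t + V b t)) has_vector_derivative
          e *\<^sub>R DF (?x t, t, e) (V (a + b) t, 0, 0) - (e *\<^sub>R DF (?x t, t, e) (V a t, 0, 0) + e *\<^sub>R DF (?x t, t, e) (V b t, 0, 0)))
          (at t within {0..T})"
        by (intro has_vector_derivative_diff has_vector_derivative_add V t)
      then show "((\<lambda>t. V (a + b) t - (V a t + V b t)) has_vector_derivative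
          e *\<^sub>R DF (?x t, t, e) (V (a + b) t - (V a t + V b t), 0, 0)) (at t within {0..T})"
        by (simp add: linear_diff[OF lin] linear_add[OF lin] scaleR_diff_right scaleR_add_right)
    qed (simp add: V0)
    then show "\<Lambda> (a + b) = \<Lambda> a + \<Lambda> b" by (simp add: \<Lambda>_def)
    have "V (c *\<^sub>R a) T - c *\<^sub>R V a T = 0"
    proof (rule Vzero[OF _ _ TT, where v = "\<lambda>t. V (c *\<^sub>R a) t - c *\<^sub>R V a t"])
      fix t assume t: "t \<in> {0..T}"
      have "((\<lambda>t. V (c *\<^sub>R a) t - c *\<^sub>R V a t) has_vector_derivative
          e *\<^sub>R DF (?x t, t, e) (V (c *\<^sub>R a) t, 0, 0) - c *\<^sub>R (e *\<^sub>R DF (?x t, t, e) (V a t, 0, 0))) (at t within {0..T})"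
        by (intro has_vector_derivative_diff bounded_linear.has_vector_derivative[OF bounded_linear_scaleR_right] V t)
      then show "((\<lambda>t. V (c *\<^sub>R a) t - c *\<^sub>R V a t) has_vector_derivative
          e *\<^sub>R DF (?x t, t, e) (V (c *\<^sub>R a) t - c *\<^sub>R V a t, 0, 0)) (at t within {0..T})"
        by (simp add: linear_diff[OF lin] linear_scale[OF lin] scaleR_diff_right mult.commute)
    qed (simp add: V0)
    then show "\<Lambda> (c *\<^sub>R a) = c *\<^sub>R \<Lambda> a" by (simp add: \<Lambda>_def)
  qed
  have remainder: "norm (flow e (p + h) T - ?x T - \<Lambda> h) \<le> 4 * (norm h)\<^sup>2" for h
  proof -
    let ?y = "flow e (p + h)"
    have ys: "is_sol e ?y" "?y 0 = p + h" using flow_solves[OF e] by auto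
    define u where "u t = ?y t - ?x t - V h t" for t
    have "norm (u T) \<le> 2 * (norm (u 0) + (e * K * (4 * (norm h)\<^sup>2)) * T)"
    proof (rule short_time_bound[OF _ _ _ _ eKT TT])
      fix t assume t: "t \<in> {0..T}"
      show "(u has_vector_derivative e *\<^sub>R F (?y t, t, e) - e *\<^sub>R F (?x t, t, e) - e *\<^sub>R DF (?x t, t, e) (V h t, 0, 0)) (at t within {0..T})"
        unfolding u_def[abs_def] by (intro has_vector_derivative_diff is_solD xs ys V t)
      have "norm (?y t - ?x t) \<le> 2 * norm h"
        using sol_Lipschitz[OF e ys(1) xs(1) t] xs ys by simp
      then have "(norm (?y t - ?x t))\<^sup>2 \<le> (2 * norm h)\<^sup>2" by (intro power_mono) auto
      then have yx: "K * (norm (?y t - ?x t))\<^sup>2 \<le> K * (4 * (norm h)\<^sup>2)"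
        using K_pos by (simp add: power_mult_distrib)
      have "F (?y t, t, e) - F (?x t, t, e) - DF (?x t, t, e) (V h t, 0, 0)
          = (F (?y t, t, e) - F (?x t, t, e) - DF (?x t, t, e) ((?y t, t, e) - (?x t, t, e))) + DF (?x t, t, e) (u t, 0, 0)"
      proof -
        have eqd: "(?y t, t, e) - (?x t, t, e) = (?y t - ?x t, 0, 0)" by (simp add: zero_prod_def)
        have Du: "DF (?x t, t, e) (u t, 0, 0) = DF (?x t, t, e) (?y t - ?x t, 0, 0) - DF (?x t, t, e) (V h t, 0, 0)"
          unfolding u_def by (rule linear_diff[OF lin])
        have alg: "a - b - c = a - b - d + (d - c)" for a b c d :: 'a by simp
        show ?thesis unfolding eqd Du by (rule alg)
      qed
      also have "norm \<dots> \<le> K * (norm ((?y t, t, e) - (?x t, t, e)))\<^sup>2 + K * norm (u t)"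
        by (intro norm_triangle_le add_mono F_Taylor sl DFb)
      also have "\<dots> \<le> K * norm (u t) + K * (4 * (norm h)\<^sup>2)"
        using yx by (simp add: norm_Pair)
      finally have "e * norm (F (?y t, t, e) - F (?x t, t, e) - DF (?x t, t, e) (V h t, 0, 0)) \<le> e * (K * norm (u t) + K * (4 * (norm h)\<^sup>2))"
        using e1 by (rule mult_left_mono)
      then show "norm (e *\<^sub>R F (?y t, t, e) - e *\<^sub>R F (?x t, t, e) - e *\<^sub>R DF (?x t, t, e) (V h t, 0, 0))
          \<le> e * K * norm (u t) + e * K * (4 * (norm h)\<^sup>2)"
        unfolding scaleR_diff_right[symmetric] norm_scaleR abs_of_nonneg[OF e1]
        by (simp only: distrib_left mult.assoc)
    qed (use smallD[OF e] in auto)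
    also have "\<dots> = 2 * (e * K * T) * (4 * (norm h)\<^sup>2)" by (simp add: u_def xs ys V0)
    also have "\<dots> \<le> 2 * (1 / 2) * (4 * (norm h)\<^sup>2)" using eKT by (intro mult_right_mono) auto
    finally show ?thesis by (simp add: u_def \<Lambda>_def)
  qed
  have "((\<lambda>p. flow e p T) has_derivative \<Lambda>) (at p)"
    unfolding has_derivative_at
  proof
    show "bounded_linear \<Lambda>" using linear by (simp add: linear_conv_bounded_linear)
    have "((\<lambda>h::'a. 4 * norm h) \<longlongrightarrow> 4 * norm (0::'a)) (at 0)" by (intro tendsto_intros)
    then have lim: "((\<lambda>h::'a. 4 * norm h) \<longlongrightarrow> 0) (at 0)" by simp
    have "norm (norm (flow e (p + h) T - ?x T - \<Lambda> h) / norm h) \<le> 4 * norm h" for h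
    proof (cases "h = 0")
      case False
      then show ?thesis using remainder[of h] by (simp add: divide_le_eq power2_eq_square mult.assoc)
    qed simp
    then show "(\<lambda>h. norm (flow e (p + h) T - ?x T - \<Lambda> h) / norm h) \<midarrow>0\<rightarrow> 0"
      by (intro Lim_null_comparison[OF always_eventually lim]) blast
  qed
  moreover have "norm (\<Lambda> h - h - (e * T) *\<^sub>R mean_deriv q h) \<le> T * e * K * (2 * (\<rho> + e * K * T + e) + 2 * e * K * T) * norm h" for h
  proof -
    have cD: "continuous_on {0..T} (\<lambda>s. DF (q, s, 0) (h, 0, 0))"
      by (intro continuous_DF continuous_intros)
    define w where "w t = integral {0..t} (\<lambda>s. DF (q, s, 0) (h, 0, 0))" for t
    have Vb: "norm (V h t) \<le> 2 * norm h" if "t \<in> {0..T}" for t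
    proof -
      have "norm (V h t) \<le> 2 * (norm (V h 0) + 0 * T)"
        by (rule short_time_bound[OF V _ _ _ eKT that])
          (use mult_left_mono[OF DFb e1] e1 smallD(4)[OF e] in \<open>auto simp: mult.assoc\<close>)
      then show ?thesis by (simp add: V0)
    qed
    have Vh: "norm (V h t - h) \<le> (e * (K * (2 * norm h))) * T" if "t \<in> {0..T}" for t
    proof -
      have "norm (V h t - V h 0) \<le> (e * (K * (2 * norm h))) * T"
      proof (rule increment_bound[OF V _ _ that])
        show "norm (e *\<^sub>R DF (?x s, s, e) (V h s, 0, 0)) \<le> e * (K * (2 * norm h))" if "s \<in> {0..T}" for s
          using order_trans[OF DFb[of s "V h s"] mult_left_mono[OF Vb[OF that], of K]] e1 K_pos
          by (simp add: mult_left_mono)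
      qed (use e1 K_pos in auto)
      then show ?thesis by (simp add: V0)
    qed
    define u where "u t = V h t - e *\<^sub>R w t" for t
    define B where "B = K * (\<rho> + e * K * T + e) * (2 * norm h) + K * ((e * (K * (2 * norm h))) * T)"
    have \<rho>: "0 \<le> \<rho>" using pq norm_ge_zero order_trans by blast
    have "norm (u T - u 0) \<le> (e * B) * T"
    proof (rule increment_bound[OF _ _ _ TT])
      fix t assume t: "t \<in> {0..T}"
      show "(u has_vector_derivative e *\<^sub>R DF (?x t, t, e) (V h t, 0, 0) - e *\<^sub>R DF (q, t, 0) (h, 0, 0)) (at t within {0..T})"
        unfolding u_def[abs_def] w_def[abs_def]
        by (intro has_vector_derivative_diff V t bounded_linear.has_vector_derivative[OF bounded_linear_scaleR_right]
            integral_has_vector_derivative cD)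
      have 1: "norm (DF (?x t, t, e) (V h t, 0, 0) - DF (q, t, 0) (V h t, 0, 0)) \<le> K * (\<rho> + e * K * T + e) * (2 * norm h)"
      proof -
        have "norm ((?x t, t, e) - (q, t, 0)) \<le> norm (?x t - q) + e"
          using norm_diff_slice[of "?x t" t e q 0] e1 by simp
        also have "norm (?x t - q) \<le> norm (?x t - ?x 0) + norm (p - q)"
          using norm_triangle_ineq[of "?x t - ?x 0" "p - q"] xs by simp
        also have "\<dots> \<le> e * K * T + \<rho>"
          using sol_displacement[OF e xs(1) t] pq by (rule add_mono)
        finally have "norm ((?x t, t, e) - (q, t, 0)) \<le> \<rho> + e * K * T + e" by simp
        then have "K * norm ((?x t, t, e) - (q, t, 0)) * norm (V h t) \<le> K * (\<rho> + e * K * T + e) * (2 * norm h)"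
          using Vb[OF t] K_pos e1 \<rho> T_pos by (intro mult_mono) auto
        moreover have "norm (V h t, 0::real, 0::real) = norm (V h t)" by (simp add: norm_Pair)
        ultimately show ?thesis
          using DF_Lipschitz[OF smallD(3)[OF e] sl, of "?x t" t "(V h t, 0, 0)" q t] by simp
      qed
      have 2: "norm (DF (q, t, 0) (V h t, 0, 0) - DF (q, t, 0) (h, 0, 0)) \<le> K * ((e * (K * (2 * norm h))) * T)"
      proof -
        have "norm (DF (q, t, 0) (V h t - h, 0, 0)) \<le> K * norm (V h t - h)"
          using DF_bound[OF smallD(3)[OF e], of q t "(V h t - h, 0, 0)"] by (simp add: norm_Pair)
        also have "\<dots> \<le> K * ((e * (K * (2 * norm h))) * T)" using Vh[OF t] K_pos by (intro mult_left_mono) auto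
        finally show ?thesis using linear_diff[OF lin, of "(q, t, 0)" "V h t" h] by simp
      qed
      have "norm (DF (?x t, t, e) (V h t, 0, 0) - DF (q, t, 0) (h, 0, 0)) \<le> B"
        using norm_triangle_le[OF add_mono[OF 1 2]] by (simp add: B_def)
      then show "norm (e *\<^sub>R DF (?x t, t, e) (V h t, 0, 0) - e *\<^sub>R DF (q, t, 0) (h, 0, 0)) \<le> e * B"
        using e1 by (simp flip: scaleR_diff_right add: mult_left_mono)
    next
      show "0 \<le> e * B" unfolding B_def using e1 K_pos \<rho> T_pos by auto
    qed
    moreover have "w T = T *\<^sub>R mean_deriv q h"
      unfolding w_def mean_deriv_def mean_field_derivative[OF smooth]
      by (subst integral_rescale[OF T_pos cD]) simp
    moreover have "w 0 = 0" by (simp add: w_def)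
    moreover have "(e * B) * T = T * e * K * (2 * (\<rho> + e * K * T + e) + 2 * e * K * T) * norm h"
      by (simp add: B_def algebra_simps)
    ultimately show ?thesis by (simp add: u_def V0 \<Lambda>_def algebra_simps)
  qed
  ultimately show ?thesis using that by blast
qed

lemma linear_mean_deriv: "linear (mean_deriv q)"
proof -
  have "linear (frechet_derivative (mean_field T F) (at (q, 0, 0)))"
    using C1_has_derivative[OF Ck_open_mean_field[OF smooth]] by (rule has_derivative_linear)
  from linear_compose[OF _ this, of "\<lambda>h. (h, 0, 0)"] show ?thesis
    by (simp add: mean_deriv_def[abs_def] o_def linear_iff)
qed

text \<open>With \<open>Q(p) = (P(p) - p)/(e T)\<close> and \<open>J'\<close> the inverse of the derivative of the mean field at \<open>q\<close>, the
  Newton-like map \<open>N(p) = p - J' (Q p)\<close> satisfies \<open>|N p - q| \<le> M (K2 |p - q|\<^sup>2 + e B)\<close>. On the ball of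
  radius \<open>C e\<close>, \<open>C = 2 M B\<close>, the quadratic term is at most \<open>e B\<close> for small \<open>e\<close>, so the ball is mapped
  into itself. Since \<open>P\<close> is continuous, Brouwer's theorem gives a fixed point of \<open>N\<close>, that is,
  a zero of \<open>Q\<close>.\<close>

lemma periodic_point_exists:
  assumes q: "mean_field T F (q, 0, 0) = 0" and inj: "\<And>v. mean_deriv q v = 0 \<Longrightarrow> v = 0"
    and Taylor: "\<And>p. norm (mean_field T F (p, 0, 0) - mean_deriv q (p - q)) \<le> K2 * (norm (p - q))\<^sup>2" and "0 < K2"
  obtains C e1 where "0 < C" "0 < e1" "small e1"
    "\<And>e. 0 < e \<Longrightarrow> e \<le> e1 \<Longrightarrow> \<exists>p. norm (p - q) \<le> C * e \<and> flow e p T = p"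
proof -
  let ?m = "\<lambda>p. mean_field T F (p, 0, 0)"
  have "inj (mean_deriv q)" using inj linear_injective_0[OF linear_mean_deriv] by blast
  then obtain J' where J': "linear J'" "\<And>v. J' (mean_deriv q v) = v" "\<And>v. mean_deriv q (J' v) = v"
    using linear_injective_isomorphism[OF linear_mean_deriv] by blast
  obtain M where M: "0 < M" "\<And>v. norm (J' v) \<le> M * norm v"
    using linear_bounded_pos[OF J'(1)] by blast
  define B where "B = K * (K * T + 1)"
  define C where "C = 2 * M * B"
  have BC: "0 < B" "0 < C" using K_pos T_pos M(1) by (auto simp: B_def C_def intro!: mult_pos_pos add_pos_pos)
  define e1 where "e1 = min e0 (min (1 / (2 * K * T)) (B / (K2 * C\<^sup>2)))"
  have e1: "0 < e1" "e1 \<le> e0" "e1 \<le> 1 / (2 * K * T)" "e1 \<le> B / (K2 * C\<^sup>2)"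
    using e0_pos K_pos T_pos BC assms(4) by (auto simp: e1_def)
  have e1K: "e1 * K * T \<le> 1 / 2"
    using mult_right_mono[OF e1(3), of "K * T"] K_pos T_pos by (simp add: mult.assoc)
  have sm: "small e" if "0 \<le> e" "e \<le> e1" for e
  proof -
    have "e * (K * T) \<le> e1 * (K * T)" using that K_pos T_pos by (intro mult_right_mono) auto
    then have "e * K * T \<le> e1 * K * T" by (simp only: mult.assoc)
    then show ?thesis using that e1(2) e1K unfolding small_def by linarith
  qed
  have "\<exists>p. norm (p - q) \<le> C * e \<and> flow e p T = p" if e: "0 < e" "e \<le> e1" for e
  proof -
    have se: "small e" using sm e by simp
    define Q where "Q p = (1 / (e * T)) *\<^sub>R (flow e p T - p)" for p
    have eT: "0 < e * T" using e T_pos by simp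
    have Qm: "norm (?m p - Q p) \<le> e * B" for p
    proof -
      have "?m p - Q p = - (1 / (e * T)) *\<^sub>R (flow e p T - p - (e * T) *\<^sub>R ?m p)"
        using eT e T_pos by (simp add: Q_def algebra_simps)
      then have "norm (?m p - Q p) = 1 / (e * T) * norm (flow e p T - p - (e * T) *\<^sub>R ?m p)"
        using eT by simp
      also have "\<dots> \<le> 1 / (e * T) * (e\<^sup>2 * (K * (K * T + 1) * T))"
        using first_order[OF se, of p] eT by (intro mult_left_mono) auto
      also have "\<dots> = e * B" using e T_pos by (simp add: B_def power2_eq_square)
      finally show ?thesis .
    qed
    define N where "N p = p - J' (Q p)" for p
    have cQ: "continuous_on UNIV Q"
      unfolding Q_def[abs_def] by (intro continuous_intros continuous_flow_end se)
    have cJ: "continuous_on UNIV J'" using J'(1) by (simp add: linear_continuous_on linear_conv_bounded_linear)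
    have "continuous_on UNIV N"
      unfolding N_def[abs_def]
      by (rule continuous_on_diff[OF continuous_on_id continuous_on_compose2[OF cJ cQ]]) simp
    then have cN: "continuous_on (cball q (C * e)) N" by (rule continuous_on_subset) simp
    have "N \<in> cball q (C * e) \<rightarrow> cball q (C * e)"
    proof
      fix p assume "p \<in> cball q (C * e)"
      then have pq: "norm (p - q) \<le> C * e" by (simp add: dist_norm norm_minus_commute)
      have "N p - q = J' (mean_deriv q (p - q) - Q p)"
        by (simp add: N_def J'(2) linear_diff[OF J'(1)])
      then have "norm (N p - q) \<le> M * norm (mean_deriv q (p - q) - Q p)" using M(2) by simp
      also have "\<dots> \<le> M * (K2 * (C * e)\<^sup>2 + e * B)"
      proof (rule mult_left_mono)
        have "norm (mean_deriv q (p - q) - Q p) \<le> norm (?m p - mean_deriv q (p - q)) + norm (?m p - Q p)"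
          using norm_triangle_ineq4[of "?m p - Q p" "?m p - mean_deriv q (p - q)"] by (simp add: norm_minus_commute)
        also have "\<dots> \<le> K2 * (norm (p - q))\<^sup>2 + e * B" by (intro add_mono Taylor Qm)
        also have "\<dots> \<le> K2 * (C * e)\<^sup>2 + e * B"
          using pq assms(4) by (intro add_right_mono mult_left_mono power_mono) auto
        finally show "norm (mean_deriv q (p - q) - Q p) \<le> K2 * (C * e)\<^sup>2 + e * B" .
      qed (use M in simp)
      also have "\<dots> \<le> M * (e * B + e * B)"
      proof -
        have "K2 * C\<^sup>2 * e \<le> K2 * C\<^sup>2 * (B / (K2 * C\<^sup>2))"
          using e e1(4) assms(4) by (intro mult_left_mono) auto
        also have "\<dots> = B" using assms(4) BC by simp
        finally have "K2 * C\<^sup>2 * e \<le> B" .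
        then have "e * (K2 * C\<^sup>2 * e) \<le> e * B" using e by (intro mult_left_mono) auto
        then show ?thesis using M(1) by (simp add: power2_eq_square mult_ac)
      qed
      also have "\<dots> = C * e" by (simp add: C_def)
      finally show "N p \<in> cball q (C * e)" by (simp add: dist_norm norm_minus_commute)
    qed
    then obtain p where p: "p \<in> cball q (C * e)" "N p = p"
      using brouwer_ball[OF _ cN] BC e by (metis mult_pos_pos)
    then have "J' (Q p) = 0" by (simp add: N_def)
    then have "Q p = 0" using J'(3)[of "Q p"] linear_0[OF linear_mean_deriv] by simp
    then have "flow e p T = p" using eT e T_pos by (simp add: Q_def)
    then show ?thesis using p(1) by (auto simp: dist_norm norm_minus_commute)
  qed
  then show ?thesis using that[OF BC(2) e1(1) sm[of e1]] e1 by simp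
qed

text \<open>The copies of the solution on \<open>[kT, (k+1)T]\<close> agree at the common end points. There the two
  one-sided derivatives are equal by periodicity of the field and combine to a derivative.\<close>

lemma periodic_solution_extends:
  assumes per: "\<And>x t. F (x, t + T, e) = F (x, t, e)" and x: "is_sol e x" "x T = x 0"
  obtains \<gamma> where "\<And>t. (\<gamma> has_vector_derivative e *\<^sub>R F (\<gamma> t, t, e)) (at t)" "\<And>t. \<gamma> (t + T) = \<gamma> t"
    "\<And>t. \<exists>s\<in>{0..T}. \<gamma> t = x s" "\<And>t. t \<in> {0..T} \<Longrightarrow> \<gamma> t = x t"
proof -
  define \<gamma> where "\<gamma> t = x (t - of_int \<lfloor>t / T\<rfloor> * T)" for t
  have per': "F (y, t + of_int k * T, e) = F (y, t, e)" for y t k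
    by (rule periodic_shift_multiple[of "\<lambda>t. F (y, t, e)"]) (rule per)
  have \<gamma>: "\<gamma> t = x (t - of_int k * T)" if "t \<in> {of_int k * T..(of_int k + 1) * T}" for t k
  proof (cases "t = (of_int k + 1) * T")
    case True
    then have "\<lfloor>t / T\<rfloor> = k + 1" using T_pos by simp
    then show ?thesis using True x(2) by (simp add: \<gamma>_def algebra_simps)
  next
    case False
    then have "\<lfloor>t / T\<rfloor> = k" using that T_pos by (intro floor_unique) (auto simp: field_simps)
    then show ?thesis by (simp add: \<gamma>_def)
  qed
  have piece: "(\<gamma> has_vector_derivative e *\<^sub>R F (\<gamma> t, t, e)) (at t within {of_int k * T..(of_int k + 1) * T})"
    if t: "t \<in> {of_int k * T..(of_int k + 1) * T}" for t k
  proof -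
    let ?I = "{of_int k * T..(of_int k + 1) * T}"
    have sub: "t - of_int k * T \<in> {0..T}" if "t \<in> ?I" for t
      using that by (auto simp: algebra_simps)
    have im: "(\<lambda>t. t - of_int k * T) ` ?I \<subseteq> {0..T}" using sub by blast
    have "((\<lambda>t. t - of_int k * T) has_vector_derivative 1) (at t within ?I)"
      by (auto intro!: derivative_eq_intros)
    moreover have "(x has_vector_derivative e *\<^sub>R F (x (t - of_int k * T), t - of_int k * T, e))
        (at (t - of_int k * T) within (\<lambda>t. t - of_int k * T) ` ?I)"
      using is_solD[OF x(1) sub[OF t]] im by (rule has_vector_derivative_within_subset)
    ultimately have "((\<lambda>t. x (t - of_int k * T)) has_vector_derivative e *\<^sub>R F (x (t - of_int k * T), t - of_int k * T, e)) (at t within ?I)"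
      using vector_diff_chain_within[of "\<lambda>t. t - of_int k * T" 1 t ?I x] by (simp add: o_def)
    moreover have "F (x (t - of_int k * T), t - of_int k * T, e) = F (\<gamma> t, t, e)"
      using per'[of _ "t - of_int k * T" k] \<gamma>[OF t] by simp
    ultimately have "((\<lambda>t. x (t - of_int k * T)) has_vector_derivative e *\<^sub>R F (\<gamma> t, t, e)) (at t within ?I)" by simp
    then show ?thesis
      by (rule has_vector_derivative_transform[rotated 2]) (use \<gamma> t in auto)
  qed
  have "(\<gamma> has_vector_derivative e *\<^sub>R F (\<gamma> t, t, e)) (at t)" for t
  proof -
    define k where "k = \<lfloor>t / T\<rfloor>"
    have "of_int k \<le> t / T" "t / T < of_int k + 1" unfolding k_def by linarith+
    then have k: "of_int k * T \<le> t" "t < (of_int k + 1) * T" using T_pos by (auto simp: field_simps)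
    show ?thesis
    proof (cases "t = of_int k * T")
      case False
      then have "at t within {of_int k * T..(of_int k + 1) * T} = at t"
        using k by (intro at_within_Icc_at) auto
      then show ?thesis using piece[of t k] k by simp
    next
      case True
      let ?A = "{of_int (k - 1) * T..(of_int (k - 1) + 1) * T}" and ?B = "{of_int k * T..(of_int k + 1) * T}"
      have A: "(\<gamma> has_vector_derivative e *\<^sub>R F (\<gamma> t, t, e)) (at t within ?A)"
        using T_pos True by (intro piece) (auto simp: algebra_simps)
      have B: "(\<gamma> has_vector_derivative e *\<^sub>R F (\<gamma> t, t, e)) (at t within ?B)"
        using k by (intro piece) auto
      have AB: "?A \<union> ?B = {of_int (k - 1) * T..(of_int k + 1) * T}"
        using T_pos by (auto simp: algebra_simps)
      have "at t within (?A \<union> ?B) = at t"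
        unfolding AB using T_pos True by (intro at_within_Icc_at) (auto simp: algebra_simps)
      moreover have "(\<gamma> has_vector_derivative e *\<^sub>R F (\<gamma> t, t, e)) (at t within (?A \<union> ?B))"
        using A B by (rule has_vector_derivative_Un)
      ultimately show ?thesis by simp
    qed
  qed
  moreover have "\<gamma> (t + T) = \<gamma> t" for t
  proof -
    have "\<lfloor>(t + T) / T\<rfloor> = \<lfloor>t / T\<rfloor> + 1" using T_pos by (simp add: add_divide_distrib)
    then show ?thesis by (simp add: \<gamma>_def algebra_simps)
  qed
  moreover have "\<exists>s\<in>{0..T}. \<gamma> t = x s" for t
  proof -
    define k where "k = \<lfloor>t / T\<rfloor>"
    have "of_int k \<le> t / T" "t / T < of_int k + 1" unfolding k_def by linarith+
    then have "t - of_int k * T \<in> {0..T}" using T_pos by (auto simp: field_simps)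
    then show ?thesis by (auto simp: \<gamma>_def k_def)
  qed
  moreover have "\<gamma> t = x t" if "t \<in> {0..T}" for t using \<gamma>[of t 0] that by simp
  ultimately show ?thesis using that by blast
qed

lemma time_map_eq_flow:
  assumes e: "small e" and f: "\<And>x t. x \<in> D \<Longrightarrow> f t x = e *\<^sub>R F (x, t, e)"
    and x: "solution_in f D {0..T} x" "x 0 = p"
  shows "time_map f D T p = flow e p T"
proof -
  have TT: "T \<in> {0..T}" using T_pos by simp
  have sol: "is_sol e y" if "solution_in f D {0..T} y" for y
    unfolding is_sol_def
  proof
    fix t assume "t \<in> {0..T}"
    then have "y t \<in> D" "(y has_vector_derivative f t (y t)) (at t within {0..T})"
      using that by (auto simp: solution_in_def)
    then show "(y has_vector_derivative e *\<^sub>R F (y t, t, e)) (at t within {0..T})" by (simp add: f)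
  qed
  show ?thesis
    unfolding time_map_def
  proof (rule the_equality)
    show "\<exists>y. solution_in f D {0..T} y \<and> y 0 = p \<and> y T = flow e p T"
      using x flow_unique[OF e sol[OF x(1)] TT] by auto
    show "r = flow e p T" if "\<exists>y. solution_in f D {0..T} y \<and> y 0 = p \<and> y T = r" for r
      using that flow_unique[OF e sol TT] by auto
  qed
qed

text \<open>Solutions starting within \<open>\<delta>/2\<close> of \<open>q\<close> stay within \<open>\<delta>\<close>, hence in \<open>D\<close>, for a whole period if \<open>e\<close> is
  small. So near \<open>q\<close> the time map of any field that agrees with \<open>e F\<close> on \<open>D\<close> is the end value of
  the flow.\<close>

lemma time_map_near:
  assumes q: "q \<in> interior D" and "0 \<le> C"
  obtains e1 B where "0 < e1" "small e1" "0 \<le> B"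
    "\<And>e p f. 0 \<le> e \<Longrightarrow> e \<le> e1 \<Longrightarrow> norm (p - q) \<le> C * e \<Longrightarrow> (\<And>x t. x \<in> D \<Longrightarrow> f t x = e *\<^sub>R F (x, t, e)) \<Longrightarrow>
      p \<in> interior (time_map_dom f D T) \<and> time_map f D T p = flow e p T \<and>
      solution_in f D {0..T} (flow e p) \<and>
      (\<exists>\<Lambda>. (time_map f D T has_derivative \<Lambda>) (at p) \<and>
        (\<forall>h. norm (\<Lambda> h - h - (e * T) *\<^sub>R mean_deriv q h) \<le> B * e\<^sup>2 * norm h))"
proof -
  obtain \<delta> where \<delta>: "0 < \<delta>" "cball q \<delta> \<subseteq> D"
    using q by (meson mem_interior_cball)
  define e1 where "e1 = min e0 (min (1 / (2 * K * T)) (min (\<delta> / (2 * K * T)) (\<delta> / (4 * (C + 1)))))"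
  have e1: "0 < e1" "e1 \<le> e0" "e1 \<le> 1 / (2 * K * T)" "e1 \<le> \<delta> / (2 * K * T)" "e1 \<le> \<delta> / (4 * (C + 1))"
    using e0_pos K_pos T_pos \<delta>(1) assms(2) by (auto simp: e1_def)
  have sm: "small e" and eKT: "e * K * T \<le> \<delta> / 2" and Ce: "C * e < \<delta> / 2" if "0 \<le> e" "e \<le> e1" for e
  proof -
    have KT: "0 < K * T" using K_pos T_pos by simp
    have 0: "e * (K * T) \<le> e1 * (K * T)" using that KT by (intro mult_right_mono) auto
    have "e1 * (K * T) \<le> 1 / 2" "e1 * (K * T) \<le> \<delta> / 2"
      using mult_right_mono[OF e1(3), of "K * T"] mult_right_mono[OF e1(4), of "K * T"] K_pos T_pos by auto
    then have "e * K * T \<le> 1 / 2" "e * K * T \<le> \<delta> / 2" using 0 unfolding mult.assoc by linarith+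
    then show "small e" "e * K * T \<le> \<delta> / 2" using that e1(2) unfolding small_def by linarith+
    have "C * e \<le> (C + 1) * e1" using that assms(2) by (intro mult_mono) auto
    also have "\<dots> \<le> (C + 1) * (\<delta> / (4 * (C + 1)))" using e1(5) assms(2) by (intro mult_left_mono) auto
    also have "\<dots> = \<delta> / 4"
    proof -
      have "c * (\<delta> / (4 * c)) = \<delta> / 4" if "0 < c" for c :: real using that by simp
      from this[of "C + 1"] show ?thesis using assms(2) by linarith
    qed
    finally show "C * e < \<delta> / 2" using \<delta>(1) by linarith
  qed
  define B where "B = T * K * (2 * (C + K * T + 1) + 2 * K * T)"
  show ?thesis
  proof (rule that[of e1 B])
    show "0 < e1" "small e1" using e1 sm[of e1] by auto
    show "0 \<le> B" unfolding B_def using K_pos T_pos assms(2) by auto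
    fix e p and f :: "real \<Rightarrow> 'a \<Rightarrow> 'a"
    assume e: "0 \<le> e" "e \<le> e1" and pq: "norm (p - q) \<le> C * e"
      and f: "\<And>x t. x \<in> D \<Longrightarrow> f t x = e *\<^sub>R F (x, t, e)"
    have se: "small e" by (rule sm[OF e])
    have sol: "solution_in f D {0..T} (flow e p')" if "p' \<in> ball q (\<delta> / 2)" for p'
    proof -
      have "flow e p' t \<in> D" if t: "t \<in> {0..T}" for t
      proof -
        have "norm (flow e p' t - p') \<le> \<delta> / 2"
          using sol_displacement[OF se flow_solves(2)[OF se] t, of p'] flow_solves(1)[OF se, of p'] eKT[OF e] by simp
        moreover have "norm (p' - q) < \<delta> / 2" using \<open>p' \<in> _\<close> by (simp add: dist_norm norm_minus_commute)
        ultimately have "norm (flow e p' t - q) \<le> \<delta>"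
          using norm_triangle_ineq[of "flow e p' t - p'" "p' - q"] by simp
        then show ?thesis using \<delta>(2) by (auto simp: dist_norm norm_minus_commute)
      qed
      then show ?thesis
        using flow_solves(2)[OF se, of p'] f by (simp add: solution_in_def is_sol_def)
    qed
    have pb: "p \<in> ball q (\<delta> / 2)" using pq Ce[OF e] by (simp add: dist_norm norm_minus_commute)
    have tm: "time_map f D T p' = flow e p' T" if "p' \<in> ball q (\<delta> / 2)" for p'
      by (rule time_map_eq_flow[OF se f sol[OF that] flow_solves(1)[OF se]])
    have "ball q (\<delta> / 2) \<subseteq> time_map_dom f D T"
      using sol flow_solves(1)[OF se] by (auto simp: time_map_dom_def simp del: mem_ball)
    then have "p \<in> interior (time_map_dom f D T)" using pb by (meson interior_maximal open_ball subsetD)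
    moreover obtain \<Lambda> where \<Lambda>: "((\<lambda>p. flow e p T) has_derivative \<Lambda>) (at p)"
      "\<And>h. norm (\<Lambda> h - h - (e * T) *\<^sub>R mean_deriv q h) \<le> T * e * K * (2 * (C * e + e * K * T + e) + 2 * e * K * T) * norm h"
      using flow_end_derivative[OF se pq] by metis
    have "(time_map f D T has_derivative \<Lambda>) (at p)"
      by (rule has_derivative_transform_within_open[OF \<Lambda>(1) open_ball pb]) (simp add: tm)
    moreover have "T * e * K * (2 * (C * e + e * K * T + e) + 2 * e * K * T) = B * e\<^sup>2"
      by (simp add: B_def power2_eq_square algebra_simps)
    ultimately show "p \<in> interior (time_map_dom f D T) \<and> time_map f D T p = flow e p T \<and>
      solution_in f D {0..T} (flow e p) \<and>
      (\<exists>\<Lambda>. (time_map f D T has_derivative \<Lambda>) (at p) \<and>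
        (\<forall>h. norm (\<Lambda> h - h - (e * T) *\<^sub>R mean_deriv q h) \<le> B * e\<^sup>2 * norm h))"
      using \<Lambda>(2) tm[OF pb] sol[OF pb] by (intro conjI exI[of _ \<Lambda>] allI) auto
  qed
qed

end

section \<open>Stability of eigenvalue counts\<close>

lemma mat_vec_mult: "mat k *v x = k *s (x :: 'a::comm_ring_1^'n)"
proof -
  have "(if i = j then k else 0) * x $ j = (if j = i then k * x $ j else 0)" for i j by simp
  then show ?thesis by (simp add: vec_eq_iff matrix_vector_mult_def mat_def)
qed

lemma poly_charpoly:
  fixes A :: "real^'n^'n"
  shows "poly (charpoly A) z = det (mat z - map_matrix of_real A)"
proof -
  have "poly ((mat [:0, 1:] - map_matrix (\<lambda>a. [:of_real a:]) A) $ i $ j) z = (mat z - map_matrix of_real A) $ i $ j" for i j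
    by (simp add: mat_def map_matrix_def)
  then show ?thesis
    unfolding charpoly_def det_def by (simp only: poly_sum poly_mult poly_prod poly_of_int)
qed

lemma eigenvalue_iff_root:
  fixes A :: "real^'n^'n"
  shows "eigenvalue A \<mu> \<longleftrightarrow> poly (charpoly A) \<mu> = 0"
proof -
  let ?M = "mat \<mu> - map_matrix of_real A :: complex^'n^'n"
  have "eigenvalue A \<mu> \<longleftrightarrow> (\<exists>v. v \<noteq> 0 \<and> ?M *v v = 0)"
    unfolding eigenvalue_def matrix_vector_mult_diff_rdistrib mat_vec_mult by auto
  also have "\<dots> \<longleftrightarrow> \<not> invertible ?M"
    using matrix_left_invertible_ker[of ?M] by (auto simp: invertible_left_inverse)
  also have "\<dots> \<longleftrightarrow> poly (charpoly A) \<mu> = 0"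
    by (simp add: invertible_det_nz poly_charpoly)
  finally show ?thesis .
qed

text \<open>The eigenvalues with multiplicity, listed by the index type of the matrix. As points of a
  Euclidean space such lists have convergent subsequences.\<close>

definition root_vector :: "real^'n^'n \<Rightarrow> complex^'n \<Rightarrow> bool" where
  "root_vector A v \<longleftrightarrow> charpoly A = (\<Prod>i\<in>UNIV. [:- (v $ i), 1:])"

text \<open>In the Leibniz formula the identity permutation contributes a monic product of degree \<open>n\<close>, and
  every other permutation misses a diagonal entry and so has smaller degree.\<close>

lemma degree_charpoly: "degree (charpoly A) = CARD('n)" and lead_coeff_charpoly: "lead_coeff (charpoly A) = 1"
  for A :: "real^'n^'n"
proof -
  define M :: "complex poly^'n^'n" where "M = mat [:0, 1:] - map_matrix (\<lambda>a. [:of_real a:]) A"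
  let ?P = "{p. p permutes (UNIV :: 'n set)}"
  let ?t = "\<lambda>p. of_int (sign p) * (\<Prod>i\<in>UNIV. M $ i $ p i)"
  have n: "0 < CARD('n)" by (simp add: card_gt_0_iff)
  have diag: "M $ i $ i = [:- of_real (A $ i $ i), 1:]" for i by (simp add: M_def mat_def map_matrix_def)
  have off: "degree (M $ i $ j) = 0" if "i \<noteq> j" for i j using that by (simp add: M_def mat_def map_matrix_def)
  have deg1: "degree (M $ i $ j) \<le> 1" for i j by (cases "i = j") (simp_all add: diag off)
  have id: "?t id = (\<Prod>i\<in>UNIV. [:- of_real (A $ i $ i), 1:])" by (simp add: diag)
  have degid: "degree (?t id) = CARD('n)"
    unfolding id by (subst degree_prod_sum_eq) auto
  have lcid: "lead_coeff (?t id) = 1"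
    unfolding id by (subst lead_coeff_prod) simp
  have rest: "degree (sum ?t (?P - {id})) < CARD('n)"
  proof (rule degree_sum_less[OF _ n])
    fix p assume "p \<in> ?P - {id}"
    then obtain i where i: "p i \<noteq> i" by (auto simp: fun_eq_iff)
    have "degree (\<Prod>i\<in>UNIV. M $ i $ p i) \<le> (\<Sum>i\<in>UNIV. degree (M $ i $ p i))"
      using degree_prod_sum_le[of UNIV "\<lambda>i. M $ i $ p i"] by (simp add: o_def)
    also have "\<dots> = (\<Sum>k\<in>UNIV - {i}. degree (M $ k $ p k))"
      using off[of i "p i"] i by (subst sum.remove[of UNIV i]) auto
    also have "\<dots> \<le> (\<Sum>k\<in>UNIV - {i}. 1)" by (intro sum_mono deg1)
    also have "\<dots> < CARD('n)" using n by (simp add: card_Diff_singleton)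
    finally have "degree (\<Prod>i\<in>UNIV. M $ i $ p i) < CARD('n)" .
    moreover have "degree (?t p) \<le> degree (\<Prod>i\<in>UNIV. M $ i $ p i)"
      by (cases "sign p = 1") (auto simp: sign_def)
    ultimately show "degree (?t p) < CARD('n)" by linarith
  qed
  have fin: "finite ?P" by (simp add: finite_permutations)
  have char: "charpoly A = ?t id + sum ?t (?P - {id})"
    unfolding charpoly_def M_def[symmetric] det_def
    by (subst sum.remove[OF fin, of id]) (auto simp: permutes_id)
  have lt: "degree (sum ?t (?P - {id})) < degree (?t id)" using rest unfolding degid .
  show "degree (charpoly A) = CARD('n)"
    unfolding char degree_add_eq_left[OF lt] by (rule degid)
  show "lead_coeff (charpoly A) = 1"
    unfolding char add.commute[of "?t id"] lead_coeff_add_le[OF lt] by (rule lcid)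
qed

lemma root_vector_exists: obtains v where "root_vector (A :: real^'n^'n) v"
proof -
  obtain root where root: "smult (lead_coeff (charpoly A)) (\<Prod>i<degree (charpoly A). [:- root i, 1:]) = charpoly A"
    by (rule complex_poly_decompose')
  obtain h where h: "bij_betw h (UNIV :: 'n set) {..<CARD('n)}"
    using finite_same_card_bij[of "UNIV :: 'n set" "{..<CARD('n)}"] by auto
  have "charpoly A = (\<Prod>i<CARD('n). [:- root i, 1:])"
    using root unfolding lead_coeff_charpoly by (simp add: degree_charpoly)
  also have "\<dots> = (\<Prod>i\<in>UNIV. [:- root (h i), 1:])"
    by (rule prod.reindex_bij_betw[OF h, symmetric])
  finally have "root_vector A (\<chi> i. root (h i))" by (simp add: root_vector_def)
  then show ?thesis by (rule that)
qed

lemma root_vector_iff: "root_vector A v \<longleftrightarrow> (\<forall>z. det (mat z - map_matrix of_real A) = (\<Prod>i\<in>UNIV. z - v $ i))"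
  unfolding root_vector_def poly_eq_poly_eq_iff[symmetric] fun_eq_iff
  by (simp add: poly_charpoly poly_prod)

lemma root_vector_eigenvalue: "root_vector A v \<Longrightarrow> eigenvalue A \<mu> \<longleftrightarrow> (\<exists>i. \<mu> = v $ i)"
  by (auto simp: eigenvalue_iff_root root_vector_def poly_prod)

lemma order_prod_linear:
  fixes v :: "'i \<Rightarrow> complex"
  assumes "finite I" shows "order \<mu> (\<Prod>i\<in>I. [:- v i, 1:]) = card {i \<in> I. v i = \<mu>}"
  using assms
proof (induction I)
  case empty
  then show ?case by simp
next
  case (insert i I)
  have nz: "(\<Prod>i\<in>insert i I. [:- v i, 1:]) \<noteq> 0" by (subst prod_zero_iff) (use insert in auto)
  have lin: "order \<mu> [:- v i, 1:] = (if v i = \<mu> then 1 else 0)"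
    using order_power_n_n[of \<mu> 1] by (auto simp: order_0I)
  have "{k \<in> insert i I. v k = \<mu>} = (if v i = \<mu> then insert i {k \<in> I. v k = \<mu>} else {k \<in> I. v k = \<mu>})"
    by auto
  then have "card {k \<in> insert i I. v k = \<mu>} = (if v i = \<mu> then 1 else 0) + card {k \<in> I. v k = \<mu>}"
    using insert by simp
  moreover have "order \<mu> (\<Prod>i\<in>insert i I. [:- v i, 1:]) = order \<mu> [:- v i, 1:] + order \<mu> (\<Prod>i\<in>I. [:- v i, 1:])"
    using nz unfolding prod.insert[OF insert.hyps] by (rule order_mult)
  ultimately show ?case using insert.IH lin by simp
qed

lemma eigenvalue_count_root_vector:
  assumes "root_vector A v" shows "eigenvalue_count A S = card {i. v $ i \<in> S}"
proof -
  have "{\<mu>. eigenvalue A \<mu> \<and> \<mu> \<in> S} = (\<lambda>i. v $ i) ` {i. v $ i \<in> S}"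
    using root_vector_eigenvalue[OF assms] by auto
  moreover have "order \<mu> (charpoly A) = card {i \<in> {i. v $ i \<in> S}. v $ i = \<mu>}" if "\<mu> \<in> S" for \<mu>
  proof -
    have "{i \<in> {i. v $ i \<in> S}. v $ i = \<mu>} = {i \<in> UNIV. v $ i = \<mu>}" using that by auto
    then show ?thesis using assms order_prod_linear[of UNIV \<mu> "\<lambda>i. v $ i"] by (simp add: root_vector_def)
  qed
  ultimately have "eigenvalue_count A S = (\<Sum>\<mu>\<in>(\<lambda>i. v $ i) ` {i. v $ i \<in> S}. card {i \<in> {i. v $ i \<in> S}. v $ i = \<mu>})"
    unfolding eigenvalue_count_def by (intro sum.cong) auto
  also have "\<dots> = card {i. v $ i \<in> S}"
    using sum.image_gen[of "{i. v $ i \<in> S}" "\<lambda>_. 1::nat" "\<lambda>i. v $ i"] by simp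
  finally show ?thesis .
qed

text \<open>Compare moduli in the component where the eigenvector is largest.\<close>

lemma eigenvalue_norm_le:
  fixes A :: "real^'n^'n"
  assumes "eigenvalue A \<mu>" shows "cmod \<mu> \<le> (\<Sum>i\<in>UNIV. \<Sum>j\<in>UNIV. \<bar>A $ i $ j\<bar>)"
proof -
  obtain x :: "complex^'n" where x: "x \<noteq> 0" "map_matrix of_real A *v x = \<mu> *s x"
    using assms unfolding eigenvalue_def by blast
  have ex: "\<exists>i. \<forall>j. cmod (x $ j) \<le> cmod (x $ i)"
  proof -
    have "Max (range (\<lambda>i. cmod (x $ i))) \<in> range (\<lambda>i. cmod (x $ i))" by (intro Max_in) auto
    then obtain i where "cmod (x $ i) = Max (range (\<lambda>i. cmod (x $ i)))" by force
    then show ?thesis using Max_ge[of "range (\<lambda>i. cmod (x $ i))"] by (metis finite rangeI finite_imageI)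
  qed
  then obtain i where i: "\<And>j. cmod (x $ j) \<le> cmod (x $ i)" by blast
  have pos: "0 < cmod (x $ i)"
  proof (rule ccontr)
    assume "\<not> 0 < cmod (x $ i)"
    then have "x $ j = 0" for j using i[of j] by (metis norm_le_zero_iff order_trans linorder_not_less)
    then show False using x(1) by (simp add: vec_eq_iff)
  qed
  have "\<mu> * x $ i = (\<Sum>j\<in>UNIV. of_real (A $ i $ j) * x $ j)"
    using arg_cong[OF x(2), of "\<lambda>y. y $ i"] by (simp add: matrix_vector_mult_def map_matrix_def)
  then have "cmod \<mu> * cmod (x $ i) = cmod (\<Sum>j\<in>UNIV. of_real (A $ i $ j) * x $ j)" by (simp flip: norm_mult)
  also have "\<dots> \<le> (\<Sum>j\<in>UNIV. \<bar>A $ i $ j\<bar> * cmod (x $ i))"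
    using i by (intro sum_norm_le) (simp add: norm_mult mult_left_mono)
  also have "\<dots> = (\<Sum>j\<in>UNIV. \<bar>A $ i $ j\<bar>) * cmod (x $ i)" by (simp add: sum_distrib_right)
  finally have "cmod \<mu> \<le> (\<Sum>j\<in>UNIV. \<bar>A $ i $ j\<bar>)" using pos by simp
  also have "\<dots> \<le> (\<Sum>i\<in>UNIV. \<Sum>j\<in>UNIV. \<bar>A $ i $ j\<bar>)"
    by (rule member_le_sum[of i UNIV "\<lambda>i. \<Sum>j\<in>UNIV. \<bar>A $ i $ j\<bar>"]) (auto intro: sum_nonneg)
  finally show ?thesis .
qed

text \<open>Eigenvalues depend continuously on the matrix, with multiplicities: a limit of root vectors
  factors the limit of the characteristic polynomials.\<close>

lemma root_vector_subsequence:
  fixes A :: "nat \<Rightarrow> real^'n^'n"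
  assumes lim: "\<And>i j. (\<lambda>k. A k $ i $ j) \<longlonglongrightarrow> L $ i $ j" and v: "\<And>k. root_vector (A k) (v k)"
  obtains \<rho> l where "strict_mono (\<rho> :: nat \<Rightarrow> nat)" "(\<lambda>k. v (\<rho> k)) \<longlonglongrightarrow> l" "root_vector L l"
proof -
  have "convergent (\<lambda>k. \<Sum>i\<in>UNIV. \<Sum>j\<in>UNIV. \<bar>A k $ i $ j\<bar>)"
    unfolding convergent_def
    by (intro exI[of _ "\<Sum>i\<in>UNIV. \<Sum>j\<in>UNIV. \<bar>L $ i $ j\<bar>"] tendsto_sum tendsto_rabs lim)
  from convergent_imp_Bseq[OF this]
  obtain R where R: "\<And>k. norm (\<Sum>i\<in>UNIV. \<Sum>j\<in>UNIV. \<bar>A k $ i $ j\<bar>) \<le> R"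
    by (rule BseqE) blast
  have "norm (v k) \<le> (\<Sum>i\<in>(UNIV::'n set). R)" for k
  proof -
    have "norm (v k) \<le> (\<Sum>i\<in>UNIV. cmod (v k $ i))"
      unfolding norm_vec_def by (rule L2_set_le_sum) simp
    also have "\<dots> \<le> (\<Sum>i\<in>(UNIV::'n set). R)"
    proof (rule sum_mono)
      fix i
      have "eigenvalue (A k) (v k $ i)" using root_vector_eigenvalue[OF v] by blast
      from eigenvalue_norm_le[OF this] show "cmod (v k $ i) \<le> R" using R[of k] by simp
    qed
    finally show ?thesis .
  qed
  then have "bounded (range v)" unfolding bounded_iff by blast
  from bounded_imp_convergent_subsequence[OF this]
  obtain l \<rho> where \<rho>: "strict_mono (\<rho> :: nat \<Rightarrow> nat)" "(v \<circ> \<rho>) \<longlonglongrightarrow> l" by blast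
  have vl: "(\<lambda>k. v (\<rho> k) $ i) \<longlonglongrightarrow> l $ i" for i
    using tendsto_vec_nth[OF \<rho>(2)] by (simp add: o_def)
  have "root_vector L l"
    unfolding root_vector_iff
  proof
    fix z
    have "(\<lambda>k. det (mat z - map_matrix of_real (A (\<rho> k)) :: complex^'n^'n)) \<longlonglongrightarrow> det (mat z - map_matrix of_real L)"
      unfolding det_def
    proof (intro tendsto_sum tendsto_mult tendsto_const tendsto_prod)
      fix p :: "'n \<Rightarrow> 'n" and i
      have "(\<lambda>k. A (\<rho> k) $ i $ p i) \<longlonglongrightarrow> L $ i $ p i"
        using LIMSEQ_subseq_LIMSEQ[OF lim \<rho>(1)] by (simp add: o_def)
      then have "(\<lambda>k. mat z $ i $ p i - of_real (A (\<rho> k) $ i $ p i)) \<longlonglongrightarrow> (mat z :: complex^'n^'n) $ i $ p i - of_real (L $ i $ p i)"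
        by (intro tendsto_diff tendsto_const tendsto_of_real)
      then show "(\<lambda>k. (mat z - map_matrix of_real (A (\<rho> k)) :: complex^'n^'n) $ i $ p i) \<longlonglongrightarrow> (mat z - map_matrix of_real L) $ i $ p i"
        by (simp add: map_matrix_def)
    qed
    moreover have "(\<lambda>k. det (mat z - map_matrix of_real (A (\<rho> k)) :: complex^'n^'n)) = (\<lambda>k. \<Prod>i\<in>UNIV. z - v (\<rho> k) $ i)"
      using v by (simp add: root_vector_iff)
    moreover have "(\<lambda>k. \<Prod>i\<in>UNIV. z - v (\<rho> k) $ i) \<longlonglongrightarrow> (\<Prod>i\<in>UNIV. z - l $ i)"
      by (intro tendsto_prod tendsto_intros vl)
    ultimately show "det (mat z - map_matrix of_real L) = (\<Prod>i\<in>UNIV. z - l $ i)"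
      using LIMSEQ_unique by metis
  qed
  then show ?thesis using that \<rho> by (simp add: o_def)
qed

lemma root_vector_affine:
  fixes A :: "real^'n^'n"
  assumes "s \<noteq> 0" "root_vector A v"
  shows "root_vector (mat 1 + s *\<^sub>R A) (\<chi> i. 1 + of_real s * v $ i)"
  unfolding root_vector_iff
proof
  fix z :: complex
  let ?M = "mat ((z - 1) / of_real s) - map_matrix of_real A :: complex^'n^'n"
  have "mat z - map_matrix of_real (mat 1 + s *\<^sub>R A) = (\<chi> i. of_real s *s (?M $ i))"
    using assms(1) by (simp add: vec_eq_iff mat_def map_matrix_def algebra_simps diff_divide_distrib)
  then have "det (mat z - map_matrix of_real (mat 1 + s *\<^sub>R A) :: complex^'n^'n) = (\<Prod>i\<in>(UNIV::'n set). of_real s) * det ?M"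
    using det_rows_mul[of "\<lambda>_. of_real s" "\<lambda>i. ?M $ i"] unfolding vec_lambda_eta by (simp only:)
  also have "det ?M = (\<Prod>i\<in>UNIV. (z - 1) / of_real s - v $ i)"
    using assms(2) unfolding root_vector_iff by blast
  also have "(\<Prod>i\<in>(UNIV::'n set). of_real s) * (\<Prod>i\<in>UNIV. (z - 1) / of_real s - v $ i) = (\<Prod>i\<in>UNIV. of_real s * ((z - 1) / of_real s - v $ i))"
    by (rule prod.distrib[symmetric])
  also have "\<dots> = (\<Prod>i\<in>UNIV. z - (\<chi> i. 1 + of_real s * v $ i) $ i)"
  proof (rule prod.cong[OF refl])
    fix i
    have "of_real s * ((z - 1) / of_real s) = z - 1" using assms(1) by simp
    then show "of_real s * ((z - 1) / of_real s - v $ i) = z - (\<chi> i. 1 + of_real s * v $ i) $ i"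
      by (simp only: right_diff_distrib vec_lambda_beta) simp
  qed
  finally show "det (mat z - map_matrix of_real (mat 1 + s *\<^sub>R A)) = (\<Prod>i\<in>UNIV. z - (\<chi> i. 1 + of_real s * v $ i) $ i)" .
qed

text \<open>\<open>|1 + s \<mu>|\<^sup>2 - 1 = s (2 Re \<mu> + s |\<mu>|\<^sup>2)\<close>, and the bracket tends to \<open>2 Re l\<close>.\<close>

lemma eventually_cmod_near_one:
  fixes s :: "nat \<Rightarrow> real" and \<mu> :: "nat \<Rightarrow> complex"
  assumes "s \<longlonglongrightarrow> 0" "\<And>k. 0 < s k" "\<mu> \<longlonglongrightarrow> l" "Re l \<noteq> 0"
  shows "\<forall>\<^sub>F k in sequentially. cmod (1 + of_real (s k) * \<mu> k) \<noteq> 1 \<and>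
    (cmod (1 + of_real (s k) * \<mu> k) < 1 \<longleftrightarrow> Re l < 0) \<and> (1 < cmod (1 + of_real (s k) * \<mu> k) \<longleftrightarrow> 0 < Re l)"
proof -
  let ?q = "\<lambda>k. 2 * Re (\<mu> k) + s k * (cmod (\<mu> k))\<^sup>2"
  have eq: "(cmod (1 + of_real (s k) * \<mu> k))\<^sup>2 = 1 + s k * ?q k" for k
    unfolding cmod_power2 by (simp add: power2_eq_square algebra_simps)
  have cmp: "cmod (1 + of_real (s k) * \<mu> k) < 1 \<longleftrightarrow> ?q k < 0" "1 < cmod (1 + of_real (s k) * \<mu> k) \<longleftrightarrow> 0 < ?q k" for k
  proof -
    let ?c = "cmod (1 + of_real (s k) * \<mu> k)"
    have "?c < 1 \<longleftrightarrow> ?c\<^sup>2 < 1" "1 < ?c \<longleftrightarrow> 1 < ?c\<^sup>2"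
      using abs_square_less_1[of ?c] power_strict_mono[of 1 ?c 2] power_mono[of ?c 1 2] by fastforce+
    then show "?c < 1 \<longleftrightarrow> ?q k < 0" "1 < ?c \<longleftrightarrow> 0 < ?q k"
      using assms(2)[of k] unfolding eq by (auto simp: mult_less_0_iff zero_less_mult_iff)
  qed
  have lim: "?q \<longlonglongrightarrow> 2 * Re l + 0 * (cmod l)\<^sup>2"
    by (intro tendsto_intros assms tendsto_Re)
  show ?thesis
  proof (cases "Re l < 0")
    case True
    then have "\<forall>\<^sub>F k in sequentially. ?q k < 0" using order_tendstoD(2)[OF lim, of 0] by simp
    then show ?thesis
    proof eventually_elim
      case (elim k)
      then show ?case using cmp[of k] True by auto
    qed
  next
    case False
    then have "\<forall>\<^sub>F k in sequentially. 0 < ?q k" using order_tendstoD(1)[OF lim, of 0] assms(4) by simp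
    then show ?thesis
    proof eventually_elim
      case (elim k)
      then show ?case using cmp[of k] False assms(4) by auto
    qed
  qed
qed

text \<open>If this failed, there would be \<open>e\<^sub>k \<rightarrow> 0\<close> and matrices \<open>A\<^sub>k\<close> violating the claim. The rescaled
  \<open>L\<^sub>k = (A\<^sub>k - I)/(e\<^sub>k T)\<close> converge to \<open>J\<close>, so along a subsequence their root vectors converge to one
  of \<open>J\<close>. The roots of \<open>A\<^sub>k\<close> are \<open>1 + e\<^sub>k T \<mu>\<close> with \<open>\<mu>\<close> a root of \<open>L\<^sub>k\<close>, and eventually each is inside
  or outside the unit circle according to the sign of the real part of the limit.\<close>

lemma near_identity_hyperbolic:
  fixes J :: "real^'n^'n"
  assumes J: "\<And>\<mu>. eigenvalue J \<mu> \<Longrightarrow> Re \<mu> \<noteq> 0" and "0 < T" "0 \<le> B"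
  shows "\<exists>d>0. \<forall>e A. 0 < e \<longrightarrow> e \<le> d \<longrightarrow> (\<forall>h. norm (A *v h - h - (e * T) *\<^sub>R (J *v h)) \<le> B * e\<^sup>2 * norm h) \<longrightarrow>
      (\<forall>\<mu>. eigenvalue A \<mu> \<longrightarrow> cmod \<mu> \<noteq> 1) \<and>
      eigenvalue_count A {\<mu>. cmod \<mu> < 1} = eigenvalue_count J {\<mu>. Re \<mu> < 0} \<and>
      eigenvalue_count A {\<mu>. cmod \<mu> > 1} = eigenvalue_count J {\<mu>. Re \<mu> > 0}"
proof -
  define close where "close e A \<longleftrightarrow> (\<forall>h. norm (A *v h - h - (e * T) *\<^sub>R (J *v h)) \<le> B * e\<^sup>2 * norm h)" for e and A :: "real^'n^'n"
  define good where "good A \<longleftrightarrow> (\<forall>\<mu>. eigenvalue A \<mu> \<longrightarrow> cmod \<mu> \<noteq> 1) \<and>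
      eigenvalue_count A {\<mu>. cmod \<mu> < 1} = eigenvalue_count J {\<mu>. Re \<mu> < 0} \<and>
      eigenvalue_count A {\<mu>. cmod \<mu> > 1} = eigenvalue_count J {\<mu>. Re \<mu> > 0}" for A :: "real^'n^'n"
  have "\<exists>d>0. \<forall>e A. 0 < e \<longrightarrow> e \<le> d \<longrightarrow> close e A \<longrightarrow> good A"
  proof (rule ccontr)
    assume neg: "\<not> ?thesis"
    have "\<exists>e A. 0 < e \<and> e \<le> 1 / real (Suc k) \<and> close e A \<and> \<not> good A" for k
      using neg[simplified, rule_format, of "1 / real (Suc k)"] by auto
    then obtain e A where eA: "\<And>k. 0 < e k" "\<And>k. e k \<le> 1 / real (Suc k)" "\<And>k. close (e k) (A k)" "\<And>k. \<not> good (A k)"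
      by metis
    have e0: "e \<longlonglongrightarrow> 0"
    proof (rule tendsto_sandwich[of "\<lambda>_. 0"])
      show "(\<lambda>k. 1 / real (Suc k)) \<longlonglongrightarrow> 0" using LIMSEQ_inverse_real_of_nat by (simp add: inverse_eq_divide)
    qed (use eA in \<open>auto intro!: always_eventually less_imp_le\<close>)
    define s where "s k = e k * T" for k
    have s: "s \<longlonglongrightarrow> 0" "\<And>k. 0 < s k"
      using tendsto_mult_left_zero[OF e0, of T] eA(1) assms(2) by (auto simp: s_def[abs_def])
    define L where "L k = (1 / s k) *\<^sub>R (A k - mat 1)" for k
    have AL: "A k = mat 1 + s k *\<^sub>R L k" for k
      using s(2)[of k] by (simp add: L_def)
    have lim: "(\<lambda>k. L k $ i $ j) \<longlonglongrightarrow> J $ i $ j" for i j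
    proof (rule LIM_zero_cancel, rule Lim_null_comparison)
      show "\<forall>\<^sub>F k in sequentially. norm (L k $ i $ j - J $ i $ j) \<le> B / T * e k"
      proof (intro always_eventually allI)
        fix k
        let ?h = "axis j 1 :: real^'n"
        have "norm ((A k *v ?h - ?h - s k *\<^sub>R (J *v ?h)) $ i) \<le> norm (A k *v ?h - ?h - s k *\<^sub>R (J *v ?h))"
          using component_le_norm_cart by (simp only: real_norm_def)
        also have "\<dots> \<le> B * (e k)\<^sup>2 * norm ?h"
          using eA(3)[of k] unfolding close_def s_def by blast
        also have "\<dots> = B * (e k)\<^sup>2" by (simp add: norm_axis_1)
        finally have "\<bar>(A k *v ?h - ?h - s k *\<^sub>R (J *v ?h)) $ i\<bar> \<le> B * (e k)\<^sup>2" by simp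
        moreover have "(A k *v ?h - ?h - s k *\<^sub>R (J *v ?h)) $ i = s k * (L k $ i $ j - J $ i $ j)"
          unfolding matrix_vector_mult_basis
          by (simp add: AL column_def mat_def axis_def algebra_simps)
        ultimately have "s k * \<bar>L k $ i $ j - J $ i $ j\<bar> \<le> B * (e k)\<^sup>2"
          using s(2)[of k] by (simp add: abs_mult)
        then have "T * \<bar>L k $ i $ j - J $ i $ j\<bar> * e k \<le> (B * e k) * e k"
          by (simp add: s_def power2_eq_square mult_ac)
        then have "T * \<bar>L k $ i $ j - J $ i $ j\<bar> \<le> B * e k" using eA(1)[of k] by simp
        then show "norm (L k $ i $ j - J $ i $ j) \<le> B / T * e k" using assms(2) by (simp add: field_simps)
      qed
      show "(\<lambda>k. B / T * e k) \<longlonglongrightarrow> 0" using tendsto_mult_right_zero[OF e0] .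
    qed
    have "\<exists>v. root_vector (L k) v" for k using root_vector_exists by blast
    then obtain v where v: "\<And>k. root_vector (L k) (v k)" by metis
    obtain \<rho> l where \<rho>: "strict_mono (\<rho> :: nat \<Rightarrow> nat)" "(\<lambda>k. v (\<rho> k)) \<longlonglongrightarrow> l" and l: "root_vector J l"
      using root_vector_subsequence[OF lim v] by metis
    have Rel: "Re (l $ i) \<noteq> 0" for i using J root_vector_eigenvalue[OF l] by blast
    define Q where "Q k i \<longleftrightarrow> cmod (1 + of_real (s (\<rho> k)) * v (\<rho> k) $ i) \<noteq> 1 \<and>
      (cmod (1 + of_real (s (\<rho> k)) * v (\<rho> k) $ i) < 1 \<longleftrightarrow> Re (l $ i) < 0) \<and>
      (1 < cmod (1 + of_real (s (\<rho> k)) * v (\<rho> k) $ i) \<longleftrightarrow> 0 < Re (l $ i))" for k i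
    have "\<forall>\<^sub>F k in sequentially. Q k i" for i
    proof -
      have "(\<lambda>k. s (\<rho> k)) \<longlonglongrightarrow> 0" using LIMSEQ_subseq_LIMSEQ[OF s(1) \<rho>(1)] by (simp add: o_def)
      from eventually_cmod_near_one[OF this s(2) tendsto_vec_nth[OF \<rho>(2)] Rel]
      show ?thesis unfolding Q_def .
    qed
    then have "\<forall>\<^sub>F k in sequentially. \<forall>i\<in>UNIV. Q k i"
      by (intro eventually_ball_finite) auto
    then have "\<exists>k. \<forall>i\<in>UNIV. Q k i" by (rule eventually_happens'[OF sequentially_bot])
    then obtain k where k: "\<And>i. cmod (1 + of_real (s (\<rho> k)) * v (\<rho> k) $ i) \<noteq> 1"
      "\<And>i. cmod (1 + of_real (s (\<rho> k)) * v (\<rho> k) $ i) < 1 \<longleftrightarrow> Re (l $ i) < 0"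
      "\<And>i. 1 < cmod (1 + of_real (s (\<rho> k)) * v (\<rho> k) $ i) \<longleftrightarrow> 0 < Re (l $ i)"
      unfolding Q_def by blast
    have rv: "root_vector (A (\<rho> k)) (\<chi> i. 1 + of_real (s (\<rho> k)) * v (\<rho> k) $ i)"
      unfolding AL[of "\<rho> k"] using s(2)[of "\<rho> k"] by (intro root_vector_affine v) simp
    have "good (A (\<rho> k))"
      unfolding good_def eigenvalue_count_root_vector[OF rv] eigenvalue_count_root_vector[OF l]
        root_vector_eigenvalue[OF rv]
      using k by auto
    then show False using eA(4) by blast
  qed
  then show ?thesis unfolding close_def good_def .
qed

section \<open>The averaging theorem\<close>

lemma slow_system_exists:
  assumes "0 < T" "0 < e0" "Ck_open 2 G UNIV" "periodic_field T G"
  obtains K where "slow_system G T e0 K"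
proof -
  obtain K where K: "0 < K"
    "\<And>z. z \<in> slab e0 \<Longrightarrow> norm (G z) \<le> K"
    "\<And>z v. z \<in> slab e0 \<Longrightarrow> norm (frechet_derivative G (at z) v) \<le> K * norm v"
    "\<And>z z'. z \<in> slab e0 \<Longrightarrow> z' \<in> slab e0 \<Longrightarrow> norm (G z' - G z) \<le> K * norm (z' - z)"
    "\<And>z z' v. z \<in> slab e0 \<Longrightarrow> z' \<in> slab e0 \<Longrightarrow>
       norm (frechet_derivative G (at z') v - frechet_derivative G (at z) v) \<le> K * norm (z' - z) * norm v"
    "\<And>z z'. z \<in> slab e0 \<Longrightarrow> z' \<in> slab e0 \<Longrightarrow>
       norm (G z' - G z - frechet_derivative G (at z) (z' - z)) \<le> K * (norm (z' - z))\<^sup>2"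
    by (rule periodic_field_bounds[OF assms(1,3,4), of e0]) (rule that)
  have "Ck_open 1 G UNIV" using assms(3) by (rule Ck_open_mono) simp
  then have "slow_system G T e0 K"
    by (intro slow_system.intro assms(1,2) K)
  then show ?thesis by (rule that)
qed

lemma real_kernel_trivial:
  fixes A :: "real^'n^'n"
  assumes "\<not> eigenvalue A 0" "A *v v = 0" shows "v = 0"
proof (rule ccontr)
  assume "v \<noteq> 0"
  then have "(\<chi> i. complex_of_real (v $ i)) \<noteq> 0" by (simp add: vec_eq_iff)
  moreover have "map_matrix of_real A *v (\<chi> i. complex_of_real (v $ i)) = (\<chi> i. of_real ((A *v v) $ i))"
    by (simp add: vec_eq_iff matrix_vector_mult_def map_matrix_def)
  then have "map_matrix of_real A *v (\<chi> i. complex_of_real (v $ i)) = 0 *s (\<chi> i. complex_of_real (v $ i))"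
    using assms(2) by (simp add: vec_eq_iff)
  ultimately show False using assms(1) unfolding eigenvalue_def by blast
qed

lemma jacobian_mult_vec:
  fixes f :: "real^'n \<Rightarrow> real^'n"
  assumes "(f has_derivative L) (at x)" shows "jacobian f (at x) *v h = L h"
  unfolding jacobian_def frechet_derivative_at[OF assms, symmetric]
  by (rule linear_matrix_vec[OF has_derivative_linear[OF assms]])

lemma Ck_on_UNIV: "Ck_open k f UNIV \<Longrightarrow> Ck_on k f S"
  unfolding Ck_on_def by (intro exI[of _ UNIV] exI[of _ f]) auto

lemma averaged_change_of_coordinates:
  fixes D :: "(real^'n) set" and g :: "real^'n \<Rightarrow> real \<Rightarrow> real \<Rightarrow> real^'n"
    and G :: "(real^'n) \<times> real \<times> real \<Rightarrow> real^'n"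
  assumes T: "0 < T" and e0: "0 < \<epsilon>0" and r: "2 \<le> r"
    and G: "Ck_open r G UNIV" "periodic_field T G"
    and Gg: "\<And>x t e. x \<in> D \<Longrightarrow> e \<in> {0..\<epsilon>0} \<Longrightarrow> G (x, t, e) = g x t e"
  shows "\<exists>U \<epsilon>1 (w :: real^'n \<Rightarrow> real \<Rightarrow> real^'n) (g1 :: real^'n \<Rightarrow> real \<Rightarrow> real \<Rightarrow> real^'n).
        open U \<and> D \<subseteq> U \<and> 0 < \<epsilon>1 \<and> \<epsilon>1 \<le> \<epsilon>0 \<and>
        (\<forall>y\<in>U. \<forall>t. w y (t + T) = w y t) \<and>
        (\<forall>y\<in>D. \<forall>t. \<forall>\<epsilon>\<in>{0..\<epsilon>1}. g1 y (t + T) \<epsilon> = g1 y t \<epsilon>) \<and>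
        Ck_on r (\<lambda>(y, t). w y t) (U \<times> UNIV) \<and>
        continuous_on (D \<times> UNIV \<times> {0..\<epsilon>1}) (\<lambda>(y, t, \<epsilon>). g1 y t \<epsilon>) \<and>
        (\<forall>\<epsilon>\<in>{0..\<epsilon>1}.
           Ck_diffeo_on r (\<lambda>(y, t). (y + \<epsilon> *\<^sub>R w y t, t)) (U \<times> UNIV) \<and>
           D \<times> UNIV \<subseteq> (\<lambda>(y, t). (y + \<epsilon> *\<^sub>R w y t, t)) ` (U \<times> UNIV) \<and>
           (\<forall>J x y. is_interval J \<longrightarrow>
              (\<forall>t\<in>J. x t \<in> D \<and> y t \<in> D \<and> x t = y t + \<epsilon> *\<^sub>R w (y t) t) \<longrightarrow>
              (solution_in (\<lambda>t x. \<epsilon> *\<^sub>R g x t \<epsilon>) D J x \<longleftrightarrow>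
               solution_in (\<lambda>t y. \<epsilon> *\<^sub>R time_average T g y + \<epsilon>\<^sup>2 *\<^sub>R g1 y t \<epsilon>) D J y)))"
proof -
  have cG: "continuous_on UNIV G" using G(1) by (rule Ck_open_continuous_on)
  have avg: "time_average T g y = mean_field T G (y, t, e)" if "y \<in> D" for y t e
    using time_average_eq_mean_field[OF T _ cG, of y g] Gg[OF that] e0
    by (simp add: mean_field_def)
  obtain e1 g1 where e1: "0 < e1" "e1 \<le> \<epsilon>0"
    and per: "\<And>y t e. g1 (y, t + T, e) = g1 (y, t, e)"
    and cont: "continuous_on (UNIV \<times> UNIV \<times> {0..e1}) g1"
    and bij: "\<And>e. e \<in> {0..e1} \<Longrightarrow> bij (\<lambda>(y, t). (y + e *\<^sub>R corrector T G (y, t, 0), t))"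
    and Ck: "\<And>e. e \<in> {0..e1} \<Longrightarrow> Ck_open r (\<lambda>(y, t). (y + e *\<^sub>R corrector T G (y, t, 0), t)) UNIV"
    and Ckinv: "\<And>e. e \<in> {0..e1} \<Longrightarrow> Ck_open r (inv (\<lambda>(y, t). (y + e *\<^sub>R corrector T G (y, t, 0), t))) UNIV"
    and equiv: "\<And>e J x y t. e \<in> {0..e1} \<Longrightarrow> \<forall>t\<in>J. x t = y t + e *\<^sub>R corrector T G (y t, t, 0) \<Longrightarrow> t \<in> J \<Longrightarrow>
      (x has_vector_derivative e *\<^sub>R G (x t, t, e)) (at t within J) \<longleftrightarrow>
      (y has_vector_derivative e *\<^sub>R mean_field T G (y t, t, 0) + e\<^sup>2 *\<^sub>R g1 (y t, t, e)) (at t within J)"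
    by (rule near_identity_transform[OF T G(1) r G(2) e0]) (rule that)
  show ?thesis
  proof (intro exI[of _ UNIV] exI[of _ e1] exI[of _ "\<lambda>y t. corrector T G (y, t, 0)"]
      exI[of _ "\<lambda>y t e. g1 (y, t, e)"] conjI ballI allI impI)
    show "corrector T G (y, t + T, 0) = corrector T G (y, t, 0)" for y t
      using periodic_field_corrector[OF G(2) cG] by (simp add: periodic_field_def)
    have "Ck_open r (\<lambda>p::(real^'n) \<times> real. corrector T G (fst p, snd p, 0)) UNIV"
      by (rule Ck_open_compose[OF open_UNIV _ Ck_open_corrector[OF G(1)] Ck_open_bounded_linear[OF open_UNIV]])
        (auto intro!: bounded_linear_Pair bounded_linear_fst bounded_linear_snd bounded_linear_zero)
    then show "Ck_on r (\<lambda>(y, t). corrector T G (y, t, 0)) (UNIV \<times> UNIV)"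
      by (intro Ck_on_UNIV) (simp add: case_prod_beta')
    have "continuous_on (D \<times> UNIV \<times> {0..e1}) g1" using cont by (rule continuous_on_subset) auto
    then show "continuous_on (D \<times> UNIV \<times> {0..e1}) (\<lambda>(y, t, e). g1 (y, t, e))" by simp
    fix e assume e: "e \<in> {0..e1}"
    let ?\<Phi> = "\<lambda>(y, t). (y + e *\<^sub>R corrector T G (y, t, 0), t)"
    show "Ck_diffeo_on r ?\<Phi> (UNIV \<times> UNIV)"
      unfolding Ck_diffeo_on_def UNIV_Times_UNIV
      using bij_is_inj[OF bij[OF e]] Ck_on_UNIV[OF Ck[OF e]] Ck_on_UNIV[OF Ckinv[OF e]] by blast
    show "D \<times> UNIV \<subseteq> ?\<Phi> ` (UNIV \<times> UNIV)"
      unfolding UNIV_Times_UNIV bij_is_surj[OF bij[OF e]] by simp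
    fix J and x y :: "real \<Rightarrow> real^'n"
    assume xy: "\<forall>t\<in>J. x t \<in> D \<and> y t \<in> D \<and> x t = y t + e *\<^sub>R corrector T G (y t, t, 0)"
    have ee: "e \<in> {0..\<epsilon>0}" using e e1(2) by auto
    have "(x has_vector_derivative e *\<^sub>R g (x t) t e) (at t within J) \<longleftrightarrow>
        (y has_vector_derivative e *\<^sub>R time_average T g (y t) + e\<^sup>2 *\<^sub>R g1 (y t, t, e)) (at t within J)"
      if t: "t \<in> J" for t
    proof -
      have "\<forall>t\<in>J. x t = y t + e *\<^sub>R corrector T G (y t, t, 0)" "x t \<in> D" "y t \<in> D" using xy t by blast+
      then show ?thesis
        using equiv[OF e _ t, of x y] avg[of "y t" t 0] Gg[OF _ ee, of "x t" t] by simp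
    qed
    then show "solution_in (\<lambda>t x. e *\<^sub>R g x t e) D J x \<longleftrightarrow>
        solution_in (\<lambda>t y. e *\<^sub>R time_average T g y + e\<^sup>2 *\<^sub>R g1 (y, t, e)) D J y"
      using xy unfolding solution_in_def by blast
  qed (use e1 per in auto)
qed

lemma averaged_trajectories_close:
  fixes g :: "'a::euclidean_space \<Rightarrow> real \<Rightarrow> real \<Rightarrow> 'a" and G :: "'a \<times> real \<times> real \<Rightarrow> 'a"
  assumes T: "0 < T" and e0: "0 < \<epsilon>0" and G: "Ck_open 2 G UNIV" "periodic_field T G"
    and Gg: "\<And>x t e. x \<in> D \<Longrightarrow> e \<in> {0..\<epsilon>0} \<Longrightarrow> G (x, t, e) = g x t e" and c: "0 < c"
  shows "\<exists>C. \<forall>\<epsilon>\<in>{0<..\<epsilon>0}. \<forall>\<tau> x y.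
        \<tau> \<le> c / \<epsilon> \<longrightarrow>
        solution_in (\<lambda>t x. \<epsilon> *\<^sub>R g x t \<epsilon>) D {0..\<tau>} x \<longrightarrow>
        solution_in (\<lambda>t y. \<epsilon> *\<^sub>R time_average T g y) D {0..\<tau>} y \<longrightarrow>
        norm (x 0 - y 0) \<le> K * \<epsilon> \<longrightarrow>
        (\<forall>t\<in>{0..\<tau>}. norm (x t - y t) \<le> C * \<epsilon>)"
proof -
  have cG: "continuous_on UNIV G" using G(1) by (rule Ck_open_continuous_on)
  have avg: "time_average T g y = mean_field T G (y, t, e)" if "y \<in> D" for y t e
    using time_average_eq_mean_field[OF T _ cG, of y g] Gg[OF that] e0
    by (simp add: mean_field_def)
  obtain C where C: "\<forall>e\<in>{0<..\<epsilon>0}. \<forall>\<tau> x y. \<tau> \<le> c / e \<longrightarrow>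
    (\<forall>t\<in>{0..\<tau>}. (x has_vector_derivative e *\<^sub>R G (x t, t, e)) (at t within {0..\<tau>})) \<longrightarrow>
    (\<forall>t\<in>{0..\<tau>}. (y has_vector_derivative e *\<^sub>R mean_field T G (y t, t, e)) (at t within {0..\<tau>})) \<longrightarrow>
    norm (x 0 - y 0) \<le> K * e \<longrightarrow> (\<forall>t\<in>{0..\<tau>}. norm (x t - y t) \<le> C * e)"
    using averaging_estimate[OF T G c e0, of K] by blast
  show ?thesis
  proof (intro exI[of _ C] ballI allI impI)
    fix e \<tau> x y t
    assume e: "e \<in> {0<..\<epsilon>0}" and \<tau>: "\<tau> \<le> c / e"
      and x: "solution_in (\<lambda>t x. e *\<^sub>R g x t e) D {0..\<tau>} x"
      and y: "solution_in (\<lambda>t y. e *\<^sub>R time_average T g y) D {0..\<tau>} y"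
      and i: "norm (x 0 - y 0) \<le> K * e" and t: "t \<in> {0..\<tau>}"
    have ee: "e \<in> {0..\<epsilon>0}" using e by auto
    have "(x has_vector_derivative e *\<^sub>R G (x t, t, e)) (at t within {0..\<tau>})"
      "(y has_vector_derivative e *\<^sub>R mean_field T G (y t, t, e)) (at t within {0..\<tau>})" if "t \<in> {0..\<tau>}" for t
    proof -
      have "x t \<in> D" "y t \<in> D" "(x has_vector_derivative e *\<^sub>R g (x t) t e) (at t within {0..\<tau>})"
        "(y has_vector_derivative e *\<^sub>R time_average T g (y t)) (at t within {0..\<tau>})"
        using x y that unfolding solution_in_def by blast+
      then show "(x has_vector_derivative e *\<^sub>R G (x t, t, e)) (at t within {0..\<tau>})"
        "(y has_vector_derivative e *\<^sub>R mean_field T G (y t, t, e)) (at t within {0..\<tau>})"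
        using Gg[OF _ ee, of "x t" t] avg[of "y t" t e] by simp_all
    qed
    then show "norm (x t - y t) \<le> C * e" using C e \<tau> i t by blast
  qed
qed

text \<open>Both time maps are \<open>I + \<epsilon> T A + O(\<epsilon>\<^sup>2)\<close> at their fixed points with the same matrix \<open>A\<close>, since the
  averaged field is its own mean. Hence the same eigenvalue count applies to both.\<close>

lemma averaged_periodic_orbit:
  fixes D :: "(real^'n) set" and g :: "real^'n \<Rightarrow> real \<Rightarrow> real \<Rightarrow> real^'n"
    and G :: "(real^'n) \<times> real \<times> real \<Rightarrow> real^'n"
  assumes T: "0 < T" and e0: "0 < \<epsilon>0" and G: "Ck_open 2 G UNIV" "periodic_field T G"
    and Gg: "\<And>x t e. x \<in> D \<Longrightarrow> e \<in> {0..\<epsilon>0} \<Longrightarrow> G (x, t, e) = g x t e"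
    and ys: "ys \<in> interior D" "time_average T g ys = 0"
    and nondeg: "\<not> eigenvalue (jacobian (time_average T g) (at ys)) 0"
  shows "\<exists>\<gamma> C \<epsilon>1. 0 < \<epsilon>1 \<and> \<epsilon>1 \<le> \<epsilon>0 \<and>
           (\<forall>\<epsilon>\<in>{0..\<epsilon>1}.
              solution_in (\<lambda>t x. \<epsilon> *\<^sub>R g x t \<epsilon>) D UNIV (\<gamma> \<epsilon>) \<and>
              (\<forall>t. \<gamma> \<epsilon> (t + T) = \<gamma> \<epsilon> t) \<and>
              (\<forall>t. norm (\<gamma> \<epsilon> t - ys) \<le> C * \<epsilon>)) \<and>
           ((\<forall>\<mu>. eigenvalue (jacobian (time_average T g) (at ys)) \<mu> \<longrightarrow> Re \<mu> \<noteq> 0) \<longrightarrow>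
            (\<exists>\<epsilon>2. 0 < \<epsilon>2 \<and> \<epsilon>2 \<le> \<epsilon>1 \<and>
               (\<forall>\<epsilon>\<in>{0<..\<epsilon>2}.
                  same_stability_type D T
                    (\<lambda>t x. \<epsilon> *\<^sub>R g x t \<epsilon>) (\<gamma> \<epsilon> 0)
                    (\<lambda>t y. \<epsilon> *\<^sub>R time_average T g y) ys)))"
proof -
  let ?m = "mean_field T G"
  define A where "A = jacobian (time_average T g) (at ys)"
  have cG: "continuous_on UNIV G" using G(1) by (rule Ck_open_continuous_on)
  have C1: "Ck_open 1 G UNIV" using G(1) by (rule Ck_open_mono) simp
  have avg: "time_average T g y = ?m (y, t, e)" if "y \<in> D" for y t e
    using time_average_eq_mean_field[OF T _ cG, of y g] Gg[OF that] e0
    by (simp add: mean_field_def)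
  have ysD: "ys \<in> D" using ys(1) interior_subset by blast
  have m0: "?m (ys, t, e) = 0" for t e using avg[OF ysD, of t e] ys(2) by simp
  have mm: "mean_field T ?m = ?m" by (simp add: fun_eq_iff mean_field_def)
  obtain K1 where K1: "slow_system G T \<epsilon>0 K1" by (rule slow_system_exists[OF T e0 G])
  obtain K2 where K2: "slow_system ?m T \<epsilon>0 K2"
    by (rule slow_system_exists[OF T e0 Ck_open_mean_field[OF G(1)] periodic_field_mean_field[OF G(2)]])
  interpret S: slow_system G T \<epsilon>0 K1 by (rule K1)
  interpret M: slow_system ?m T \<epsilon>0 K2 by (rule K2)
  have MJ: "M.mean_deriv = S.mean_deriv" by (simp add: M.mean_deriv_def S.mean_deriv_def mm fun_eq_iff)
  have AJ: "A *v h = S.mean_deriv ys h" for h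
  proof -
    have "((\<lambda>y. (y, 0::real, 0::real)) has_derivative (\<lambda>h. (h, 0, 0))) (at ys)"
      by (auto intro!: derivative_eq_intros simp: zero_prod_def)
    from has_derivative_compose[OF this C1_has_derivative[OF Ck_open_mean_field[OF C1]]]
    have "((\<lambda>y. ?m (y, 0, 0)) has_derivative S.mean_deriv ys) (at ys)" by (simp add: S.mean_deriv_def[abs_def])
    then have "(time_average T g has_derivative S.mean_deriv ys) (at ys)"
      by (rule has_derivative_transform_within_open[OF _ open_interior ys(1)])
        (rule avg[OF subsetD[OF interior_subset], symmetric])
    then show ?thesis unfolding A_def by (rule jacobian_mult_vec)
  qed
  have inj: "v = 0" if "S.mean_deriv ys v = 0" for v
    using real_kernel_trivial[OF nondeg] that AJ[of v] by (simp add: A_def)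
  have Taylor: "norm (?m (p, 0, 0) - S.mean_deriv ys (p - ys)) \<le> K2 * (norm (p - ys))\<^sup>2" for p
    using M.F_Taylor[of "(ys, 0, 0)" "(p, 0, 0)"] e0 by (simp add: m0 S.mean_deriv_def norm_Pair zero_prod_def)
  obtain C ea where C: "0 < C" and ea: "0 < ea" "S.small ea"
    "\<And>e. 0 < e \<Longrightarrow> e \<le> ea \<Longrightarrow> \<exists>p. norm (p - ys) \<le> C * e \<and> S.flow e p T = p"
    by (rule S.periodic_point_exists[OF m0 inj Taylor M.K_pos]) (assumption, rule that)
  obtain eb B where eb: "0 < eb" "S.small eb" and B: "0 \<le> B"
    and near: "\<And>e p f. 0 \<le> e \<Longrightarrow> e \<le> eb \<Longrightarrow> norm (p - ys) \<le> C * e \<Longrightarrow>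
      (\<And>x t. x \<in> D \<Longrightarrow> f t x = e *\<^sub>R G (x, t, e)) \<Longrightarrow>
      p \<in> interior (time_map_dom f D T) \<and> time_map f D T p = S.flow e p T \<and>
      solution_in f D {0..T} (S.flow e p) \<and>
      (\<exists>\<Lambda>. (time_map f D T has_derivative \<Lambda>) (at p) \<and>
        (\<forall>h. norm (\<Lambda> h - h - (e * T) *\<^sub>R S.mean_deriv ys h) \<le> B * e\<^sup>2 * norm h))"
    using S.time_map_near[OF ys(1), of C] C by (metis less_imp_le)
  obtain ec B' where ec: "0 < ec" "M.small ec" and B': "0 \<le> B'"
    and near': "\<And>e p f. 0 \<le> e \<Longrightarrow> e \<le> ec \<Longrightarrow> norm (p - ys) \<le> 0 * e \<Longrightarrow>
      (\<And>x t. x \<in> D \<Longrightarrow> f t x = e *\<^sub>R ?m (x, t, e)) \<Longrightarrow>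
      p \<in> interior (time_map_dom f D T) \<and> time_map f D T p = M.flow e p T \<and>
      solution_in f D {0..T} (M.flow e p) \<and>
      (\<exists>\<Lambda>. (time_map f D T has_derivative \<Lambda>) (at p) \<and>
        (\<forall>h. norm (\<Lambda> h - h - (e * T) *\<^sub>R M.mean_deriv ys h) \<le> B' * e\<^sup>2 * norm h))"
    using M.time_map_near[OF ys(1), of 0] by (metis order_refl)
  define e1 where "e1 = min ea eb"
  have e1: "0 < e1" "e1 \<le> ea" "e1 \<le> eb" "e1 \<le> \<epsilon>0" using ea(1,2) eb by (auto simp: e1_def S.small_def)
  have small: "S.small e" if "e \<in> {0..e1}" for e
  proof -
    have "e * (K1 * T) \<le> ea * (K1 * T)" using that e1 S.K_pos T by (intro mult_right_mono) auto
    then show ?thesis using ea(2) that e1 unfolding S.small_def mult.assoc by auto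
  qed
  define R where "R e \<gamma> \<longleftrightarrow> solution_in (\<lambda>t x. e *\<^sub>R g x t e) D UNIV \<gamma> \<and> (\<forall>t. \<gamma> (t + T) = \<gamma> t) \<and>
      (\<forall>t. norm (\<gamma> t - ys) \<le> (K1 * T + C) * e) \<and> norm (\<gamma> 0 - ys) \<le> C * e \<and> S.flow e (\<gamma> 0) T = \<gamma> 0" for e \<gamma>
  have "\<exists>\<gamma>. R e \<gamma>" if e: "e \<in> {0..e1}" for e
  proof -
    note se = small[OF e]
    have ee: "e \<in> {0..\<epsilon>0}" using e e1(4) by auto
    have "\<exists>p. norm (p - ys) \<le> C * e \<and> S.flow e p T = p"
    proof (cases "e = 0")
      case True
      have "norm (S.flow 0 ys T - S.flow 0 ys 0) \<le> 0 * K1 * T"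
        using S.sol_displacement[OF se S.flow_solves(2)[OF se], of T ys] T by (simp add: True)
      then show ?thesis using S.flow_solves(1)[OF se, of ys] by (intro exI[of _ ys]) (simp add: True)
    qed (use ea(3) e e1 in auto)
    then obtain p where p: "norm (p - ys) \<le> C * e" "S.flow e p T = p" by blast
    note fl = S.flow_solves[OF se, of p]
    have inD: "solution_in (\<lambda>t x. e *\<^sub>R g x t e) D {0..T} (S.flow e p)"
      using near[of e p "\<lambda>t x. e *\<^sub>R g x t e"] e e1(3) p(1) Gg[OF _ ee] by simp
    have per: "G (x, t + T, e) = G (x, t, e)" for x t using G(2) by (simp add: periodic_field_def)
    obtain \<gamma> where \<gamma>: "\<And>t. (\<gamma> has_vector_derivative e *\<^sub>R G (\<gamma> t, t, e)) (at t)" "\<And>t. \<gamma> (t + T) = \<gamma> t"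
      "\<And>t. \<exists>s\<in>{0..T}. \<gamma> t = S.flow e p s" "\<And>t. t \<in> {0..T} \<Longrightarrow> \<gamma> t = S.flow e p t"
      by (rule S.periodic_solution_extends[OF per fl(2)]) (simp only: p(2) fl(1), rule that)
    have \<gamma>0: "\<gamma> 0 = p" using \<gamma>(4)[of 0] T fl(1) by simp
    have "\<gamma> t \<in> D" for t using \<gamma>(3)[of t] inD by (auto simp: solution_in_def)
    then have "solution_in (\<lambda>t x. e *\<^sub>R g x t e) D UNIV \<gamma>"
      using \<gamma>(1) Gg[OF _ ee] by (simp add: solution_in_def)
    moreover have "norm (\<gamma> t - ys) \<le> (K1 * T + C) * e" for t
    proof -
      obtain s where s: "s \<in> {0..T}" "\<gamma> t = S.flow e p s" using \<gamma>(3) by blast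
      have "norm (S.flow e p s - p) \<le> e * K1 * T"
        using S.sol_displacement[OF se fl(2) s(1)] fl(1) by simp
      then show ?thesis
        using norm_triangle_ineq[of "S.flow e p s - p" "p - ys"] p(1) s(2) by (simp add: algebra_simps)
    qed
    ultimately have "R e \<gamma>" using \<gamma>(2) p \<gamma>0 by (simp add: R_def)
    then show ?thesis by blast
  qed
  then obtain \<gamma> where \<gamma>: "\<And>e. e \<in> {0..e1} \<Longrightarrow> R e (\<gamma> e)" by metis
  have stab: "\<exists>\<epsilon>2. 0 < \<epsilon>2 \<and> \<epsilon>2 \<le> e1 \<and> (\<forall>e\<in>{0<..\<epsilon>2}. same_stability_type D T
        (\<lambda>t x. e *\<^sub>R g x t e) (\<gamma> e 0) (\<lambda>t y. e *\<^sub>R time_average T g y) ys)"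
    if hyp: "\<forall>\<mu>. eigenvalue A \<mu> \<longrightarrow> Re \<mu> \<noteq> 0"
  proof -
    have hyp': "eigenvalue A \<mu> \<Longrightarrow> Re \<mu> \<noteq> 0" for \<mu> using hyp by blast
    obtain d1 where d1: "0 < d1"
      "\<forall>e L. 0 < e \<longrightarrow> e \<le> d1 \<longrightarrow> (\<forall>h. norm (L *v h - h - (e * T) *\<^sub>R (A *v h)) \<le> B * e\<^sup>2 * norm h) \<longrightarrow>
        (\<forall>\<mu>. eigenvalue L \<mu> \<longrightarrow> cmod \<mu> \<noteq> 1) \<and>
        eigenvalue_count L {\<mu>. cmod \<mu> < 1} = eigenvalue_count A {\<mu>. Re \<mu> < 0} \<and>
        eigenvalue_count L {\<mu>. cmod \<mu> > 1} = eigenvalue_count A {\<mu>. Re \<mu> > 0}"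
      using near_identity_hyperbolic[OF hyp' T B] by blast
    obtain d2 where d2: "0 < d2"
      "\<forall>e L. 0 < e \<longrightarrow> e \<le> d2 \<longrightarrow> (\<forall>h. norm (L *v h - h - (e * T) *\<^sub>R (A *v h)) \<le> B' * e\<^sup>2 * norm h) \<longrightarrow>
        (\<forall>\<mu>. eigenvalue L \<mu> \<longrightarrow> cmod \<mu> \<noteq> 1) \<and>
        eigenvalue_count L {\<mu>. cmod \<mu> < 1} = eigenvalue_count A {\<mu>. Re \<mu> < 0} \<and>
        eigenvalue_count L {\<mu>. cmod \<mu> > 1} = eigenvalue_count A {\<mu>. Re \<mu> > 0}"
      using near_identity_hyperbolic[OF hyp' T B'] by blast
    define e2 where "e2 = min e1 (min ec (min d1 d2))"
    have e2: "0 < e2" "e2 \<le> e1" "e2 \<le> ec" "e2 \<le> d1" "e2 \<le> d2" using e1 ec d1(1) d2(1) by (auto simp: e2_def)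
    have "same_stability_type D T (\<lambda>t x. e *\<^sub>R g x t e) (\<gamma> e 0) (\<lambda>t y. e *\<^sub>R time_average T g y) ys"
      if e: "e \<in> {0<..e2}" for e
    proof -
      let ?f = "\<lambda>t x. e *\<^sub>R g x t e" and ?h = "\<lambda>(t::real) y. e *\<^sub>R time_average T g y" and ?p = "\<gamma> e 0"
      have ee: "e \<in> {0..\<epsilon>0}" "e \<in> {0..e1}" "0 < e" using e e2 e1 by auto
      have Rg: "norm (?p - ys) \<le> C * e" "S.flow e ?p T = ?p" using \<gamma>[OF ee(2)] by (auto simp: R_def)
      obtain \<Lambda> where f: "?p \<in> interior (time_map_dom ?f D T)" "time_map ?f D T ?p = ?p"
        "(time_map ?f D T has_derivative \<Lambda>) (at ?p)"
        "\<And>h. norm (\<Lambda> h - h - (e * T) *\<^sub>R S.mean_deriv ys h) \<le> B * e\<^sup>2 * norm h"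
        using near[of e ?p ?f] e e2 e1 Rg Gg[OF _ ee(1)] by auto
      have sm: "M.small e"
      proof -
        have "e * (K2 * T) \<le> ec * (K2 * T)" using e e2 M.K_pos T by (intro mult_right_mono) auto
        then show ?thesis using ec(2) e e2 unfolding M.small_def mult.assoc by auto
      qed
      have "M.is_sol e (\<lambda>_. ys)" by (simp add: M.is_sol_def m0)
      from M.flow_unique[OF sm this, of T] have "M.flow e ys T = ys" using T by simp
      then obtain \<Lambda>' where h: "ys \<in> interior (time_map_dom ?h D T)" "time_map ?h D T ys = ys"
        "(time_map ?h D T has_derivative \<Lambda>') (at ys)"
        "\<And>h. norm (\<Lambda>' h - h - (e * T) *\<^sub>R S.mean_deriv ys h) \<le> B' * e\<^sup>2 * norm h"
        using near'[of e ys ?h] e e2 avg unfolding MJ by auto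
      let ?L = "jacobian (time_map ?f D T) (at ?p)" and ?L' = "jacobian (time_map ?h D T) (at ys)"
      have L: "norm (?L *v v - v - (e * T) *\<^sub>R (A *v v)) \<le> B * e\<^sup>2 * norm v" for v
        unfolding jacobian_mult_vec[OF f(3)] AJ by (rule f(4))
      have L': "norm (?L' *v v - v - (e * T) *\<^sub>R (A *v v)) \<le> B' * e\<^sup>2 * norm v" for v
        unfolding jacobian_mult_vec[OF h(3)] AJ by (rule h(4))
      have cL: "(\<forall>\<mu>. eigenvalue ?L \<mu> \<longrightarrow> cmod \<mu> \<noteq> 1) \<and>
        eigenvalue_count ?L {\<mu>. cmod \<mu> < 1} = eigenvalue_count A {\<mu>. Re \<mu> < 0} \<and>
        eigenvalue_count ?L {\<mu>. cmod \<mu> > 1} = eigenvalue_count A {\<mu>. Re \<mu> > 0}"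
        by (rule d1(2)[rule_format, OF ee(3) _ L]) (use e e2 in simp)
      have cL': "(\<forall>\<mu>. eigenvalue ?L' \<mu> \<longrightarrow> cmod \<mu> \<noteq> 1) \<and>
        eigenvalue_count ?L' {\<mu>. cmod \<mu> < 1} = eigenvalue_count A {\<mu>. Re \<mu> < 0} \<and>
        eigenvalue_count ?L' {\<mu>. cmod \<mu> > 1} = eigenvalue_count A {\<mu>. Re \<mu> > 0}"
        by (rule d2(2)[rule_format, OF ee(3) _ L']) (use e e2 in simp)
      have "time_map ?f D T differentiable (at ?p)" "time_map ?h D T differentiable (at ys)"
        using f(3) h(3) unfolding differentiable_def by blast+
      then show ?thesis
        unfolding same_stability_type_def hyperbolic_fixed_point_def
        using f(1,2) h(1,2) cL cL' by presburger
    qed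
    then show ?thesis using e2 by blast
  qed
  show ?thesis
    unfolding A_def[symmetric]
    using e1 \<gamma> stab unfolding R_def
    by (intro exI[of _ \<gamma>] exI[of _ "K1 * T + C"] exI[of _ e1]) blast
qed

theorem theorem3p2p3:
  fixes D :: "(real^'n) set" and r :: nat and T \<epsilon>0 :: real
    and g :: "real^'n \<Rightarrow> real \<Rightarrow> real \<Rightarrow> real^'n"
  assumes "compact D" and "2 \<le> r" and "0 < T" and "0 < \<epsilon>0"
    and periodic: "\<forall>x\<in>D. \<forall>t. \<forall>\<epsilon>\<in>{0..\<epsilon>0}. g x (t + T) \<epsilon> = g x t \<epsilon>"
    and smooth: "Ck_on r (\<lambda>(x, t, \<epsilon>). g x t \<epsilon>) (D \<times> UNIV \<times> {0..\<epsilon>0})"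
  shows
    "(\<exists>U \<epsilon>1 (w :: real^'n \<Rightarrow> real \<Rightarrow> real^'n) (g1 :: real^'n \<Rightarrow> real \<Rightarrow> real \<Rightarrow> real^'n).
        open U \<and> D \<subseteq> U \<and> 0 < \<epsilon>1 \<and> \<epsilon>1 \<le> \<epsilon>0 \<and>
        (\<forall>y\<in>U. \<forall>t. w y (t + T) = w y t) \<and>
        (\<forall>y\<in>D. \<forall>t. \<forall>\<epsilon>\<in>{0..\<epsilon>1}. g1 y (t + T) \<epsilon> = g1 y t \<epsilon>) \<and>
        Ck_on r (\<lambda>(y, t). w y t) (U \<times> UNIV) \<and>
        continuous_on (D \<times> UNIV \<times> {0..\<epsilon>1}) (\<lambda>(y, t, \<epsilon>). g1 y t \<epsilon>) \<and>
        (\<forall>\<epsilon>\<in>{0..\<epsilon>1}.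
           Ck_diffeo_on r (\<lambda>(y, t). (y + \<epsilon> *\<^sub>R w y t, t)) (U \<times> UNIV) \<and>
           D \<times> UNIV \<subseteq> (\<lambda>(y, t). (y + \<epsilon> *\<^sub>R w y t, t)) ` (U \<times> UNIV) \<and>
           (\<forall>J x y. is_interval J \<longrightarrow>
              (\<forall>t\<in>J. x t \<in> D \<and> y t \<in> D \<and> x t = y t + \<epsilon> *\<^sub>R w (y t) t) \<longrightarrow>
              (solution_in (\<lambda>t x. \<epsilon> *\<^sub>R g x t \<epsilon>) D J x \<longleftrightarrow>
               solution_in (\<lambda>t y. \<epsilon> *\<^sub>R time_average T g y + \<epsilon>\<^sup>2 *\<^sub>R g1 y t \<epsilon>) D J y))))
     \<and>
     (\<forall>c>0. \<forall>K. \<exists>C. \<forall>\<epsilon>\<in>{0<..\<epsilon>0}. \<forall>\<tau> x y.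
        \<tau> \<le> c / \<epsilon> \<longrightarrow>
        solution_in (\<lambda>t x. \<epsilon> *\<^sub>R g x t \<epsilon>) D {0..\<tau>} x \<longrightarrow>
        solution_in (\<lambda>t y. \<epsilon> *\<^sub>R time_average T g y) D {0..\<tau>} y \<longrightarrow>
        norm (x 0 - y 0) \<le> K * \<epsilon> \<longrightarrow>
        (\<forall>t\<in>{0..\<tau>}. norm (x t - y t) \<le> C * \<epsilon>))
     \<and>
     (\<forall>ys\<in>interior D.
        time_average T g ys = 0 \<longrightarrow>
        \<not> eigenvalue (jacobian (time_average T g) (at ys)) 0 \<longrightarrow>
        (\<exists>\<gamma> C \<epsilon>1. 0 < \<epsilon>1 \<and> \<epsilon>1 \<le> \<epsilon>0 \<and>
           (\<forall>\<epsilon>\<in>{0..\<epsilon>1}.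
              solution_in (\<lambda>t x. \<epsilon> *\<^sub>R g x t \<epsilon>) D UNIV (\<gamma> \<epsilon>) \<and>
              (\<forall>t. \<gamma> \<epsilon> (t + T) = \<gamma> \<epsilon> t) \<and>
              (\<forall>t. norm (\<gamma> \<epsilon> t - ys) \<le> C * \<epsilon>)) \<and>
           ((\<forall>\<mu>. eigenvalue (jacobian (time_average T g) (at ys)) \<mu> \<longrightarrow> Re \<mu> \<noteq> 0) \<longrightarrow>
            (\<exists>\<epsilon>2. 0 < \<epsilon>2 \<and> \<epsilon>2 \<le> \<epsilon>1 \<and>
               (\<forall>\<epsilon>\<in>{0<..\<epsilon>2}.
                  same_stability_type D T
                    (\<lambda>t x. \<epsilon> *\<^sub>R g x t \<epsilon>) (\<gamma> \<epsilon> 0)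
                    (\<lambda>t y. \<epsilon> *\<^sub>R time_average T g y) ys)))))"
proof -
  obtain G :: "(real^'n) \<times> real \<times> real \<Rightarrow> real^'n" and R where G: "Ck_open r G UNIV"
    "\<And>x t e. G (x, t + T, e) = G (x, t, e)" "\<And>x t e. R < norm x \<Longrightarrow> G (x, t, e) = 0"
    and Gg: "\<And>x t e. x \<in> D \<Longrightarrow> e \<in> {0..\<epsilon>0} \<Longrightarrow> G (x, t, e) = g x t e"
    using periodic_Ck_extension_exists[OF \<open>compact D\<close> compact_Icc \<open>0 < T\<close> periodic smooth] by metis
  have per: "periodic_field T G" using G(2,3) unfolding periodic_field_def by blast
  have G2: "Ck_open 2 G UNIV" using G(1) \<open>2 \<le> r\<close> by (rule Ck_open_mono)
  show ?thesis
    by (intro conjI allI ballI impI;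
        rule averaged_change_of_coordinates[OF \<open>0 < T\<close> \<open>0 < \<epsilon>0\<close> \<open>2 \<le> r\<close> G(1) per]
          averaged_trajectories_close[OF \<open>0 < T\<close> \<open>0 < \<epsilon>0\<close> G2 per]
          averaged_periodic_orbit[OF \<open>0 < T\<close> \<open>0 < \<epsilon>0\<close> G2 per];
        (erule (1) Gg | assumption))
qed

end
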